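(* The following commutative diagram, formed by Poisson maps, summarizes the evolution equations generated by the Hamiltonian $\mathcal{H}=\int u^2\,dx$ and the differential substitutions which relate these equations. The equations are $$\eta_t=S(\eta)\eta_x,\qquad \rho_t=\rho_{xxx}-\tfrac32\left(\rho_x^2/\rho\right)_x-\tfrac12(\rho^3)_x,\qquad \theta_t=\theta_{xxx}-\tfrac32\left(\theta_x^2/\theta\right)_x,$$ $$v_t=v_{xxx}-6v^2v_x,\qquad u_t=u_{xxx}+6uu_x,$$ and the arrows (Poisson maps, carrying each equation to the next) are $$\eta\mapsto\rho=\eta'/\eta,\quad \eta\mapsto\theta=\eta',\quad \eta\mapsto v=\tfrac12\eta''/\eta',\quad \eta\mapsto u=\tfrac12S(\eta),$$ $$\rho\mapsto v=\tfrac12(\rho+\rho'\rho^{-1}),\quad \theta\mapsto v=\tfrac12\theta'/\theta,\quad v\mapsto u=v'-v^2 .$$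
   Context: $\eta=\phi/\psi$ is the affine coordinate of a non-degenerate quasi-periodic projective curve on $\mathbb{R}$ (so that $\eta(x+2\pi)$ is a fractional linear transform of $\eta(x)$ by a matrix in $SL(2,\mathbb{C})$ and $u=\tfrac12S(\eta)$ is $2\pi$-periodic), where $S(\eta)=\frac{\eta'''}{\eta'}-\frac32\left(\frac{\eta''}{\eta'}\right)^2$ is the Schwarzian derivative; primes and subscripts $x$ denote $d/dx$. The Poisson brackets carried by the variables are: $$\{\eta(x),\eta(y)\}=\eta(x)^2-\eta(y)^2-\operatorname{sign}(x-y)(\eta(x)-\eta(y))^2,$$ $$\{\theta(x),\theta(y)\}=2\operatorname{sign}(x-y)\theta(x)\theta(y),$$ $$\{\rho(x),\rho(y)\}=2\rho(x)\rho(y)\left[\sinh\int_x^y\rho(s)\,ds+\operatorname{sign}(x-y)\cosh\int_x^y\rho(s)\,ds\right],$$ $$\{v(x),v(y)\}=\tfrac12\delta'(x-y),\qquad \{u(x),u(y)\}=\tfrac12\delta'''(x-y)+\delta'(x-y)[u(x)+u(y)],$$ the last one being the Virasoro bracket, with respect to which $\mathcal{H}$ generates the standard KdV equation.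
   Formalization: The printed brackets are mutually inconsistent (e.g. {v,v}=½δ' maps to minus the Virasoro bracket under u=v'−v²); here the Virasoro bracket and H are kept, the η, ρ, θ brackets are multiplied by 1/2 and the v bracket by −1. *)

theory Defs
  imports "HOL-Analysis.Analysis"
begin

section \<open>Fields and differential substitutions\<close>

text \<open>All fields are complex valued functions of a real variable.\<close>

type_synonym field = "real \<Rightarrow> complex"

definition D :: "field \<Rightarrow> field" where
  "D f = (\<lambda>x. vector_derivative f (at x))"

definition smooth :: "field \<Rightarrow> bool" where
  "smooth f \<longleftrightarrow> (\<forall>n x. ((D ^^ n) f) differentiable (at x))"

text \<open>
  \<open>smooth_family T V\<close>: on the open set \<open>T \<times> UNIV\<close> all iterated partial derivatives of
  \<open>(t, x) \<mapsto> V t x\<close> exist and are (jointly) continuous.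
\<close>

coinductive smooth_family :: "real set \<Rightarrow> (real \<Rightarrow> field) \<Rightarrow> bool" for T where
  "\<lbrakk>continuous_on (T \<times> UNIV) (\<lambda>(t, x). V t x);
    \<And>t x. t \<in> T \<Longrightarrow> ((\<lambda>\<tau>. V \<tau> x) has_vector_derivative Vt t x) (at t);
    \<And>t x. t \<in> T \<Longrightarrow> ((\<lambda>\<xi>. V t \<xi>) has_vector_derivative Vx t x) (at x);
    smooth_family T Vt; smooth_family T Vx\<rbrakk>
   \<Longrightarrow> smooth_family T V"

definition schwarzian :: "field \<Rightarrow> field" where
  "schwarzian \<eta> = (\<lambda>x. (D ^^ 3) \<eta> x / D \<eta> x - 3/2 * ((D ^^ 2) \<eta> x / D \<eta> x)\<^sup>2)"

definition rho_of_eta :: "field \<Rightarrow> field" where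
  "rho_of_eta \<eta> = (\<lambda>x. D \<eta> x / \<eta> x)"

definition theta_of_eta :: "field \<Rightarrow> field" where
  "theta_of_eta \<eta> = D \<eta>"

definition v_of_eta :: "field \<Rightarrow> field" where
  "v_of_eta \<eta> = (\<lambda>x. 1/2 * ((D ^^ 2) \<eta> x / D \<eta> x))"

definition u_of_eta :: "field \<Rightarrow> field" where
  "u_of_eta \<eta> = (\<lambda>x. 1/2 * schwarzian \<eta> x)"

definition v_of_rho :: "field \<Rightarrow> field" where
  "v_of_rho \<rho> = (\<lambda>x. 1/2 * (\<rho> x + D \<rho> x / \<rho> x))"

definition v_of_theta :: "field \<Rightarrow> field" where
  "v_of_theta \<theta> = (\<lambda>x. 1/2 * (D \<theta> x / \<theta> x))"

definition u_of_v :: "field \<Rightarrow> field" where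
  "u_of_v v = (\<lambda>x. D v x - (v x)\<^sup>2)"


section \<open>Brackets as distribution kernels\<close>

text \<open>
  A bracket \<open>{w(x), w(y)}\<close> is a distribution in \<open>(x, y)\<close> depending on the field \<open>w\<close>.  It is
  represented by the operator sending a test function \<open>f\<close> to the function
  \<open>y \<mapsto> \<integral> f(x) {w(x), w(y)} dx\<close>.
  For a kernel \<open>c(x, y) \<delta>\<^sup>(\<^sup>n\<^sup>)(x - y)\<close> this function is
  \<open>(-1)\<^sup>n (d/dx)\<^sup>n [f(x) c(x, y)]\<close> at \<open>x = y\<close>.
\<close>

definition function_kernel :: "(real \<Rightarrow> real \<Rightarrow> complex) \<Rightarrow> field \<Rightarrow> field" where
  "function_kernel K f = (\<lambda>y. integral UNIV (\<lambda>x. f x * K x y))"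

definition delta_kernel :: "nat \<Rightarrow> (real \<Rightarrow> real \<Rightarrow> complex) \<Rightarrow> field \<Rightarrow> field" where
  "delta_kernel n c f = (\<lambda>y. (-1) ^ n * (D ^^ n) (\<lambda>x. f x * c x y) y)"

definition eta_bracket :: "field \<Rightarrow> field \<Rightarrow> field" where
  "eta_bracket \<eta> = function_kernel (\<lambda>x y.
     (\<eta> x)\<^sup>2 - (\<eta> y)\<^sup>2 - of_real (sgn (x - y)) * (\<eta> x - \<eta> y)\<^sup>2)"

definition theta_bracket :: "field \<Rightarrow> field \<Rightarrow> field" where
  "theta_bracket \<theta> = function_kernel (\<lambda>x y. 2 * of_real (sgn (x - y)) * \<theta> x * \<theta> y)"

definition rho_bracket :: "field \<Rightarrow> field \<Rightarrow> field" where
  "rho_bracket \<rho> = function_kernel (\<lambda>x y. 2 * \<rho> x * \<rho> y *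
     (sinh (LBINT s=ereal x..ereal y. \<rho> s)
      + of_real (sgn (x - y)) * cosh (LBINT s=ereal x..ereal y. \<rho> s)))"

definition v_bracket :: "field \<Rightarrow> field \<Rightarrow> field" where
  "v_bracket v f = (\<lambda>y. 1/2 * delta_kernel 1 (\<lambda>x y. 1) f y)"

definition u_bracket :: "field \<Rightarrow> field \<Rightarrow> field" where
  "u_bracket u f =
     (\<lambda>y. 1/2 * delta_kernel 3 (\<lambda>x y. 1) f y + delta_kernel 1 (\<lambda>x y. u x + u y) f y)"

definition rescale :: "real \<Rightarrow> (field \<Rightarrow> field \<Rightarrow> field) \<Rightarrow> field \<Rightarrow> field \<Rightarrow> field" where
  "rescale c P w f = (\<lambda>y. of_real c * P w f y)"


section \<open>Phase spaces\<close>

text \<open>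
  \<open>points\<close> is the phase space proper.  On a compact part of a window \<open>(a, a + 2\<pi>)\<close> a field
  in \<open>points\<close> is arbitrary apart from the non-degeneracy condition, so variations and
  functionals supported in such a window are taken over the larger set \<open>admissible\<close>, where
  no quasi-periodicity is imposed.  Kernels are likewise only used for arguments whose distance
  is less than \<open>2\<pi>\<close>; beyond that the bracket of a quasi-periodic field involves its
  monodromy.
\<close>

record phase_space =
  admissible :: "field set"
  points :: "field set"
  poisson :: "field \<Rightarrow> field \<Rightarrow> field"

definition periodic :: "field \<Rightarrow> bool" where
  "periodic u \<longleftrightarrow> (\<forall>x. u (x + 2 * pi) = u x)"

definition quasi_periodic :: "field \<Rightarrow> bool" where
  "quasi_periodic \<eta> \<longleftrightarrow> (\<exists>a b c d. a * d - b * c = 1 \<and>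
     (\<forall>x. c * \<eta> x + d \<noteq> 0 \<and> \<eta> (x + 2 * pi) = (a * \<eta> x + b) / (c * \<eta> x + d)))"

text \<open>
  Normalization.  The kernels above are taken as published,
  \<open>{\<eta>(x), \<eta>(y)} = \<eta>(x)\<^sup>2 - \<eta>(y)\<^sup>2 - sign(x - y) (\<eta>(x) - \<eta>(y))\<^sup>2\<close>, ...,
  \<open>{v(x), v(y)} = 1/2 \<delta>'(x - y)\<close>, whose entries are not mutually normalized.
  With \<open>sign' = 2\<delta>\<close> the bracket \<open>2 sign(x - y) \<theta>(x) \<theta>(y)\<close> gives
  \<open>{v(x), v(y)} = 1/4 \<partial>\<^sub>x \<partial>\<^sub>y (2 sign(x - y)) = - \<delta>'(x - y)\<close> for \<open>v = \<theta>'/(2\<theta>)\<close>;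
  and \<open>{v(x), v(y)} = c \<delta>'(x - y)\<close> gives
  \<open>{u(x), u(y)} = -2c (1/2 \<delta>''' + \<delta>' (u(x) + u(y)))\<close> for \<open>u = v' - v\<^sup>2\<close>.
  The Virasoro bracket and the Hamiltonian \<open>\<integral> u\<^sup>2\<close>, which yield the equation
  \<open>u\<^sub>t = u\<^sub>x\<^sub>x\<^sub>x + 6 u u\<^sub>x\<close>, are kept; then the maps below are Poisson exactly when the
  brackets of \<open>\<eta>\<close>, \<open>\<rho>\<close>, \<open>\<theta>\<close> are multiplied by \<open>1/2\<close> and that of \<open>v\<close>
  by \<open>-1\<close>.  The same factors are required for \<open>\<integral> u\<^sup>2\<close> to generate the five equations.
\<close>

definition eta_space :: phase_space where
  "eta_space =
    \<lparr>admissible = {\<eta>. smooth \<eta> \<and> (\<forall>x. D \<eta> x \<noteq> 0)},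
     points = {\<eta>. smooth \<eta> \<and> (\<forall>x. D \<eta> x \<noteq> 0) \<and> quasi_periodic \<eta>},
     poisson = rescale (1/2) eta_bracket\<rparr>"

text \<open>The open part of \<open>eta_space\<close> on which \<open>\<rho> = \<eta>'/\<eta>\<close> is defined.\<close>

definition eta_nz_space :: phase_space where
  "eta_nz_space =
    \<lparr>admissible = {\<eta> \<in> admissible eta_space. \<forall>x. \<eta> x \<noteq> 0},
     points = {\<eta> \<in> points eta_space. \<forall>x. \<eta> x \<noteq> 0},
     poisson = poisson eta_space\<rparr>"

definition rho_space :: phase_space where
  "rho_space =
    \<lparr>admissible = {\<rho>. smooth \<rho> \<and> (\<forall>x. \<rho> x \<noteq> 0)},
     points = {\<rho>. smooth \<rho> \<and> (\<forall>x. \<rho> x \<noteq> 0) \<and> periodic (u_of_v (v_of_rho \<rho>))},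
     poisson = rescale (1/2) rho_bracket\<rparr>"

definition theta_space :: phase_space where
  "theta_space =
    \<lparr>admissible = {\<theta>. smooth \<theta> \<and> (\<forall>x. \<theta> x \<noteq> 0)},
     points = {\<theta>. smooth \<theta> \<and> (\<forall>x. \<theta> x \<noteq> 0) \<and> periodic (u_of_v (v_of_theta \<theta>))},
     poisson = rescale (1/2) theta_bracket\<rparr>"

definition v_space :: phase_space where
  "v_space =
    \<lparr>admissible = {v. smooth v},
     points = {v. smooth v \<and> periodic (u_of_v v)},
     poisson = rescale (-1) v_bracket\<rparr>"

definition u_space :: phase_space where
  "u_space =
    \<lparr>admissible = {u. smooth u},
     points = {u. smooth u \<and> periodic u},
     poisson = u_bracket\<rparr>"


section \<open>Functionals, Poisson maps, Hamiltonian evolution\<close>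

definition test_function :: "real \<Rightarrow> field \<Rightarrow> bool" where
  "test_function a f \<longleftrightarrow> smooth f \<and>
     (\<exists>c d. a < c \<and> d < a + 2 * pi \<and> (\<forall>x. x \<notin> {c..d} \<longrightarrow> f x = 0))"

text \<open>
  \<open>f = \<delta>F/\<delta>w\<close> at \<open>w\<close>, the functional \<open>F\<close> being differentiated along all smooth curves
  of admissible fields through \<open>w\<close>, and \<open>f\<close> being a test function on the window at \<open>a\<close>.
\<close>

definition has_variational_derivative ::
    "phase_space \<Rightarrow> real \<Rightarrow> (field \<Rightarrow> complex) \<Rightarrow> field \<Rightarrow> field \<Rightarrow> bool" where
  "has_variational_derivative M a F w f \<longleftrightarrow> test_function a f \<and>
     (\<forall>W. smooth_family UNIV W \<and> (\<forall>s. W s \<in> admissible M) \<and> W 0 = w \<longrightarrow>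
       ((\<lambda>s. F (W s)) has_vector_derivative
          integral UNIV (\<lambda>x. f x * vector_derivative (\<lambda>s. W s x) (at 0))) (at 0))"

definition local_functional_at ::
    "phase_space \<Rightarrow> real \<Rightarrow> (field \<Rightarrow> complex) \<Rightarrow> field \<Rightarrow> bool" where
  "local_functional_at M a F w \<longleftrightarrow> (\<exists>f. has_variational_derivative M a F w f)"

definition variational_derivative ::
    "phase_space \<Rightarrow> real \<Rightarrow> (field \<Rightarrow> complex) \<Rightarrow> field \<Rightarrow> field" where
  "variational_derivative M a F w = (THE f. has_variational_derivative M a F w f)"

text \<open>The vector field \<open>y \<mapsto> {F, w(y)}\<close>.\<close>

definition bracket_field ::
    "phase_space \<Rightarrow> real \<Rightarrow> (field \<Rightarrow> complex) \<Rightarrow> field \<Rightarrow> field" where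
  "bracket_field M a F w = poisson M w (variational_derivative M a F w)"

definition bracket ::
    "phase_space \<Rightarrow> real \<Rightarrow> (field \<Rightarrow> complex) \<Rightarrow> (field \<Rightarrow> complex) \<Rightarrow> field \<Rightarrow> complex"
  where
  "bracket M a F G w =
     integral UNIV (\<lambda>y. bracket_field M a F w y * variational_derivative M a G w y)"

definition poisson_map :: "phase_space \<Rightarrow> phase_space \<Rightarrow> (field \<Rightarrow> field) \<Rightarrow> bool" where
  "poisson_map M N \<Phi> \<longleftrightarrow>
     \<Phi> ` admissible M \<subseteq> admissible N \<and> \<Phi> ` points M \<subseteq> points N \<and>
     (\<forall>W. smooth_family UNIV W \<and> (\<forall>s. W s \<in> admissible M) \<longrightarrow>
        smooth_family UNIV (\<lambda>s. \<Phi> (W s))) \<and>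
     (\<forall>a F G w. w \<in> points M \<and>
        local_functional_at N a F (\<Phi> w) \<and> local_functional_at N a G (\<Phi> w) \<longrightarrow>
        local_functional_at M a (F \<circ> \<Phi>) w \<and> local_functional_at M a (G \<circ> \<Phi>) w \<and>
        bracket M a (F \<circ> \<Phi>) (G \<circ> \<Phi>) w = bracket N a F G (\<Phi> w))"

text \<open>
  The integral of \<open>u\<^sup>2\<close> over one period; it does not depend on \<open>a\<close> when \<open>u\<close> is periodic.
\<close>

definition energy :: "real \<Rightarrow> field \<Rightarrow> complex" where
  "energy a u = integral {a..a + 2 * pi} (\<lambda>x. (u x)\<^sup>2)"

text \<open>
  The evolution \<open>w\<^sub>t = Z w\<close> is generated by \<open>\<H> = \<integral> (U w)\<^sup>2\<close>, that is
  \<open>w\<^sub>t = {w, \<H>}\<close>: along it every local functional satisfies \<open>dF/dt = {F, \<H>}\<close>, where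
  \<open>dF/dt = \<integral> (\<delta>F/\<delta>w) Z w\<close>.  As \<open>\<H>\<close> is an integral over a whole period its variational
  derivative is not a test function, and \<open>{F, \<H>}\<close> is the derivative of \<open>\<H>\<close> along the vector
  field \<open>{F, w(y)}\<close>.
\<close>

definition generated_by_energy ::
    "phase_space \<Rightarrow> (field \<Rightarrow> field) \<Rightarrow> (field \<Rightarrow> field) \<Rightarrow> bool" where
  "generated_by_energy M U Z \<longleftrightarrow>
     (\<forall>a F w. w \<in> points M \<and> local_functional_at M a F w \<longrightarrow>
       ((\<lambda>s. energy a (U (\<lambda>y. w y + of_real s * bracket_field M a F w y)))
          has_vector_derivative
        integral UNIV (\<lambda>x. variational_derivative M a F w x * Z w x)) (at 0))"

definition solution ::
    "phase_space \<Rightarrow> (field \<Rightarrow> field) \<Rightarrow> real set \<Rightarrow> (real \<Rightarrow> field) \<Rightarrow> bool" where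
  "solution M Z T W \<longleftrightarrow> smooth_family T W \<and> (\<forall>t\<in>T. W t \<in> points M) \<and>
     (\<forall>t\<in>T. \<forall>x. ((\<lambda>\<tau>. W \<tau> x) has_vector_derivative Z (W t) x) (at t))"

definition carries_solutions ::
    "phase_space \<Rightarrow> (field \<Rightarrow> field) \<Rightarrow> phase_space \<Rightarrow> (field \<Rightarrow> field) \<Rightarrow> (field \<Rightarrow> field) \<Rightarrow> bool"
  where
  "carries_solutions M Z N Z' \<Phi> \<longleftrightarrow>
     (\<forall>T W. open T \<and> solution M Z T W \<longrightarrow> solution N Z' T (\<lambda>t. \<Phi> (W t)))"


section \<open>The evolution equations\<close>

definition eta_rhs :: "field \<Rightarrow> field" where
  "eta_rhs \<eta> = (\<lambda>x. schwarzian \<eta> x * D \<eta> x)"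

definition rho_rhs :: "field \<Rightarrow> field" where
  "rho_rhs \<rho> = (\<lambda>x. (D ^^ 3) \<rho> x - 3/2 * D (\<lambda>x. (D \<rho> x)\<^sup>2 / \<rho> x) x
                     - 1/2 * D (\<lambda>x. \<rho> x ^ 3) x)"

definition theta_rhs :: "field \<Rightarrow> field" where
  "theta_rhs \<theta> = (\<lambda>x. (D ^^ 3) \<theta> x - 3/2 * D (\<lambda>x. (D \<theta> x)\<^sup>2 / \<theta> x) x)"

definition v_rhs :: "field \<Rightarrow> field" where
  "v_rhs v = (\<lambda>x. (D ^^ 3) v x - 6 * (v x)\<^sup>2 * D v x)"

definition u_rhs :: "field \<Rightarrow> field" where
  "u_rhs u = (\<lambda>x. (D ^^ 3) u x + 6 * u x * D u x)"

end

theory Submission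
  imports Defs
begin

text \<open>
  Every arrow of the diagram linearizes to a first order operator
  \<open>\<phi> \<mapsto> (k \<phi>)' + m \<phi>\<close> with formal adjoint \<open>g \<mapsto> m g - k g'\<close>.  Pulling a functional back
  replaces its variational derivative \<open>g\<close> by the adjoint applied to \<open>g\<close>, so the arrow is Poisson
  as soon as the linearization, the source bracket and the adjoint compose to the target bracket.
  All nonlocal brackets are combinations of products of local terms with the transform
  \<open>h \<mapsto> \<integral> h(x) sgn(x - y) dx\<close>, whose derivative is \<open>-2h\<close>, which reduces this to differential algebra.
  The equations take the form \<open>\<eta>\<^sub>t = 2u\<eta>'\<close>, \<open>\<theta>\<^sub>t = (2u\<theta>)'\<close>, \<open>\<rho>\<^sub>t = (2u\<rho>)'\<close>,
  \<open>v\<^sub>t = (u' + 2uv)'\<close>, from which both their compatibility with the arrows and their generation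
  by \<open>\<integral> u\<^sup>2\<close> can be read off: a bracket field changes \<open>u\<close> by \<open>f\<eta>'\<close>, \<open>-f'\<theta>\<close>, \<open>-f'\<rho>\<close>,
  \<open>f''/2 - vf'\<close> respectively, which is supported in the window although the bracket field itself is not.
\<close>

section \<open>Smooth families\<close>

text \<open>Besides the algebra there are analytic obstacles. The variational derivative is a
  \<open>THE\<close>, so nothing can be computed before it is shown unique. That needs curves which
  stay admissible for every real parameter, although non-vanishing survives only small
  perturbations; a bounded reparametrization of a compactly supported perturbation supplies them.
  Linearizing a substitution that contains derivatives requires exchanging the time derivative with
  \<open>D\<close>, which is why families are smooth jointly in time and position. Since bracket
  fields need not have compact support, the adjoint identity is proved for every smooth argument,
  and even a small multiple of a bracket field may create zeros far from the window; the energy is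
  therefore differentiated through pointwise formulas valid on the window. The bracket of \<rho>
  contains exponentials of integrals and is made separable by any \<open>E\<close> with E' = \<rho>
  E; along the arrow from \<eta> the curve \<eta> itself is such an \<open>E\<close>. The arrows
  from \<eta> to v and u need no bracket computation, being composites through \<theta>.\<close>

lemma D_eqI:
  assumes "\<And>x. (f has_vector_derivative g x) (at x)"
  shows "D f = g"
  using assms by (auto simp: D_def vector_derivative_at)

lemma smooth_imp_has_D:
  assumes "smooth f"
  shows "(f has_vector_derivative D f x) (at x)"
proof -
  have "((D ^^ 0) f) differentiable (at x)"
    using assms unfolding smooth_def by blast
  then show ?thesis
    by (simp add: D_def vector_derivative_works)
qed

lemma smooth_D: "smooth f \<Longrightarrow> smooth (D f)"
  unfolding smooth_def by (metis funpow_Suc_right comp_apply)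

lemma smoothI:
  assumes "\<And>x. (f has_vector_derivative g x) (at x)" and "smooth g"
  shows "smooth f"
  unfolding smooth_def
proof (intro allI)
  fix n x
  have "D f = g"
    by (rule D_eqI) fact
  then show "((D ^^ n) f) differentiable (at x)"
  proof (cases n)
    case 0
    then show ?thesis
      using assms(1) differentiableI_vector by auto
  next
    case (Suc m)
    have "(D ^^ n) f = (D ^^ m) g"
      by (simp only: Suc funpow_Suc_right comp_apply \<open>D f = g\<close>)
    then show ?thesis
      using assms(2) by (simp add: smooth_def)
  qed
qed

lemma smooth_imp_continuous_on: "smooth f \<Longrightarrow> continuous_on A f"
  using smooth_imp_has_D continuous_at_imp_continuous_on has_vector_derivative_continuous
  by blast

definition dt :: "(real \<Rightarrow> field) \<Rightarrow> real \<Rightarrow> field" where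
  "dt V t = (\<lambda>x. vector_derivative (\<lambda>\<tau>. V \<tau> x) (at t))"

text \<open>A time derivative at a point of \<open>T\<close> depends on nearby times only, and these
  lie in \<open>T\<close> because it is open. Hence agreement on \<open>T\<close> lets the witnesses
  for \<open>V\<close> serve for \<open>V'\<close> as well.\<close>

lemma smooth_family_cong:
  assumes "smooth_family T V" "open T" "\<And>t. t \<in> T \<Longrightarrow> V' t = V t"
  shows "smooth_family T V'"
  using assms(1,3)
proof (coinduction arbitrary: V V')
  case smooth_family
  from smooth_family(1) obtain Vt Vx where
    V: "continuous_on (T \<times> UNIV) (\<lambda>(t, x). V t x)"
      "\<And>t x. t \<in> T \<Longrightarrow> ((\<lambda>\<tau>. V \<tau> x) has_vector_derivative Vt t x) (at t)"
      "\<And>t x. t \<in> T \<Longrightarrow> ((\<lambda>\<xi>. V t \<xi>) has_vector_derivative Vx t x) (at x)"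
      "smooth_family T Vt" "smooth_family T Vx"
    by (rule smooth_family.cases) blast
  have "continuous_on (T \<times> UNIV) (\<lambda>(t, x). V' t x)"
    using V(1) by (rule continuous_on_eq) (auto simp: smooth_family(2))
  moreover have "((\<lambda>\<tau>. V' \<tau> x) has_vector_derivative Vt t x) (at t)" if "t \<in> T" for t x
    by (rule has_vector_derivative_transform_within_open[OF V(2)[OF that] \<open>open T\<close> that])
      (use smooth_family(2) in simp)
  moreover have "(V' t has_vector_derivative Vx t x) (at x)" if "t \<in> T" for t x
    using V(3)[OF that] smooth_family(2) that by simp
  ultimately show ?case
    using V(4,5) by blast
qed

lemma smooth_family_const_in_time:
  assumes "smooth f"
  shows "smooth_family T (\<lambda>_. f)"
proof -
  have "smooth_family T V" if "\<exists>f. smooth f \<and> V = (\<lambda>_. f)" for V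
    using that
  proof (coinduction arbitrary: V)
    case smooth_family
    then obtain f where f: "smooth f" and V: "V = (\<lambda>_. f)"
      by blast
    \<comment> \<open>The time derivative of a constant family is the zero family, which must itself
      satisfy the coinduction invariant.\<close>
    have "smooth (\<lambda>_. 0)"
    proof -
      have "(D ^^ n) (\<lambda>_. 0) = (\<lambda>_. 0)" for n
        by (induction n) (auto simp: D_def)
      then show ?thesis
        by (simp add: smooth_def)
    qed
    moreover have "continuous_on (T \<times> UNIV) (\<lambda>(t, x). V t x)"
      using f unfolding V split_beta
      by (intro continuous_on_compose2[OF smooth_imp_continuous_on[of f UNIV]] continuous_intros) auto
    moreover have "((\<lambda>\<tau>. V \<tau> x) has_vector_derivative 0) (at t)" for t x
      by (simp add: V)
    moreover have "(V t has_vector_derivative D f x) (at x)" for t x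
      using smooth_imp_has_D[OF f] by (simp add: V)
    ultimately show ?case
      using smooth_D[OF f]
      by (intro exI[of _ V] exI[of _ "\<lambda>_ _. 0"] exI[of _ "\<lambda>_. D f"]) blast
  qed
  then show ?thesis
    using assms by blast
qed

text \<open>The coinductive rule yields anonymous witnesses. Uniqueness of derivatives identifies
  them on \<open>T\<close> with \<open>dt V\<close> and \<open>D (V t)\<close>, and
  \<open>smooth_family_cong\<close> carries their smoothness over to these canonical
  partials.\<close>

lemma smooth_familyE:
  assumes "smooth_family T V" "open T"
  shows "continuous_on (T \<times> UNIV) (\<lambda>(t, x). V t x)"
    and "\<And>t x. t \<in> T \<Longrightarrow> ((\<lambda>\<tau>. V \<tau> x) has_vector_derivative dt V t x) (at t)"
    and "\<And>t x. t \<in> T \<Longrightarrow> (V t has_vector_derivative D (V t) x) (at x)"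
    and "smooth_family T (dt V)" and "smooth_family T (\<lambda>t. D (V t))"
proof -
  from assms(1) obtain Vt Vx where
    V: "continuous_on (T \<times> UNIV) (\<lambda>(t, x). V t x)"
      "\<And>t x. t \<in> T \<Longrightarrow> ((\<lambda>\<tau>. V \<tau> x) has_vector_derivative Vt t x) (at t)"
      "\<And>t x. t \<in> T \<Longrightarrow> ((\<lambda>\<xi>. V t \<xi>) has_vector_derivative Vx t x) (at x)"
      "smooth_family T Vt" "smooth_family T Vx"
    by (rule smooth_family.cases) blast
  have dt: "dt V t = Vt t" if "t \<in> T" for t
    using V(2)[OF that] by (auto simp: dt_def vector_derivative_at)
  have D: "D (V t) = Vx t" if "t \<in> T" for t
    by (rule D_eqI) (use V(3) that in auto)
  show "continuous_on (T \<times> UNIV) (\<lambda>(t, x). V t x)"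
    by fact
  show "\<And>t x. t \<in> T \<Longrightarrow> ((\<lambda>\<tau>. V \<tau> x) has_vector_derivative dt V t x) (at t)"
    "\<And>t x. t \<in> T \<Longrightarrow> (V t has_vector_derivative D (V t) x) (at x)"
    using V dt D by auto
  show "smooth_family T (dt V)"
    by (rule smooth_family_cong[OF V(4) assms(2) dt])
  show "smooth_family T (\<lambda>t. D (V t))"
    by (rule smooth_family_cong[OF V(5) assms(2) D])
qed

lemma smooth_family_imp_smooth:
  assumes "smooth_family T V" "open T" "t \<in> T"
  shows "smooth (V t)"
  unfolding smooth_def
proof (intro allI)
  fix n x
  have "smooth_family T (\<lambda>t. (D ^^ n) (V t))"
    by (induction n) (auto simp: assms intro: smooth_familyE(5))
  then show "((D ^^ n) (V t)) differentiable (at x)"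
    using smooth_familyE(3)[OF _ assms(2,3)] differentiableI_vector by blast
qed

text \<open>
  A product differentiates into a sum of products, so closure of \<open>smooth_family\<close> under
  the field operations is shown by coinduction on this whole algebra at once.
\<close>

inductive family_algebra :: "real set \<Rightarrow> (real \<Rightarrow> field) \<Rightarrow> bool" for T where
  base: "smooth_family T V \<Longrightarrow> family_algebra T V"
| const: "family_algebra T (\<lambda>t x. c)"
| time: "family_algebra T (\<lambda>t x. of_real t)"
| add: "family_algebra T V \<Longrightarrow> family_algebra T W \<Longrightarrow> family_algebra T (\<lambda>t x. V t x + W t x)"
| mult: "family_algebra T V \<Longrightarrow> family_algebra T W \<Longrightarrow> family_algebra T (\<lambda>t x. V t x * W t x)"
| inverse: "family_algebra T V \<Longrightarrow> (\<And>t x. t \<in> T \<Longrightarrow> V t x \<noteq> 0) \<Longrightarrow>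
    family_algebra T (\<lambda>t x. inverse (V t x))"
| exp: "family_algebra T V \<Longrightarrow> family_algebra T (\<lambda>t x. exp (V t x))"

lemma has_vector_derivative_inverse:
  fixes f :: "real \<Rightarrow> complex"
  assumes "(f has_vector_derivative f') (at x)" "f x \<noteq> 0"
  shows "((\<lambda>x. inverse (f x)) has_vector_derivative - (f' * (inverse (f x) * inverse (f x)))) (at x)"
  using field_vector_diff_chain_at[OF assms(1) DERIV_inverse[OF assms(2)]]
  by (simp add: o_def numeral_2_eq_2)

lemma has_vector_derivative_exp:
  fixes f :: "real \<Rightarrow> complex"
  assumes "(f has_vector_derivative f') (at x)"
  shows "((\<lambda>x. exp (f x)) has_vector_derivative f' * exp (f x)) (at x)"
  using field_vector_diff_chain_at[OF assms DERIV_exp] by (simp add: o_def)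

text \<open>One unfolding of the coinductive rule without its recursive premises. Projections
  instead of a tuple pattern match the form expected by the continuity rules.\<close>

definition partials ::
    "real set \<Rightarrow> (real \<Rightarrow> field) \<Rightarrow> (real \<Rightarrow> field) \<Rightarrow> (real \<Rightarrow> field) \<Rightarrow> bool" where
  "partials T V Vt Vx \<longleftrightarrow> continuous_on (T \<times> UNIV) (\<lambda>p. V (fst p) (snd p)) \<and>
    (\<forall>t\<in>T. \<forall>x. ((\<lambda>\<tau>. V \<tau> x) has_vector_derivative Vt t x) (at t) \<and>
      (V t has_vector_derivative Vx t x) (at x))"

lemma partials_const: "partials T (\<lambda>t x. c) (\<lambda>t x. 0) (\<lambda>t x. 0)"
  by (simp add: partials_def)

lemma partials_time: "partials T (\<lambda>t x. of_real t) (\<lambda>t x. 1) (\<lambda>t x. 0)"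
proof -
  have "((\<lambda>\<tau>. complex_of_real \<tau>) has_vector_derivative 1) (at t)" for t
    using has_vector_derivative_of_real[OF DERIV_ident] by simp
  then show ?thesis
    unfolding partials_def by (auto intro: continuous_intros)
qed

lemma partials_add:
  assumes "partials T V Vt Vx" "partials T W Wt Wx"
  shows "partials T (\<lambda>t x. V t x + W t x) (\<lambda>t x. Vt t x + Wt t x) (\<lambda>t x. Vx t x + Wx t x)"
  using assms unfolding partials_def by (auto intro!: continuous_on_add has_vector_derivative_add)

lemma partials_mult:
  assumes "partials T V Vt Vx" "partials T W Wt Wx"
  shows "partials T (\<lambda>t x. V t x * W t x) (\<lambda>t x. V t x * Wt t x + Vt t x * W t x)
    (\<lambda>t x. V t x * Wx t x + Vx t x * W t x)"
  using assms unfolding partials_def by (auto intro!: continuous_on_mult has_vector_derivative_mult)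

text \<open>The derivatives are written with a factor -1 and products of inverses so that they are
  literally members of \<open>family_algebra\<close>, whose constructors include neither negation
  nor division nor powers.\<close>

lemma partials_inverse:
  assumes "partials T V Vt Vx" "\<And>t x. t \<in> T \<Longrightarrow> V t x \<noteq> 0"
  shows "partials T (\<lambda>t x. inverse (V t x))
    (\<lambda>t x. (-1) * (Vt t x * (inverse (V t x) * inverse (V t x))))
    (\<lambda>t x. (-1) * (Vx t x * (inverse (V t x) * inverse (V t x))))"
  using assms unfolding partials_def
  by (auto intro!: continuous_on_inverse has_vector_derivative_inverse)

lemma partials_exp:
  assumes "partials T V Vt Vx"
  shows "partials T (\<lambda>t x. exp (V t x)) (\<lambda>t x. Vt t x * exp (V t x)) (\<lambda>t x. Vx t x * exp (V t x))"
  using assms unfolding partials_def by (auto intro!: continuous_on_exp has_vector_derivative_exp)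

lemma family_algebra_partials:
  assumes "family_algebra T V" "open T"
  shows "\<exists>Vt Vx. partials T V Vt Vx \<and> family_algebra T Vt \<and> family_algebra T Vx"
  using assms(1)
proof induction
  case (base V)
  note V = smooth_familyE[OF base assms(2)]
  have "partials T V (dt V) (\<lambda>t. D (V t))"
    using V(1,2,3) by (simp add: partials_def split_beta)
  then show ?case
    using V(4,5) family_algebra.base by blast
next
  case const
  show ?case
    using partials_const family_algebra.const by blast
next
  case time
  show ?case
    using partials_time family_algebra.const by blast
next
  case (add V W)
  then obtain Vt Vx Wt Wx where "partials T V Vt Vx" "partials T W Wt Wx"
    and *: "family_algebra T Vt" "family_algebra T Vx" "family_algebra T Wt" "family_algebra T Wx"
    by blast
  from partials_add[OF this(1,2)] show ?case
    by (intro exI conjI) (assumption | rule family_algebra.add *)+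
next
  case (mult V W)
  then obtain Vt Vx Wt Wx where "partials T V Vt Vx" "partials T W Wt Wx"
    and *: "family_algebra T Vt" "family_algebra T Vx" "family_algebra T Wt" "family_algebra T Wx"
    by blast
  from partials_mult[OF this(1,2)] show ?case
    by (intro exI conjI) (assumption | rule family_algebra.add family_algebra.mult mult.hyps *)+
next
  case (inverse V)
  then obtain Vt Vx where "partials T V Vt Vx"
    and *: "family_algebra T Vt" "family_algebra T Vx"
    by blast
  from partials_inverse[OF this(1) inverse.hyps(2)] show ?case
    by (intro exI conjI)
      (assumption | rule family_algebra.mult family_algebra.const family_algebra.inverse inverse.hyps *)+
next
  case (exp V)
  then obtain Vt Vx where "partials T V Vt Vx"
    and *: "family_algebra T Vt" "family_algebra T Vx"
    by blast
  from partials_exp[OF this(1)] show ?case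
    by (intro exI conjI)
      (assumption | rule family_algebra.mult family_algebra.exp exp.hyps *)+
qed

lemma smooth_family_algebra:
  assumes "family_algebra T V" "open T"
  shows "smooth_family T V"
  using assms(1)
proof (coinduction arbitrary: V)
  case smooth_family
  then obtain Vt Vx where "partials T V Vt Vx"
    and *: "family_algebra T Vt" "family_algebra T Vx"
    using family_algebra_partials[OF _ assms(2)] by blast
  then have "continuous_on (T \<times> UNIV) (\<lambda>(t, x). V t x)"
    "t \<in> T \<Longrightarrow> ((\<lambda>\<tau>. V \<tau> x) has_vector_derivative Vt t x) (at t)"
    "t \<in> T \<Longrightarrow> (V t has_vector_derivative Vx t x) (at x)" for t x
    by (simp_all add: partials_def split_beta)
  with * show ?case
    by blast
qed

section \<open>Closure rules for smooth families and smooth fields\<close>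

context
  fixes T :: "real set"
  assumes T: "open T"
begin

lemma smooth_family_const: "smooth_family T (\<lambda>t x. c)"
  and smooth_family_time: "smooth_family T (\<lambda>t x. of_real t)"
  and smooth_family_add: "smooth_family T V \<Longrightarrow> smooth_family T W \<Longrightarrow>
    smooth_family T (\<lambda>t x. V t x + W t x)"
  and smooth_family_mult: "smooth_family T V \<Longrightarrow> smooth_family T W \<Longrightarrow>
    smooth_family T (\<lambda>t x. V t x * W t x)"
  and smooth_family_exp: "smooth_family T V \<Longrightarrow> smooth_family T (\<lambda>t x. exp (V t x))"
  using T by (intro smooth_family_algebra; auto intro: family_algebra.intros)+

lemma smooth_family_inverse:
  "smooth_family T V \<Longrightarrow> (\<And>t x. t \<in> T \<Longrightarrow> V t x \<noteq> 0) \<Longrightarrow> smooth_family T (\<lambda>t x. inverse (V t x))"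
  using T by (intro smooth_family_algebra; auto intro: family_algebra.intros)

lemma smooth_family_divide:
  "smooth_family T V \<Longrightarrow> smooth_family T W \<Longrightarrow> (\<And>t x. t \<in> T \<Longrightarrow> W t x \<noteq> 0) \<Longrightarrow>
    smooth_family T (\<lambda>t x. V t x / W t x)"
  using smooth_family_mult[OF _ smooth_family_inverse] by (simp add: divide_inverse)

lemma smooth_family_diff:
  "smooth_family T V \<Longrightarrow> smooth_family T W \<Longrightarrow> smooth_family T (\<lambda>t x. V t x - W t x)"
  using smooth_family_add[OF _ smooth_family_mult[OF smooth_family_const[of "-1"]]] by simp

lemma smooth_family_power:
  "smooth_family T V \<Longrightarrow> smooth_family T (\<lambda>t x. V t x ^ n)"
  by (induction n) (auto intro: smooth_family_const smooth_family_mult)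

lemmas smooth_family_intros = smooth_family_const smooth_family_add smooth_family_mult
  smooth_family_divide smooth_family_diff smooth_family_power smooth_familyE(5)[OF _ T]
  smooth_family_exp

end

text \<open>Viewing a field as a family constant in time, closure of \<open>smooth\<close> under the
  field operations is inherited from families instead of being proved a second time.\<close>

lemma smooth_iff_smooth_family: "smooth f \<longleftrightarrow> smooth_family UNIV (\<lambda>_. f)"
  using smooth_family_const_in_time smooth_family_imp_smooth by blast

lemma smooth_const: "smooth (\<lambda>x. c)"
  and smooth_add: "smooth f \<Longrightarrow> smooth g \<Longrightarrow> smooth (\<lambda>x. f x + g x)"
  and smooth_mult: "smooth f \<Longrightarrow> smooth g \<Longrightarrow> smooth (\<lambda>x. f x * g x)"
  and smooth_diff: "smooth f \<Longrightarrow> smooth g \<Longrightarrow> smooth (\<lambda>x. f x - g x)"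
  and smooth_divide: "smooth f \<Longrightarrow> smooth g \<Longrightarrow> \<forall>x. g x \<noteq> 0 \<Longrightarrow> smooth (\<lambda>x. f x / g x)"
  and smooth_power: "smooth f \<Longrightarrow> smooth (\<lambda>x. f x ^ n)"
  and smooth_exp: "smooth f \<Longrightarrow> smooth (\<lambda>x. exp (f x))"
  unfolding smooth_iff_smooth_family by (intro smooth_family_intros; auto)+

lemma smooth_uminus: "smooth f \<Longrightarrow> smooth (\<lambda>x. - f x)"
  using smooth_diff[OF smooth_const[of 0]] by simp

text \<open>
  By differentiating
  \<open>V t y = V t a + \<integral> {a..y} \<partial>\<^sub>x V\<close> under the integral sign.
\<close>

lemma smooth_family_dt_D:
  assumes V: "smooth_family T V" and T: "open T" and t: "t \<in> T"
  shows "((\<lambda>\<tau>. D (V \<tau>) x) has_vector_derivative D (dt V t) x) (at t)"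
proof -
  define Vx where "Vx = (\<lambda>t. D (V t))"
  have Vx: "smooth_family T Vx"
    unfolding Vx_def by (rule smooth_familyE(5)[OF V T])
  \<comment> \<open>\<open>T\<close> is merely open; the ball is the convex set of times that the
    Leibniz rule asks for.\<close>
  obtain e where e: "e > 0" "ball t e \<subseteq> T"
    using T t open_contains_ball by blast
  let ?U = "ball t e" and ?a = "x - 1" and ?b = "x + 1"
  have cont: "continuous_on A (Vx \<tau>)" if "\<tau> \<in> T" for \<tau> A
    using smooth_family_imp_smooth[OF Vx T that] by (rule smooth_imp_continuous_on)
  have FTC: "integral {?a..y} (Vx \<tau>) = V \<tau> y - V \<tau> ?a" if "\<tau> \<in> T" "?a \<le> y" for \<tau> y
    by (rule integral_unique, rule fundamental_theorem_of_calculus)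
      (use that smooth_familyE(3)[OF V T] in
        \<open>auto simp: Vx_def intro: has_vector_derivative_at_within\<close>)
  have *: "dt V t y = dt V t ?a + integral {?a..y} (dt Vx t)" if "y \<in> {?a..?b}" for y
  proof -
    have "((\<lambda>\<tau>. integral (cbox ?a y) (Vx \<tau>)) has_vector_derivative
        integral (cbox ?a y) (dt Vx t)) (at t within ?U)"
    proof (rule leibniz_rule_vector_derivative)
      show "((\<lambda>\<tau>. Vx \<tau> z) has_vector_derivative dt Vx \<tau> z) (at \<tau> within ?U)"
        if "\<tau> \<in> ?U" for \<tau> z
        using smooth_familyE(2)[OF Vx T] that e has_vector_derivative_at_within by blast
      show "Vx \<tau> integrable_on cbox ?a y" if "\<tau> \<in> ?U" for \<tau>
        by (intro integrable_continuous cont) (use that e in auto)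
      show "continuous_on (?U \<times> cbox ?a y) (\<lambda>(\<tau>, z). dt Vx \<tau> z)"
        using smooth_familyE(1)[OF smooth_familyE(4)[OF Vx T] T]
        by (rule continuous_on_subset) (use e in auto)
    qed (use e in auto)
    moreover have "at t within ?U = at t"
      by (rule at_within_open) (use e in auto)
    ultimately have "((\<lambda>\<tau>. integral {?a..y} (Vx \<tau>)) has_vector_derivative
        integral {?a..y} (dt Vx t)) (at t)"
      unfolding box_real by (simp only:)
    then have "((\<lambda>\<tau>. V \<tau> y - V \<tau> ?a) has_vector_derivative integral {?a..y} (dt Vx t)) (at t)"
      by (rule has_vector_derivative_transform_within_open[OF _ T t]) (use that FTC in auto)
    moreover have "((\<lambda>\<tau>. V \<tau> y - V \<tau> ?a) has_vector_derivative dt V t y - dt V t ?a) (at t)"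
      using smooth_familyE(2)[OF V T t] by (intro has_vector_derivative_diff)
    ultimately have "integral {?a..y} (dt Vx t) = dt V t y - dt V t ?a"
      by (rule vector_derivative_unique_at)
    then show ?thesis
      by simp
  qed
  have "((\<lambda>y. integral {?a..y} (dt Vx t)) has_vector_derivative dt Vx t x) (at x within {?a..?b})"
    by (rule integral_has_vector_derivative)
      (auto intro!: smooth_imp_continuous_on smooth_family_imp_smooth[OF smooth_familyE(4)[OF Vx T] T t])
  from has_vector_derivative_add[OF has_vector_derivative_const this]
  have "((\<lambda>y. dt V t ?a + integral {?a..y} (dt Vx t)) has_vector_derivative dt Vx t x)
      (at x within {?a..?b})"
    by (simp only: add_0_left)
  then have "(dt V t has_vector_derivative dt Vx t x) (at x within {?a..?b})"
    by (rule has_vector_derivative_transform[of x "{?a..?b}", rotated 2]) (simp, rule *)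
  moreover have "at x within {?a..?b} = at x"
    by (rule at_within_interior) simp
  ultimately have "(dt V t has_vector_derivative dt Vx t x) (at x)"
    by (simp only:)
  then have "D (dt V t) x = dt Vx t x"
    by (simp add: D_def vector_derivative_at)
  then show ?thesis
    using smooth_familyE(2)[OF Vx T t] by (simp add: Vx_def)
qed

section \<open>Derivatives of smooth fields\<close>

lemma D_const: "D (\<lambda>x. c) = (\<lambda>x. 0)"
  by (rule D_eqI) simp

lemma D_add: "smooth f \<Longrightarrow> smooth g \<Longrightarrow> D (\<lambda>x. f x + g x) = (\<lambda>x. D f x + D g x)"
  by (rule D_eqI) (auto intro!: derivative_eq_intros smooth_imp_has_D)

lemma D_diff: "smooth f \<Longrightarrow> smooth g \<Longrightarrow> D (\<lambda>x. f x - g x) = (\<lambda>x. D f x - D g x)"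
  by (rule D_eqI) (auto intro!: derivative_eq_intros smooth_imp_has_D)

lemma D_uminus: "smooth f \<Longrightarrow> D (\<lambda>x. - f x) = (\<lambda>x. - D f x)"
  by (rule D_eqI) (auto intro!: derivative_eq_intros smooth_imp_has_D)

lemma D_mult: "smooth f \<Longrightarrow> smooth g \<Longrightarrow> D (\<lambda>x. f x * g x) = (\<lambda>x. D f x * g x + f x * D g x)"
  by (rule D_eqI, rule has_vector_derivative_eq_rhs,
      rule has_vector_derivative_mult[OF smooth_imp_has_D smooth_imp_has_D]) auto

lemma has_vector_derivative_quotient:
  fixes f g :: field
  assumes "(f has_vector_derivative f') (at x)" "(g has_vector_derivative g') (at x)" "g x \<noteq> 0"
  shows "((\<lambda>x. f x / g x) has_vector_derivative (f' * g x - f x * g') / (g x)\<^sup>2) (at x)"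
  using has_vector_derivative_mult[OF assms(1) has_vector_derivative_inverse[OF assms(2,3)]] assms(3)
  by (simp add: field_simps power2_eq_square)

lemma D_divide:
  assumes "smooth f" "smooth g" "\<forall>x. g x \<noteq> 0"
  shows "D (\<lambda>x. f x / g x) = (\<lambda>x. (D f x * g x - f x * D g x) / (g x)\<^sup>2)"
  by (rule D_eqI) (use assms in \<open>auto intro: has_vector_derivative_quotient smooth_imp_has_D\<close>)

lemma D_power2: "smooth f \<Longrightarrow> D (\<lambda>x. (f x)\<^sup>2) = (\<lambda>x. 2 * f x * D f x)"
  using D_mult[of f f] by (simp add: power2_eq_square algebra_simps)

lemma D_power3: "smooth f \<Longrightarrow> D (\<lambda>x. f x ^ 3) = (\<lambda>x. 3 * (f x)\<^sup>2 * D f x)"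
  using D_mult[of f "\<lambda>x. (f x)\<^sup>2"] smooth_power[of f 2]
  by (simp add: D_power2) (simp add: power2_eq_square power3_eq_cube algebra_simps)

lemmas smooth_intros = smooth_const smooth_add smooth_mult smooth_diff smooth_divide smooth_power
  smooth_uminus smooth_D

lemmas D_rules = D_const D_add D_diff D_uminus D_mult D_divide D_power2 D_power3

lemma funpow_D: "(D ^^ 2) f = D (D f)" "(D ^^ 3) f = D (D (D f))"
  by (simp_all add: numeral_2_eq_2 numeral_3_eq_3)


section \<open>Test functions\<close>

lemma test_functionE:
  assumes "test_function a f"
  obtains c d where "a < c" "c < d" "d < a + 2 * pi" "\<And>x. x \<notin> {c..d} \<Longrightarrow> f x = 0"
proof -
  from assms obtain c d where cd: "a < c" "d < a + 2 * pi" "\<forall>x. x \<notin> {c..d} \<longrightarrow> f x = 0"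
    by (auto simp: test_function_def)
  show ?thesis
  proof (rule that)
    \<comment> \<open>The definition of a test function also permits an empty or one-point interval.
      Adjoining the interval from a + 2 to a + 3, which lies in the window because 3 < 2 pi, makes
      it nondegenerate, as the positivity argument in \<open>test_function_eq_0\<close>
      requires.\<close>
    show "a < min c (a + 2)" "max d (a + 3) < a + 2 * pi" "min c (a + 2) < max d (a + 3)"
      using cd pi_gt3 by auto
    show "f x = 0" if "x \<notin> {min c (a + 2)..max d (a + 3)}" for x
      using cd(3) that by (auto simp: not_le)
  qed
qed

lemma test_functionI:
  assumes "smooth f" "a < c" "d < a + 2 * pi" "\<And>x. x \<notin> {c..d} \<Longrightarrow> f x = 0"
  shows "test_function a f"
  using assms unfolding test_function_def by blast

lemma test_function_imp_smooth: "test_function a f \<Longrightarrow> smooth f"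
  by (simp add: test_function_def)

lemma D_eq_0_outside:
  assumes "\<And>x. x \<notin> {c..d} \<Longrightarrow> f x = 0" "x \<notin> {c..d}"
  shows "D f x = 0"
proof -
  have "(f has_vector_derivative 0) (at x)"
    by (rule has_vector_derivative_transform_within_open[OF has_vector_derivative_const, of "- {c..d}"])
      (use assms in \<open>auto simp: open_Compl\<close>)
  then show ?thesis
    by (simp add: D_def vector_derivative_at)
qed

lemma test_function_D:
  assumes "test_function a f"
  shows "test_function a (D f)"
proof -
  from assms obtain c d where cd: "a < c" "d < a + 2 * pi" "\<And>x. x \<notin> {c..d} \<Longrightarrow> f x = 0"
    by (rule test_functionE) blast
  then show ?thesis
    by (intro test_functionI[of _ a c d] smooth_D test_function_imp_smooth[OF assms] D_eq_0_outside)
qed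

lemma test_function_mult_left:
  assumes "test_function a f" "smooth g"
  shows "test_function a (\<lambda>x. f x * g x)"
proof -
  from assms(1) obtain c d where "a < c" "d < a + 2 * pi" "\<And>x. x \<notin> {c..d} \<Longrightarrow> f x = 0"
    by (rule test_functionE) blast
  then show ?thesis
    using assms by (intro test_functionI[of _ a c d] smooth_mult) (auto simp: test_function_def)
qed

lemma test_function_mult_right:
  "test_function a f \<Longrightarrow> smooth g \<Longrightarrow> test_function a (\<lambda>x. g x * f x)"
  using test_function_mult_left[of a f g] by (simp add: mult.commute)

lemma test_function_divide:
  "test_function a f \<Longrightarrow> smooth g \<Longrightarrow> \<forall>x. g x \<noteq> 0 \<Longrightarrow> test_function a (\<lambda>x. f x / g x)"
  using test_function_mult_left[OF _ smooth_divide[OF smooth_const[of 1]]] by simp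

lemma test_function_uminus: "test_function a f \<Longrightarrow> test_function a (\<lambda>x. - f x)"
  using test_function_mult_right[OF _ smooth_const[of "-1"]] by simp

lemma test_function_add:
  assumes "test_function a f" "test_function a g"
  shows "test_function a (\<lambda>x. f x + g x)"
proof -
  from assms(1) obtain c d where cd: "a < c" "d < a + 2 * pi" "\<And>x. x \<notin> {c..d} \<Longrightarrow> f x = 0"
    by (rule test_functionE) blast
  from assms(2) obtain c' d' where cd': "a < c'" "d' < a + 2 * pi" "\<And>x. x \<notin> {c'..d'} \<Longrightarrow> g x = 0"
    by (rule test_functionE) blast
  show ?thesis
    by (rule test_functionI[of _ a "min c c'" "max d d'"])
      (use cd cd' test_function_imp_smooth[OF assms(1)] test_function_imp_smooth[OF assms(2)]
        in \<open>auto intro: smooth_add simp: not_le\<close>)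
qed

lemma test_function_diff:
  "test_function a f \<Longrightarrow> test_function a g \<Longrightarrow> test_function a (\<lambda>x. f x - g x)"
  using test_function_add[OF _ test_function_uminus] by simp

lemmas test_function_intros = test_function_D test_function_mult_left test_function_mult_right
  test_function_divide test_function_uminus test_function_add test_function_diff

section \<open>Integrals of test functions, the sign transform and integration by parts\<close>

lemma integral_UNIV_eq:
  fixes f :: field
  assumes "\<And>x. x \<notin> {A..B} \<Longrightarrow> f x = 0"
  shows "integral UNIV f = integral {A..B} f"
proof -
  have "f = (\<lambda>x. if x \<in> {A..B} then f x else 0)"
    using assms by auto
  then show ?thesis
    using integral_restrict_UNIV[of "{A..B}" f] by simp
qed

lemma test_function_has_integral:
  assumes "test_function a f"
  shows "(f has_integral integral UNIV f) UNIV"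
proof -
  from assms obtain c d where cd: "\<And>x. x \<notin> {c..d} \<Longrightarrow> f x = 0"
    by (rule test_functionE) blast
  have "f integrable_on {c..d}"
    using assms by (intro integrable_continuous_real smooth_imp_continuous_on test_function_imp_smooth)
  then have "(f has_integral integral {c..d} f) {c..d}"
    by (rule integrable_integral)
  then have "(f has_integral integral {c..d} f) UNIV"
    by (rule has_integral_on_superset) (use cd in auto)
  then show ?thesis
    using integral_unique by blast
qed

text \<open>For compactly supported \<open>h\<close> this is the antiderivative of -2h whose limits
  at the two ends of the line are opposite to each other.\<close>

definition sgn_transform :: "field \<Rightarrow> field" where
  "sgn_transform h = (\<lambda>y. integral UNIV (\<lambda>x. h x * of_real (sgn (x - y))))"

lemma sgn_transform_has_integral':
  assumes h: "smooth h" and "A \<le> y" "y \<le> B" and "\<And>x. x \<notin> {A..B} \<Longrightarrow> h x = 0"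
  shows "((\<lambda>x. h x * of_real (sgn (x - y))) has_integral
    (integral {y..B} h - integral {A..y} h)) UNIV"
proof -
  let ?k = "\<lambda>x. h x * of_real (sgn (x - y))"
  have int: "(h has_integral integral {p..q} h) {p..q}" for p q
    by (intro integrable_integral integrable_continuous_real smooth_imp_continuous_on h)
  \<comment> \<open>On either side of y the integrand is h up to a constant sign, except at y
    itself, where \<open>sgn\<close> is 0.\<close>
  have l: "(?k has_integral (- integral {A..y} h)) {A..y}"
    by (rule has_integral_spike_finite[of "{y}", OF _ _ has_integral_neg[OF int]]) auto
  have r: "(?k has_integral integral {y..B} h) {y..B}"
    by (rule has_integral_spike_finite[of "{y}", OF _ _ int]) auto
  have "(?k has_integral (- integral {A..y} h + integral {y..B} h)) {A..B}"
    by (rule has_integral_combine[OF assms(2,3) l r])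
  then have "(?k has_integral (- integral {A..y} h + integral {y..B} h)) UNIV"
    by (rule has_integral_on_superset) (use assms(4) in auto)
  then show ?thesis
    by simp
qed

text \<open>The point y is interior to the window, and \<open>h\<close> and \<open>D h\<close>
  vanish at the endpoints too, so boundary terms drop out and derivatives at y may be taken within
  the interval.\<close>

lemma test_function_window:
  assumes "test_function a h"
  obtains A B where "A < y" "y < B" "\<And>x. x \<notin> {A<..<B} \<Longrightarrow> h x = 0"
    "\<And>x. x \<notin> {A<..<B} \<Longrightarrow> D h x = 0"
proof -
  from assms obtain c d where cd: "\<And>x. x \<notin> {c..d} \<Longrightarrow> h x = 0"
    by (rule test_functionE) blast
  show ?thesis
  proof (rule that[of "min c y - 1" "max d y + 1"])
    fix x assume "x \<notin> {min c y - 1<..<max d y + 1}"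
    then have "x \<notin> {c..d}"
      by auto
    then show "h x = 0" "D h x = 0"
      using cd D_eq_0_outside by blast+
  qed auto
qed

lemma sgn_transform_has_integral:
  assumes "test_function a h"
  shows "((\<lambda>x. h x * of_real (sgn (x - y))) has_integral sgn_transform h y) UNIV"
proof -
  obtain A B where "A < y" "y < B" "\<And>x. x \<notin> {A<..<B} \<Longrightarrow> h x = 0"
    by (rule test_function_window[OF assms, of y]) blast
  then have "((\<lambda>x. h x * of_real (sgn (x - y))) has_integral
      (integral {y..B} h - integral {A..y} h)) UNIV"
    by (intro sgn_transform_has_integral' test_function_imp_smooth[OF assms]) auto
  then show ?thesis
    using integral_unique unfolding sgn_transform_def by blast
qed

lemma sgn_transform_has_derivative:
  assumes "test_function a h"
  shows "(sgn_transform h has_vector_derivative - 2 * h y) (at y)"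
proof -
  note h = test_function_imp_smooth[OF assms]
  obtain A B where AB: "A < y" "y < B" "\<And>x. x \<notin> {A<..<B} \<Longrightarrow> h x = 0"
    by (rule test_function_window[OF assms, of y]) blast
  \<comment> \<open>With A and B fixed for all z near y, only one integral depends on z, and the
    fundamental theorem applies to it.\<close>
  have *: "sgn_transform h z = integral {A..B} h - 2 * integral {A..z} h" if "z \<in> {A<..<B}" for z
  proof -
    have "sgn_transform h z = integral {z..B} h - integral {A..z} h"
      unfolding sgn_transform_def
      by (rule integral_unique, rule sgn_transform_has_integral'[OF h]) (use that AB(3) in auto)
    moreover have "integral {A..z} h + integral {z..B} h = integral {A..B} h"
      using that by (intro Henstock_Kurzweil_Integration.integral_combine
          integrable_continuous_real smooth_imp_continuous_on h) auto
    ultimately show ?thesis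
      by algebra
  qed
  have "((\<lambda>z. integral {A..z} h) has_vector_derivative h y) (at y within {A..B})"
    using AB by (intro integral_has_vector_derivative smooth_imp_continuous_on h) auto
  moreover have "at y within {A..B} = at y"
    using AB by (intro at_within_interior) auto
  ultimately have I: "((\<lambda>z. integral {A..z} h) has_vector_derivative h y) (at y)"
    by (simp only:)
  have "((\<lambda>z. integral {A..B} h - 2 * integral {A..z} h) has_vector_derivative 0 - 2 * h y) (at y)"
    by (intro has_vector_derivative_diff has_vector_derivative_const has_vector_derivative_mult_right I)
  from has_vector_derivative_transform_within_open[OF this, of "{A<..<B}"] show ?thesis
    using AB * by simp
qed

lemma smooth_sgn_transform: "test_function a h \<Longrightarrow> smooth (sgn_transform h)"
  by (rule smoothI, rule sgn_transform_has_derivative, assumption)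
    (intro smooth_mult smooth_const test_function_imp_smooth)

lemma D_sgn_transform: "test_function a h \<Longrightarrow> D (sgn_transform h) = (\<lambda>x. - 2 * h x)"
  by (rule D_eqI) (rule sgn_transform_has_derivative)

lemma integral_D:
  assumes "smooth h" "A \<le> B"
  shows "integral {A..B} (D h) = h B - h A"
  by (rule integral_unique, rule fundamental_theorem_of_calculus)
    (use assms in \<open>auto intro: has_vector_derivative_at_within smooth_imp_has_D\<close>)

text \<open>Each of the two half-lines at y contributes -h(y), the far endpoints contributing
  nothing. This is how nonlocal expressions become local ones.\<close>

lemma sgn_transform_D:
  assumes "test_function a h"
  shows "sgn_transform (D h) = (\<lambda>x. - 2 * h x)"
proof
  fix y
  note h = test_function_imp_smooth[OF assms]
  obtain A B where AB: "A < y" "y < B" "\<And>x. x \<notin> {A<..<B} \<Longrightarrow> h x = 0"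
    "\<And>x. x \<notin> {A<..<B} \<Longrightarrow> D h x = 0"
    by (rule test_function_window[OF assms, of y]) blast
  have "sgn_transform (D h) y = integral {y..B} (D h) - integral {A..y} (D h)"
    unfolding sgn_transform_def
    by (rule integral_unique, rule sgn_transform_has_integral'[OF smooth_D[OF h]]) (use AB in auto)
  then show "sgn_transform (D h) y = - 2 * h y"
    using AB by (simp add: integral_D[OF h])
qed

lemma integral_UNIV_D:
  assumes "test_function a h"
  shows "integral UNIV (D h) = 0"
proof -
  obtain A B where AB: "A < 0" "0 < B" "\<And>x. x \<notin> {A<..<B} \<Longrightarrow> h x = 0"
    "\<And>x. x \<notin> {A<..<B} \<Longrightarrow> D h x = 0"
    by (rule test_function_window[OF assms, of 0]) blast
  then have "integral UNIV (D h) = integral {A..B} (D h)"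
    by (intro integral_UNIV_eq) auto
  also have "\<dots> = h B - h A"
    using AB test_function_imp_smooth[OF assms] by (intro integral_D) auto
  finally show ?thesis
    using AB by simp
qed

lemma integral_by_parts:
  assumes "test_function a f" "smooth g"
  shows "integral UNIV (\<lambda>x. D f x * g x) = - integral UNIV (\<lambda>x. f x * D g x)"
proof -
  note f = test_function_imp_smooth[OF assms(1)]
  have "((\<lambda>x. D f x * g x + f x * D g x) has_integral
      integral UNIV (\<lambda>x. D f x * g x) + integral UNIV (\<lambda>x. f x * D g x)) UNIV"
    by (rule has_integral_add; rule test_function_has_integral[of a];
        intro test_function_intros smooth_D assms)
  moreover have "(\<lambda>x. D f x * g x + f x * D g x) = D (\<lambda>x. f x * g x)"
    by (rule D_mult[OF f assms(2), symmetric])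
  moreover have "integral UNIV (D (\<lambda>x. f x * g x)) = 0"
    by (rule integral_UNIV_D[OF test_function_mult_left[OF assms]])
  ultimately have "integral UNIV (\<lambda>x. D f x * g x) + integral UNIV (\<lambda>x. f x * D g x) = 0"
    by (simp only: integral_unique)
  then show ?thesis
    by (rule eq_neg_iff_add_eq_0[THEN iffD2])
qed

section \<open>Variational derivatives\<close>

text \<open>Conjugation is real-linear, hence commutes with differentiation in a real variable. It
  enters because the test direction detecting a complex-valued \<open>h\<close> is its
  conjugate.\<close>

lemma D_cnj:
  assumes "smooth f"
  shows "((\<lambda>x. cnj (f x)) has_vector_derivative cnj (D f x)) (at x)"
  by (rule has_vector_derivative_cnj) (rule smooth_imp_has_D[OF assms])

lemma smooth_cnj:
  assumes "smooth f"
  shows "smooth (\<lambda>x. cnj (f x))"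
proof -
  have "(D ^^ n) (\<lambda>x. cnj (f x)) = (\<lambda>x. cnj ((D ^^ n) f x)) \<and> smooth ((D ^^ n) f)" for n
  proof (induction n)
    case (Suc n)
    then have "D ((D ^^ n) (\<lambda>x. cnj (f x))) = (\<lambda>x. cnj (D ((D ^^ n) f) x))"
      by (intro D_eqI) (auto intro: D_cnj)
    then show ?case
      using Suc smooth_D by auto
  qed (use assms in simp)
  then show ?thesis
    unfolding smooth_def[of "\<lambda>x. cnj (f x)"] by (auto intro!: differentiableI_vector D_cnj)
qed

lemma test_function_cnj:
  assumes "test_function a f"
  shows "test_function a (\<lambda>x. cnj (f x))"
proof -
  from assms obtain c d where "a < c" "d < a + 2 * pi" "\<And>x. x \<notin> {c..d} \<Longrightarrow> f x = 0"
    by (rule test_functionE) blast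
  then show ?thesis
    by (intro test_functionI[of _ a c d] smooth_cnj test_function_imp_smooth[OF assms]) auto
qed

text \<open>The integrand is the continuous nonnegative function |h|^2. The detour through
  \<open>of_real\<close> moves the integral to the reals, where a vanishing integral over a
  nondegenerate interval forces the function to vanish.\<close>

lemma test_function_eq_0:
  assumes "test_function a h" "integral UNIV (\<lambda>x. h x * cnj (h x)) = 0"
  shows "h = (\<lambda>x. 0)"
proof -
  from assms(1) obtain c d where cd: "c < d" "\<And>x. x \<notin> {c..d} \<Longrightarrow> h x = 0"
    by (rule test_functionE) blast
  have cont: "continuous_on {c..d} h"
    by (intro smooth_imp_continuous_on test_function_imp_smooth[OF assms(1)])
  have "(\<lambda>x. (cmod (h x))\<^sup>2) integrable_on {c..d}"
    by (intro integrable_continuous_real continuous_intros cont)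
  from integral_linear[OF this bounded_linear_of_real[where 'a = complex]]
  have "complex_of_real (integral {c..d} (\<lambda>x. (cmod (h x))\<^sup>2)) =
      integral {c..d} (\<lambda>x. complex_of_real ((cmod (h x))\<^sup>2))"
    by (simp add: o_def)
  also have "\<dots> = integral {c..d} (\<lambda>x. h x * cnj (h x))"
    by (simp only: complex_norm_square)
  also have "\<dots> = integral UNIV (\<lambda>x. h x * cnj (h x))"
    by (rule integral_UNIV_eq[symmetric]) (use cd in auto)
  finally have "integral {c..d} (\<lambda>x. (cmod (h x))\<^sup>2) = 0"
    using assms(2) by simp
  then have "\<forall>x\<in>{c..d}. (cmod (h x))\<^sup>2 = 0"
    by (subst (asm) integral_eq_0_iff) (use cd in \<open>auto intro!: continuous_intros cont\<close>)
  then show ?thesis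
    using cd by (intro ext) (metis norm_eq_zero zero_eq_power2)
qed

text \<open>Admissibility is stable under small multiples of test functions. Restricting to test
  functions matters: a condition such as non-vanishing on the whole line need not survive a small
  multiple of an arbitrary smooth function.\<close>

definition perturbable :: "phase_space \<Rightarrow> bool" where
  "perturbable M \<longleftrightarrow> points M \<subseteq> admissible M \<and> (\<forall>w\<in>admissible M. smooth w \<and>
    (\<forall>a \<phi>. test_function a \<phi> \<longrightarrow>
      (\<exists>\<epsilon>>0. \<forall>s. \<bar>s\<bar> \<le> \<epsilon> \<longrightarrow> (\<lambda>x. w x + of_real s * \<phi> x) \<in> admissible M)))"

text \<open>Both candidates predict the derivative of F along one curve through w whose velocity is
  a positive multiple of the conjugate of f - g. Equating the predictions gives a vanishing integral
  of |f - g|^2.\<close>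

lemma has_variational_derivative_unique:
  assumes M: "perturbable M" and w: "w \<in> admissible M"
    and f: "has_variational_derivative M a F w f" and g: "has_variational_derivative M a F w g"
  shows "f = g"
proof -
  have test: "test_function a f" "test_function a g"
    using f g by (simp_all add: has_variational_derivative_def)
  define h where "h = (\<lambda>x. f x - g x)"
  have h: "test_function a h"
    unfolding h_def by (intro test_function_diff test)
  note sh = smooth_cnj[OF test_function_imp_smooth[OF h]]
  obtain \<epsilon> where \<epsilon>: "\<epsilon> > 0" "\<And>s. \<bar>s\<bar> \<le> \<epsilon> \<Longrightarrow> (\<lambda>x. w x + of_real s * cnj (h x)) \<in> admissible M"
    using M w test_function_cnj[OF h] unfolding perturbable_def by metis
  \<comment> \<open>Curves must be admissible for all real s, but perturbations are admissible only
    up to size \<epsilon>. The function s/(1 + s^2) is bounded by 1, has derivative 1 at 0, and is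
    rational without poles, so the smooth family rules cover it.\<close>
  let ?\<sigma> = "\<lambda>s::real. \<epsilon> * (s / (1 + s * s))"
  have \<sigma>: "\<bar>?\<sigma> s\<bar> \<le> \<epsilon>" for s
  proof -
    have "\<bar>s\<bar> \<le> 1 + s * s"
      using zero_le_square[of "s - 1"] zero_le_square[of "s + 1"] zero_le_square[of s]
      by (simp add: abs_le_iff algebra_simps)
    then have "\<bar>s / (1 + s * s)\<bar> \<le> 1"
      by (simp add: abs_divide divide_le_eq add_pos_nonneg)
    from mult_left_mono[OF this, of \<epsilon>] show ?thesis
      using \<epsilon>(1) by (simp add: abs_mult)
  qed
  have nz: "1 + complex_of_real s * complex_of_real s \<noteq> 0" for s
  proof -
    have "1 + s * s \<noteq> 0"
      by (smt (verit) zero_le_square)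
    then show ?thesis
      by (metis of_real_1 of_real_add of_real_eq_0_iff of_real_mult)
  qed
  define W where "W = (\<lambda>s x. w x + of_real (?\<sigma> s) * cnj (h x))"
  have "smooth_family UNIV (\<lambda>s x. w x + (of_real \<epsilon> * (of_real s / (1 + of_real s * of_real s))) * cnj (h x))"
    using M w nz unfolding perturbable_def
    by (intro smooth_family_add smooth_family_mult smooth_family_divide smooth_family_time
        smooth_family_const smooth_family_const_in_time sh) auto
  moreover have "W = (\<lambda>s x. w x + (of_real \<epsilon> * (of_real s / (1 + of_real s * of_real s))) * cnj (h x))"
    by (simp add: W_def)
  ultimately have "smooth_family UNIV W"
    by simp
  moreover have "W 0 = w" "\<And>s. W s \<in> admissible M"
    using \<epsilon>(2)[OF \<sigma>] by (simp_all add: W_def)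
  ultimately have *: "((\<lambda>s. F (W s)) has_vector_derivative
      integral UNIV (\<lambda>x. k x * vector_derivative (\<lambda>s. W s x) (at 0))) (at 0)"
    if "k \<in> {f, g}" for k
    using f g that unfolding has_variational_derivative_def by blast
  have dW: "vector_derivative (\<lambda>s. W s x) (at 0) = of_real \<epsilon> * cnj (h x)" for x
  proof (rule vector_derivative_at)
    have "(?\<sigma> has_real_derivative \<epsilon>) (at 0)"
      by (auto intro!: derivative_eq_intros)
    then have "((\<lambda>s. complex_of_real (?\<sigma> s)) has_vector_derivative of_real \<epsilon>) (at 0)"
      by (rule has_vector_derivative_of_real)
    then have "((\<lambda>s. w x + of_real (?\<sigma> s) * cnj (h x)) has_vector_derivative 0 + of_real \<epsilon> * cnj (h x)) (at 0)"
      by (intro has_vector_derivative_add has_vector_derivative_const has_vector_derivative_mult_left)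
    then show "((\<lambda>s. W s x) has_vector_derivative of_real \<epsilon> * cnj (h x)) (at 0)"
      by (simp add: W_def)
  qed
  have "integral UNIV (\<lambda>x. f x * (of_real \<epsilon> * cnj (h x))) = integral UNIV (\<lambda>x. g x * (of_real \<epsilon> * cnj (h x)))"
    using vector_derivative_unique_at[OF *[of f] *[of g]] by (simp add: dW)
  moreover have "((\<lambda>x. k x * (of_real \<epsilon> * cnj (h x))) has_integral
      integral UNIV (\<lambda>x. k x * (of_real \<epsilon> * cnj (h x)))) UNIV" if "test_function a k" for k
    by (rule test_function_has_integral[of a]) (intro test_function_mult_left smooth_mult smooth_const that sh)
  from has_integral_diff[OF this[OF test(1)] this[OF test(2)]]
  have "((\<lambda>x. f x * (of_real \<epsilon> * cnj (h x)) - g x * (of_real \<epsilon> * cnj (h x))) has_integral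
      integral UNIV (\<lambda>x. f x * (of_real \<epsilon> * cnj (h x))) -
      integral UNIV (\<lambda>x. g x * (of_real \<epsilon> * cnj (h x)))) UNIV" .
  ultimately have "((\<lambda>x. f x * (of_real \<epsilon> * cnj (h x)) - g x * (of_real \<epsilon> * cnj (h x))) has_integral 0) UNIV"
    by simp
  then have "((\<lambda>x. of_real \<epsilon> * (h x * cnj (h x))) has_integral 0) UNIV"
    by (simp add: h_def algebra_simps)
  then have "integral UNIV (\<lambda>x. of_real \<epsilon> * (h x * cnj (h x))) = 0"
    by (rule integral_unique)
  then have "integral UNIV (\<lambda>x. h x * cnj (h x)) = 0"
    using \<epsilon>(1) by (simp only: integral_mult_right mult_eq_0_iff of_real_eq_0_iff) simp
  from test_function_eq_0[OF h this] show ?thesis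
    by (auto simp: h_def fun_eq_iff)
qed

lemma variational_derivative_eq:
  assumes "perturbable M" "w \<in> admissible M" "has_variational_derivative M a F w f"
  shows "variational_derivative M a F w = f"
  unfolding variational_derivative_def
  by (rule the_equality) (use assms has_variational_derivative_unique in blast)+

lemma has_variational_derivative_imp_test_function:
  "has_variational_derivative M a F w f \<Longrightarrow> test_function a f"
  by (simp add: has_variational_derivative_def)


section \<open>Differential substitutions\<close>

text \<open>\<open>L w\<close> is the linearization of \<open>\<Phi>\<close> at \<open>w\<close>.\<close>

definition substitution ::
    "phase_space \<Rightarrow> phase_space \<Rightarrow> (field \<Rightarrow> field) \<Rightarrow> (field \<Rightarrow> field \<Rightarrow> field) \<Rightarrow> bool" where
  "substitution M N \<Phi> L \<longleftrightarrow> perturbable M \<and> perturbable N \<and>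
    \<Phi> ` admissible M \<subseteq> admissible N \<and> \<Phi> ` points M \<subseteq> points N \<and>
    (\<forall>T W. open T \<and> smooth_family T W \<and> (\<forall>t\<in>T. W t \<in> admissible M) \<longrightarrow>
      smooth_family T (\<lambda>t. \<Phi> (W t)) \<and>
      (\<forall>t\<in>T. \<forall>x. ((\<lambda>\<tau>. \<Phi> (W \<tau>) x) has_vector_derivative L (W t) (dt W t) x) (at t)))"

lemma substitutionD:
  assumes "substitution M N \<Phi> L"
  shows "perturbable M" "perturbable N"
    and "w \<in> admissible M \<Longrightarrow> \<Phi> w \<in> admissible N" and "w \<in> points M \<Longrightarrow> \<Phi> w \<in> points N"
    and "open T \<Longrightarrow> smooth_family T W \<Longrightarrow> (\<And>t. t \<in> T \<Longrightarrow> W t \<in> admissible M) \<Longrightarrow>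
      smooth_family T (\<lambda>t. \<Phi> (W t))"
    and "open T \<Longrightarrow> smooth_family T W \<Longrightarrow> (\<And>t. t \<in> T \<Longrightarrow> W t \<in> admissible M) \<Longrightarrow> t \<in> T \<Longrightarrow>
      ((\<lambda>\<tau>. \<Phi> (W \<tau>) x) has_vector_derivative L (W t) (dt W t) x) (at t)"
  using assms unfolding substitution_def by blast+

text \<open>\<open>L'\<close> is the adjoint of the linearization \<open>L\<close>. Moving it across
  the integral turns the source bracket of the pulled back functionals into the pairing of g with
  \<open>L\<close> P \<open>L'\<close> f, P being the source bracket operator, and
  \<open>intertwine\<close> recognizes the target bracket.\<close>

lemma poisson_mapI:
  assumes sub: "substitution M N \<Phi> L"
    and test: "\<And>w a g. w \<in> points M \<Longrightarrow> test_function a g \<Longrightarrow> test_function a (L' w g)"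
    and adjoint: "\<And>w a g \<phi>. w \<in> points M \<Longrightarrow> test_function a g \<Longrightarrow> smooth \<phi> \<Longrightarrow>
      integral UNIV (\<lambda>x. L' w g x * \<phi> x) = integral UNIV (\<lambda>x. g x * L w \<phi> x)"
    and smooth: "\<And>w a f. w \<in> points M \<Longrightarrow> test_function a f \<Longrightarrow> smooth (poisson M w f)"
    and intertwine: "\<And>w a g. w \<in> points M \<Longrightarrow> test_function a g \<Longrightarrow>
      L w (poisson M w (L' w g)) = poisson N (\<Phi> w) g"
  shows "poisson_map M N \<Phi>"
proof -
  \<comment> \<open>Chain rule for functionals: an admissible curve through w is mapped to one
    through its image with velocity \<open>L w (dt W 0)\<close>, and the adjoint moves
    \<open>L\<close> onto f.\<close>
  have vd: "has_variational_derivative M a (F \<circ> \<Phi>) w (L' w f)"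
    if w: "w \<in> points M" and f: "has_variational_derivative N a F (\<Phi> w) f" for a F w f
    unfolding has_variational_derivative_def
  proof (intro conjI allI impI)
    have tf: "test_function a f"
      by (rule has_variational_derivative_imp_test_function[OF f])
    then show "test_function a (L' w f)"
      by (rule test[OF w])
    fix W assume W: "smooth_family UNIV W \<and> (\<forall>s. W s \<in> admissible M) \<and> W 0 = w"
    then have \<Phi>W: "smooth_family UNIV (\<lambda>s. \<Phi> (W s))"
      "\<And>x. ((\<lambda>\<tau>. \<Phi> (W \<tau>) x) has_vector_derivative L w (dt W 0) x) (at 0)"
      using substitutionD(5,6)[OF sub open_UNIV, of W] by auto
    have "\<forall>s. \<Phi> (W s) \<in> admissible N"
      using W substitutionD(3)[OF sub] by blast
    then have "((\<lambda>s. F (\<Phi> (W s))) has_vector_derivative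
        integral UNIV (\<lambda>x. f x * vector_derivative (\<lambda>s. \<Phi> (W s) x) (at 0))) (at 0)"
      using f \<Phi>W(1) W unfolding has_variational_derivative_def by blast
    moreover have "vector_derivative (\<lambda>s. \<Phi> (W s) x) (at 0) = L w (dt W 0) x" for x
      by (rule vector_derivative_at) (rule \<Phi>W(2))
    moreover have "smooth (dt W 0)"
      using W by (intro smooth_family_imp_smooth[of UNIV] smooth_familyE(4)) auto
    ultimately show "((\<lambda>s. (F \<circ> \<Phi>) (W s)) has_vector_derivative
        integral UNIV (\<lambda>x. L' w f x * vector_derivative (\<lambda>s. W s x) (at 0))) (at 0)"
      using adjoint[OF w tf] by (simp add: dt_def)
  qed
  have pert: "perturbable M" "perturbable N"
    using substitutionD(1,2)[OF sub] .
  have "local_functional_at M a (F \<circ> \<Phi>) w \<and> local_functional_at M a (G \<circ> \<Phi>) w \<and>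
      bracket M a (F \<circ> \<Phi>) (G \<circ> \<Phi>) w = bracket N a F G (\<Phi> w)"
    if w: "w \<in> points M"
      and F: "local_functional_at N a F (\<Phi> w)" and G: "local_functional_at N a G (\<Phi> w)"
    for a F G w
  proof -
    obtain f where f: "has_variational_derivative N a F (\<Phi> w) f"
      using F unfolding local_functional_at_def by (rule exE)
    obtain g where g: "has_variational_derivative N a G (\<Phi> w) g"
      using G unfolding local_functional_at_def by (rule exE)
    have adm: "w \<in> admissible M" "\<Phi> w \<in> admissible N"
      using w pert(1) substitutionD(3)[OF sub] by (auto simp: perturbable_def)
    note fg = vd[OF w f] vd[OF w g]
    note tests = f[THEN has_variational_derivative_imp_test_function]
      g[THEN has_variational_derivative_imp_test_function]
    have "bracket M a (F \<circ> \<Phi>) (G \<circ> \<Phi>) w = integral UNIV (\<lambda>y. L' w g y * poisson M w (L' w f) y)"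
      unfolding bracket_def bracket_field_def
      by (simp add: variational_derivative_eq[OF pert(1) adm(1) fg(1)]
          variational_derivative_eq[OF pert(1) adm(1) fg(2)] mult.commute)
    \<comment> \<open>The adjoint identity is applied to a bracket field, which is smooth but in
      general not a test function; g provides the compact support.\<close>
    also have "\<dots> = integral UNIV (\<lambda>y. g y * L w (poisson M w (L' w f)) y)"
      by (rule adjoint[OF w tests(2) smooth[OF w test[OF w tests(1)]]])
    also have "\<dots> = integral UNIV (\<lambda>y. g y * poisson N (\<Phi> w) f y)"
      by (simp add: intertwine[OF w tests(1)])
    also have "\<dots> = bracket N a F G (\<Phi> w)"
      unfolding bracket_def bracket_field_def
      by (simp add: variational_derivative_eq[OF pert(2) adm(2) f]
          variational_derivative_eq[OF pert(2) adm(2) g] mult.commute)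
    finally show ?thesis
      using fg unfolding local_functional_at_def by blast
  qed
  moreover have "smooth_family UNIV (\<lambda>s. \<Phi> (W s))"
    if "smooth_family UNIV W \<and> (\<forall>s. W s \<in> admissible M)" for W
    using that by (intro substitutionD(5)[OF sub open_UNIV]) auto
  moreover have "\<Phi> ` admissible M \<subseteq> admissible N" "\<Phi> ` points M \<subseteq> points N"
    using sub by (simp_all add: substitution_def)
  ultimately show ?thesis
    unfolding poisson_map_def by blast
qed

lemma poisson_mapD:
  assumes "poisson_map M N \<Phi>"
  shows "w \<in> admissible M \<Longrightarrow> \<Phi> w \<in> admissible N" and "w \<in> points M \<Longrightarrow> \<Phi> w \<in> points N"
    and "smooth_family UNIV W \<Longrightarrow> (\<And>s. W s \<in> admissible M) \<Longrightarrow> smooth_family UNIV (\<lambda>s. \<Phi> (W s))"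
    and "w \<in> points M \<Longrightarrow> local_functional_at N a F (\<Phi> w) \<Longrightarrow> local_functional_at N a G (\<Phi> w) \<Longrightarrow>
      local_functional_at M a (F \<circ> \<Phi>) w \<and> local_functional_at M a (G \<circ> \<Phi>) w \<and>
      bracket M a (F \<circ> \<Phi>) (G \<circ> \<Phi>) w = bracket N a F G (\<Phi> w)"
  using assms unfolding poisson_map_def by blast+

text \<open>Poisson maps are described through pulled back functionals, and pulling back is
  associative. This provides the arrows from \<eta> to v and to u.\<close>

lemma poisson_map_comp:
  assumes \<Phi>: "poisson_map M N \<Phi>" and \<Psi>: "poisson_map N K \<Psi>"
  shows "poisson_map M K (\<lambda>w. \<Psi> (\<Phi> w))"
  unfolding poisson_map_def
proof (intro conjI allI impI)
  note d\<Phi> = poisson_mapD[OF \<Phi>] and d\<Psi> = poisson_mapD[OF \<Psi>]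
  show "(\<lambda>w. \<Psi> (\<Phi> w)) ` admissible M \<subseteq> admissible K"
    and "(\<lambda>w. \<Psi> (\<Phi> w)) ` points M \<subseteq> points K"
    using d\<Phi>(1,2) d\<Psi>(1,2) by auto
  show "smooth_family UNIV (\<lambda>s. \<Psi> (\<Phi> (W s)))"
    if "smooth_family UNIV W \<and> (\<forall>s. W s \<in> admissible M)" for W
    using that by (intro d\<Psi>(3) d\<Phi>(3) d\<Phi>(1)) auto
  fix a F G w
  assume "w \<in> points M \<and> local_functional_at K a F (\<Psi> (\<Phi> w)) \<and> local_functional_at K a G (\<Psi> (\<Phi> w))"
  then have w: "w \<in> points M" and F: "local_functional_at K a F (\<Psi> (\<Phi> w))"
    and G: "local_functional_at K a G (\<Psi> (\<Phi> w))"
    by auto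
  have comp: "F \<circ> (\<lambda>w. \<Psi> (\<Phi> w)) = (F \<circ> \<Psi>) \<circ> \<Phi>" for F :: "field \<Rightarrow> complex"
    by auto
  note 1 = d\<Psi>(4)[OF d\<Phi>(2)[OF w] F G]
  note 2 = d\<Phi>(4)[OF w, of a "F \<circ> \<Psi>" "G \<circ> \<Psi>"]
  show "local_functional_at M a (F \<circ> (\<lambda>w. \<Psi> (\<Phi> w))) w" "local_functional_at M a (G \<circ> (\<lambda>w. \<Psi> (\<Phi> w))) w"
    "bracket M a (F \<circ> (\<lambda>w. \<Psi> (\<Phi> w))) (G \<circ> (\<lambda>w. \<Psi> (\<Phi> w))) w = bracket K a F G (\<Psi> (\<Phi> w))"
    unfolding comp using 1 2 by simp_all
qed

text \<open>Functionals are only evaluated along admissible curves. At a field that is not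
  admissible no such curve starts, and both sides reduce to the same condition on the test
  function.\<close>

lemma has_variational_derivative_cong:
  assumes "\<And>w. w \<in> admissible M \<Longrightarrow> F w = G w"
  shows "has_variational_derivative M a F = has_variational_derivative M a G"
  unfolding has_variational_derivative_def fun_eq_iff using assms by (simp cong: conj_cong)

lemma poisson_map_cong:
  assumes "poisson_map M N \<Phi>" "perturbable M" "\<And>w. w \<in> admissible M \<Longrightarrow> \<Psi> w = \<Phi> w"
  shows "poisson_map M N \<Psi>"
proof -
  have pts: "\<Psi> w = \<Phi> w" if "w \<in> points M" for w
    using that assms(2,3) by (auto simp: perturbable_def)
  have "has_variational_derivative M a (F \<circ> \<Psi>) = has_variational_derivative M a (F \<circ> \<Phi>)" for a F
    by (rule has_variational_derivative_cong) (simp add: assms(3))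
  then have "local_functional_at M a (F \<circ> \<Psi>) = local_functional_at M a (F \<circ> \<Phi>)"
    "variational_derivative M a (F \<circ> \<Psi>) = variational_derivative M a (F \<circ> \<Phi>)" for a F
    unfolding local_functional_at_def[abs_def] variational_derivative_def[abs_def] by (simp_all only:)
  moreover from this have "bracket M a (F \<circ> \<Psi>) (G \<circ> \<Psi>) = bracket M a (F \<circ> \<Phi>) (G \<circ> \<Phi>)" for a F G
    unfolding bracket_def[abs_def] bracket_field_def[abs_def] by (simp_all only:)
  ultimately show ?thesis
    using assms(1) unfolding poisson_map_def
    by (simp add: image_subset_iff assms(3) pts cong: conj_cong) blast
qed

text \<open>By the chain rule the image of a solution moves with velocity \<open>L\<close> applied
  to \<open>Z\<close>, so it suffices that the two vector fields are related by the
  linearization.\<close>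

lemma carries_solutionsI:
  assumes sub: "substitution M N \<Phi> L"
    and Z: "\<And>w. w \<in> points M \<Longrightarrow> L w (Z w) = Z' (\<Phi> w)"
  shows "carries_solutions M Z N Z' \<Phi>"
  unfolding carries_solutions_def
proof (intro allI impI)
  fix T W assume *: "open T \<and> solution M Z T W"
  then have W: "open T" "smooth_family T W" "\<And>t. t \<in> T \<Longrightarrow> W t \<in> points M"
    "\<And>t x. t \<in> T \<Longrightarrow> ((\<lambda>\<tau>. W \<tau> x) has_vector_derivative Z (W t) x) (at t)"
    by (auto simp: solution_def)
  have "dt W t = Z (W t)" if "t \<in> T" for t
    using W(4)[OF that] by (simp add: dt_def vector_derivative_at fun_eq_iff)
  moreover have adm: "W t \<in> admissible M" if "t \<in> T" for t
    using W(3)[OF that] substitutionD(1)[OF sub] by (auto simp: perturbable_def)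
  ultimately show "solution N Z' T (\<lambda>t. \<Phi> (W t))"
    using substitutionD(5,6)[OF sub W(1,2) adm] substitutionD(4)[OF sub W(3)] Z W(3)
    by (simp add: solution_def)
qed

lemma carries_solutions_comp:
  assumes "carries_solutions M Z N Z' \<Phi>" "carries_solutions N Z' K Z'' \<Psi>"
  shows "carries_solutions M Z K Z'' (\<lambda>w. \<Psi> (\<Phi> w))"
  using assms unfolding carries_solutions_def by blast

lemma carries_solutions_cong:
  assumes "carries_solutions M Z N Z' \<Phi>" "\<And>w. w \<in> points M \<Longrightarrow> \<Psi> w = \<Phi> w"
  shows "carries_solutions M Z N Z' \<Psi>"
  unfolding carries_solutions_def
proof (intro allI impI)
  fix T W assume *: "open T \<and> solution M Z T W"
  then have T: "open T" and eq: "\<And>t. t \<in> T \<Longrightarrow> \<Psi> (W t) = \<Phi> (W t)"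
    by (auto simp: solution_def assms(2))
  from * assms(1) have sol: "solution N Z' T (\<lambda>t. \<Phi> (W t))"
    by (simp add: carries_solutions_def)
  then have "smooth_family T (\<lambda>t. \<Psi> (W t))"
    by (intro smooth_family_cong[OF _ T eq]) (simp add: solution_def)
  moreover have "((\<lambda>\<tau>. \<Psi> (W \<tau>) x) has_vector_derivative Z' (\<Psi> (W t)) x) (at t)" if "t \<in> T" for t x
    by (rule has_vector_derivative_transform_within_open[OF _ T that])
      (use sol that eq in \<open>simp_all add: solution_def\<close>)
  ultimately show "solution N Z' T (\<lambda>t. \<Psi> (W t))"
    using sol eq by (simp add: solution_def)
qed

section \<open>The differential substitutions of the diagram\<close>

text \<open>Off the support of q nothing changes. On the support, which is compact, q/p is bounded
  by some B, so multiples up to 1/(2B) cannot cancel p.\<close>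

lemma nonzero_perturbation:
  assumes "smooth p" "\<forall>x. p x \<noteq> 0" "test_function a q"
  shows "\<exists>\<epsilon>>0. \<forall>s. \<bar>s\<bar> \<le> \<epsilon> \<longrightarrow> (\<forall>x. p x + of_real s * q x \<noteq> 0)"
proof -
  obtain c d where cd: "\<And>x. x \<notin> {c..d} \<Longrightarrow> q x = 0"
    using assms(3) by (rule test_functionE) blast
  have "continuous_on {c..d} (\<lambda>x. q x / p x)"
    by (intro smooth_imp_continuous_on smooth_divide assms test_function_imp_smooth[OF assms(3)])
  then have "bounded ((\<lambda>x. q x / p x) ` {c..d})"
    by (intro compact_imp_bounded compact_continuous_image) auto
  then obtain B where B: "B > 0" "\<And>x. x \<in> {c..d} \<Longrightarrow> norm (q x / p x) \<le> B"
    by (auto simp: bounded_pos)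
  have "p x + of_real s * q x \<noteq> 0" if "\<bar>s\<bar> \<le> 1 / (2 * B)" for s x
  proof (cases "x \<in> {c..d}")
    case True
    show ?thesis
    proof
      assume "p x + of_real s * q x = 0"
      then have "of_real s * (q x / p x) = -1"
        using assms(2) by (simp add: field_simps eq_neg_iff_add_eq_0 add.commute)
      then have "\<bar>s\<bar> * norm (q x / p x) = 1"
        by (metis norm_minus_cancel norm_mult norm_of_real norm_one)
      moreover have "\<bar>s\<bar> * norm (q x / p x) \<le> 1 / (2 * B) * B"
        using that B True by (intro mult_mono) auto
      ultimately show False
        using B(1) by simp
    qed
  qed (use assms cd in auto)
  then show ?thesis
    using B(1) by (intro exI[of _ "1 / (2 * B)"]) auto
qed

lemma perturbable_u_space: "perturbable u_space" and perturbable_v_space: "perturbable v_space"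
  unfolding perturbable_def u_space_def v_space_def
  by (auto intro!: exI[of _ 1] smooth_intros dest: test_function_imp_smooth)

lemma perturbableI_nonzero:
  assumes "points M \<subseteq> admissible M" "admissible M = {w. smooth w \<and> (\<forall>x. w x \<noteq> 0)}"
  shows "perturbable M"
  unfolding perturbable_def
proof (intro conjI ballI allI impI assms(1))
  fix w assume "w \<in> admissible M"
  then have w: "smooth w" "\<forall>x. w x \<noteq> 0"
    by (auto simp: assms)
  show "smooth w" by fact
  fix a \<phi> assume \<phi>: "test_function a \<phi>"
  from nonzero_perturbation[OF w this]
  show "\<exists>\<epsilon>>0. \<forall>s. \<bar>s\<bar> \<le> \<epsilon> \<longrightarrow> (\<lambda>x. w x + of_real s * \<phi> x) \<in> admissible M"
    unfolding assms(2) using w test_function_imp_smooth[OF \<phi>]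
    by (auto intro!: smooth_add smooth_mult smooth_const)
qed

lemma perturbable_theta_space: "perturbable theta_space"
  by (rule perturbableI_nonzero) (auto simp: theta_space_def)

lemma perturbable_rho_space: "perturbable rho_space"
  by (rule perturbableI_nonzero) (auto simp: rho_space_def)

lemma perturbation_eta:
  assumes "smooth \<eta>" "\<forall>x. D \<eta> x \<noteq> 0" "test_function a \<phi>"
  shows "\<exists>\<epsilon>>0. \<forall>s. \<bar>s\<bar> \<le> \<epsilon> \<longrightarrow> (\<lambda>x. \<eta> x + of_real s * \<phi> x) \<in> admissible eta_space"
proof -
  have [simp]: "smooth \<phi>"
    by (rule test_function_imp_smooth[OF assms(3)])
  have "D (\<lambda>x. \<eta> x + of_real s * \<phi> x) = (\<lambda>x. D \<eta> x + of_real s * D \<phi> x)" for s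
    using assms by (simp add: D_rules smooth_intros)
  then show ?thesis
    using nonzero_perturbation[OF smooth_D[OF assms(1)] assms(2) test_function_D[OF assms(3)]] assms(1)
    by (simp add: eta_space_def smooth_intros)
qed

lemma perturbable_eta_space: "perturbable eta_space"
  unfolding perturbable_def
proof (intro conjI ballI allI impI)
  fix w assume "w \<in> admissible eta_space"
  then have w: "smooth w" "\<forall>x. D w x \<noteq> 0"
    by (auto simp: eta_space_def)
  show "smooth w" by fact
  show "\<exists>\<epsilon>>0. \<forall>s. \<bar>s\<bar> \<le> \<epsilon> \<longrightarrow> (\<lambda>x. w x + of_real s * \<phi> x) \<in> admissible eta_space"
    if "test_function a \<phi>" for a \<phi>
    by (rule perturbation_eta[OF w that])
qed (auto simp: eta_space_def)

lemma perturbable_eta_nz_space: "perturbable eta_nz_space"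
  unfolding perturbable_def
proof (intro conjI ballI allI impI)
  fix w assume "w \<in> admissible eta_nz_space"
  then have w: "smooth w" "\<forall>x. D w x \<noteq> 0" "\<forall>x. w x \<noteq> 0"
    by (auto simp: eta_nz_space_def eta_space_def)
  show "smooth w" by fact
  fix a \<phi> assume \<phi>: "test_function a \<phi>"
  obtain \<epsilon> where "\<epsilon> > 0" "\<forall>s. \<bar>s\<bar> \<le> \<epsilon> \<longrightarrow> (\<lambda>x. w x + of_real s * \<phi> x) \<in> admissible eta_space"
    using perturbation_eta[OF w(1,2) \<phi>] by blast
  moreover obtain \<delta> where "\<delta> > 0" "\<forall>s. \<bar>s\<bar> \<le> \<delta> \<longrightarrow> (\<forall>x. w x + of_real s * \<phi> x \<noteq> 0)"
    using nonzero_perturbation[OF w(1,3) \<phi>] by blast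
  ultimately show "\<exists>\<epsilon>>0. \<forall>s. \<bar>s\<bar> \<le> \<epsilon> \<longrightarrow> (\<lambda>x. w x + of_real s * \<phi> x) \<in> admissible eta_nz_space"
    by (intro exI[of _ "min \<epsilon> \<delta>"]) (auto simp: eta_nz_space_def)
qed (auto simp: eta_nz_space_def eta_space_def)

text \<open>
  In terms of \<open>p = \<eta>'\<close>, \<open>\<theta>\<close> (with \<open>k = 0\<close>) or \<open>\<rho>\<close> (with \<open>k = 1/4\<close>) the field
  \<open>u\<close> is always of this shape.
\<close>

definition u_rational :: "complex \<Rightarrow> field \<Rightarrow> field" where
  "u_rational k p = (\<lambda>x. 1/2 * (D (D p) x / p x) - 3/4 * (D p x / p x)\<^sup>2 - k * (p x)\<^sup>2)"

lemma u_of_eta_eq: "u_of_eta \<eta> = u_rational 0 (D \<eta>)"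
  by (simp add: u_of_eta_def schwarzian_def u_rational_def funpow_D fun_eq_iff algebra_simps)

text \<open>Stated at a single point where p is nonzero, because the perturbed fields in the energy
  computation are known to be nonzero only on the window.\<close>

lemma u_of_v_of_theta_eq:
  assumes p: "smooth p" "p x \<noteq> 0"
  shows "u_of_v (v_of_theta p) x = u_rational 0 p x"
proof -
  have "(v_of_theta p has_vector_derivative 1/2 * ((D (D p) x * p x - D p x * D p x) / (p x)\<^sup>2)) (at x)"
    unfolding v_of_theta_def using p
    by (intro has_vector_derivative_mult_right has_vector_derivative_quotient smooth_imp_has_D smooth_D)
  then have D: "D (v_of_theta p) x = 1/2 * ((D (D p) x * p x - D p x * D p x) / (p x)\<^sup>2)"
    by (simp add: D_def vector_derivative_at)
  show ?thesis
    unfolding u_of_v_def u_rational_def D using p(2)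
    by (simp add: v_of_theta_def field_simps power2_eq_square)
qed

lemma u_of_v_of_rho_eq:
  assumes p: "smooth p" "p x \<noteq> 0"
  shows "u_of_v (v_of_rho p) x = u_rational (1/4) p x"
proof -
  have "(v_of_rho p has_vector_derivative 1/2 * (D p x + (D (D p) x * p x - D p x * D p x) / (p x)\<^sup>2)) (at x)"
    unfolding v_of_rho_def using p
    by (intro has_vector_derivative_mult_right has_vector_derivative_add
        has_vector_derivative_quotient smooth_imp_has_D smooth_D)
  then have D: "D (v_of_rho p) x = 1/2 * (D p x + (D (D p) x * p x - D p x * D p x) / (p x)\<^sup>2)"
    by (simp add: D_def vector_derivative_at)
  show ?thesis
    unfolding u_of_v_def u_rational_def D using p(2)
    by (simp add: v_of_rho_def field_simps power2_eq_square)
qed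

lemma v_of_theta_of_eta: "v_of_theta (theta_of_eta \<eta>) = v_of_eta \<eta>"
  by (simp add: v_of_theta_def theta_of_eta_def v_of_eta_def funpow_D)

text \<open>The logarithmic derivative of \<rho> = \<eta>'/\<eta> is \<eta>''/\<eta>' -
  \<eta>'/\<eta>, whose second term is cancelled by the summand \<rho> of
  \<open>v_of_rho\<close>.\<close>

lemma v_of_rho_of_eta:
  assumes "\<eta> \<in> admissible eta_nz_space"
  shows "v_of_rho (rho_of_eta \<eta>) = v_of_eta \<eta>"
proof -
  have \<eta>: "smooth \<eta>" "\<forall>x. \<eta> x \<noteq> 0" "\<forall>x. D \<eta> x \<noteq> 0"
    using assms by (auto simp: eta_nz_space_def eta_space_def)
  then have "D (\<lambda>x. D \<eta> x / \<eta> x) = (\<lambda>x. (D (D \<eta>) x * \<eta> x - D \<eta> x * D \<eta> x) / (\<eta> x)\<^sup>2)"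
    by (intro D_divide smooth_D)
  then show ?thesis
    using \<eta> by (simp add: v_of_rho_def rho_of_eta_def v_of_eta_def funpow_D fun_eq_iff field_simps power2_eq_square)
qed

lemma u_of_v_of_eta:
  assumes "\<eta> \<in> admissible eta_space"
  shows "u_of_v (v_of_eta \<eta>) = u_of_eta \<eta>"
  using assms smooth_D
  by (auto simp: fun_eq_iff eta_space_def u_of_eta_eq u_of_v_of_theta_eq theta_of_eta_def
      simp flip: v_of_theta_of_eta)

lemma D_shift:
  assumes "smooth f"
  shows "D (\<lambda>x. f (x + c)) = (\<lambda>x. D f (x + c))"
proof (rule D_eqI)
  fix x
  have "((\<lambda>x. x + c) has_vector_derivative 1) (at x)"
    by (auto intro!: derivative_eq_intros)
  from vector_diff_chain_at[OF this smooth_imp_has_D[OF assms]]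
  show "((\<lambda>x. f (x + c)) has_vector_derivative D f (x + c)) (at x)"
    by (simp add: o_def)
qed

text \<open>Invariance of the Schwarzian under fractional linear maps: a shift by one period is such
  a map, with denominator \<open>q\<close>, and the first three derivatives of the shifted curve are
  computed explicitly.\<close>

lemma periodic_u_of_eta:
  assumes "\<eta> \<in> points eta_space"
  shows "periodic (u_of_eta \<eta>)"
  unfolding periodic_def
proof
  fix x
  have \<eta>: "smooth \<eta>" "\<forall>x. D \<eta> x \<noteq> 0" "quasi_periodic \<eta>"
    using assms by (auto simp: eta_space_def)
  then obtain a b c d where abcd: "a * d - b * c = 1"
    and "\<forall>x. c * \<eta> x + d \<noteq> 0 \<and> \<eta> (x + 2 * pi) = (a * \<eta> x + b) / (c * \<eta> x + d)"
    by (auto simp: quasi_periodic_def)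
  then have nz: "\<forall>x. c * \<eta> x + d \<noteq> 0"
    and m: "(\<lambda>x. \<eta> (x + 2 * pi)) = (\<lambda>x. (a * \<eta> x + b) / (c * \<eta> x + d))"
    by auto
  define q where "q = (\<lambda>x. c * \<eta> x + d)"
  have q: "smooth q" "D q = (\<lambda>x. c * D \<eta> x)" "\<forall>x. q x \<noteq> 0"
    using \<eta>(1) nz by (simp_all add: q_def D_rules smooth_intros)
  \<comment> \<open>The numerator of the derivative is (ad - bc) \<eta>', and the determinant is 1.
    Since shifts commute with \<open>D\<close>, the next two derivatives come from differentiating
    this identity.\<close>
  have D1: "(\<lambda>x. D \<eta> (x + 2 * pi)) = (\<lambda>x. D \<eta> x / (q x)\<^sup>2)"
  proof
    fix x
    have "D (\<lambda>x. (a * \<eta> x + b) / (c * \<eta> x + d)) x = (a * d - b * c) * D \<eta> x / (q x)\<^sup>2"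
      using \<eta>(1) nz by (simp add: D_rules smooth_intros q_def algebra_simps)
    then show "D \<eta> (x + 2 * pi) = D \<eta> x / (q x)\<^sup>2"
      unfolding m[symmetric] D_shift[OF \<eta>(1)] abcd by simp
  qed
  have D2: "(\<lambda>x. D (D \<eta>) (x + 2 * pi)) = (\<lambda>x. D (D \<eta>) x / (q x)\<^sup>2 - 2 * c * (D \<eta> x)\<^sup>2 / q x ^ 3)"
    unfolding D_shift[OF smooth_D[OF \<eta>(1)], symmetric] D1 using \<eta>(1) q(1,3)
    by (simp add: D_rules smooth_intros q(2) fun_eq_iff field_simps eval_nat_numeral)
  have D3: "(\<lambda>x. D (D (D \<eta>)) (x + 2 * pi)) = (\<lambda>x. D (D (D \<eta>)) x / (q x)\<^sup>2
      - 6 * c * D \<eta> x * D (D \<eta>) x / q x ^ 3 + 6 * c\<^sup>2 * D \<eta> x ^ 3 / q x ^ 4)"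
    unfolding D_shift[OF smooth_D[OF smooth_D[OF \<eta>(1)]], symmetric] D2 using \<eta>(1) q(1,3)
    by (simp add: D_rules smooth_intros q(2) fun_eq_iff) (simp add: field_simps eval_nat_numeral)
  show "u_of_eta \<eta> (x + 2 * pi) = u_of_eta \<eta> x"
    unfolding u_of_eta_eq u_rational_def D1[THEN fun_cong] D2[THEN fun_cong] D3[THEN fun_cong]
    using \<eta>(2) q(3) by (simp add: field_simps eval_nat_numeral)
qed

section \<open>First order operators, their adjoints and the criteria built on them\<close>

definition first_order :: "field \<Rightarrow> field \<Rightarrow> field \<Rightarrow> field" where
  "first_order k m \<phi> = (\<lambda>x. D (\<lambda>x. k x * \<phi> x) x + m x * \<phi> x)"

definition first_order_adjoint :: "field \<Rightarrow> field \<Rightarrow> field \<Rightarrow> field" where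
  "first_order_adjoint k m g = (\<lambda>x. m x * g x - k x * D g x)"

lemma test_function_first_order_adjoint:
  "smooth k \<Longrightarrow> smooth m \<Longrightarrow> test_function a g \<Longrightarrow> test_function a (first_order_adjoint k m g)"
  unfolding first_order_adjoint_def by (intro test_function_intros)

lemma integral_first_order_adjoint:
  assumes k: "smooth k" and m: "smooth m" and g: "test_function a g" and \<phi>: "smooth \<phi>"
  shows "integral UNIV (\<lambda>x. first_order_adjoint k m g x * \<phi> x) =
    integral UNIV (\<lambda>x. g x * first_order k m \<phi> x)"
proof -
  note k\<phi> = smooth_mult[OF k \<phi>]
  let ?m = "\<lambda>x. g x * (m x * \<phi> x)" and ?d = "\<lambda>x. D g x * (k x * \<phi> x)"
    and ?e = "\<lambda>x. g x * D (\<lambda>x. k x * \<phi> x) x"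
  have m': "(?m has_integral integral UNIV ?m) UNIV"
    by (intro test_function_has_integral[of a] test_function_mult_left[OF g] smooth_mult m \<phi>)
  have d: "(?d has_integral integral UNIV ?d) UNIV"
    by (intro test_function_has_integral[of a] test_function_mult_left[OF test_function_D[OF g]] k\<phi>)
  have e: "(?e has_integral integral UNIV ?e) UNIV"
    by (intro test_function_has_integral[of a] test_function_mult_left[OF g] smooth_D k\<phi>)
  have "integral UNIV (\<lambda>x. ?m x - ?d x) = integral UNIV (\<lambda>x. ?e x + ?m x)"
    using integral_unique[OF has_integral_diff[OF m' d]] integral_unique[OF has_integral_add[OF e m']]
      integral_by_parts[OF g k\<phi>] by simp
  then show ?thesis
    by (simp add: first_order_def first_order_adjoint_def algebra_simps)
qed

lemma poisson_map_first_orderI: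
  assumes "substitution M N \<Phi> (\<lambda>w. first_order (k w) (m w))"
    and "\<And>w. w \<in> points M \<Longrightarrow> smooth (k w)" "\<And>w. w \<in> points M \<Longrightarrow> smooth (m w)"
    and "\<And>w a f. w \<in> points M \<Longrightarrow> test_function a f \<Longrightarrow> smooth (poisson M w f)"
    and "\<And>w a g. w \<in> points M \<Longrightarrow> test_function a g \<Longrightarrow>
      first_order (k w) (m w) (poisson M w (first_order_adjoint (k w) (m w) g)) = poisson N (\<Phi> w) g"
  shows "poisson_map M N \<Phi>"
  by (rule poisson_mapI[where L' = "\<lambda>w. first_order_adjoint (k w) (m w)"])
    (use assms test_function_first_order_adjoint integral_first_order_adjoint in auto)

text \<open>The last premise of the rule is handed the exchange of time derivative and
  \<open>D\<close>, so each arrow is left with a pointwise use of the product or quotient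
  rule.\<close>

lemma substitutionI:
  assumes "perturbable M" "perturbable N"
    and "\<And>w. w \<in> admissible M \<Longrightarrow> \<Phi> w \<in> admissible N"
    and "\<And>w. w \<in> points M \<Longrightarrow> \<Phi> w \<in> points N"
    and "\<And>T W. open T \<Longrightarrow> smooth_family T W \<Longrightarrow> (\<And>t. t \<in> T \<Longrightarrow> W t \<in> admissible M) \<Longrightarrow>
      smooth_family T (\<lambda>t. \<Phi> (W t))"
    and "\<And>T W t x. open T \<Longrightarrow> smooth_family T W \<Longrightarrow> (\<And>t. t \<in> T \<Longrightarrow> W t \<in> admissible M) \<Longrightarrow> t \<in> T \<Longrightarrow>
      W t \<in> admissible M \<Longrightarrow> smooth (W t) \<Longrightarrow> smooth (dt W t) \<Longrightarrow>
      ((\<lambda>\<tau>. W \<tau> x) has_vector_derivative dt W t x) (at t) \<Longrightarrow>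
      ((\<lambda>\<tau>. D (W \<tau>) x) has_vector_derivative D (dt W t) x) (at t) \<Longrightarrow>
      ((\<lambda>\<tau>. \<Phi> (W \<tau>) x) has_vector_derivative L (W t) (dt W t) x) (at t)"
  shows "substitution M N \<Phi> L"
  unfolding substitution_def
proof (intro conjI allI impI ballI)
  show "\<Phi> ` admissible M \<subseteq> admissible N" "\<Phi> ` points M \<subseteq> points N"
    using assms(3,4) by auto
  fix T W assume "open T \<and> smooth_family T W \<and> (\<forall>t\<in>T. W t \<in> admissible M)"
  then have W: "open T" "smooth_family T W" "\<And>t. t \<in> T \<Longrightarrow> W t \<in> admissible M"
    by auto
  show "smooth_family T (\<lambda>t. \<Phi> (W t))"
    by (rule assms(5)[OF W])
  show "((\<lambda>\<tau>. \<Phi> (W \<tau>) x) has_vector_derivative L (W t) (dt W t) x) (at t)" if t: "t \<in> T" for t x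
    by (rule assms(6)[OF W t W(3)[OF t] smooth_family_imp_smooth[OF W(2,1) t]
          smooth_family_imp_smooth[OF smooth_familyE(4)[OF W(2,1)] W(1) t]
          smooth_familyE(2)[OF W(2,1) t] smooth_family_dt_D[OF W(2,1) t]])
qed (fact assms)+

section \<open>Linearizations of the five elementary arrows\<close>

lemma substitution_theta_of_eta:
  "substitution eta_space theta_space theta_of_eta (\<lambda>\<eta>. first_order (\<lambda>x. 1) (\<lambda>x. 0))"
proof (rule substitutionI[OF perturbable_eta_space perturbable_theta_space])
  show "theta_of_eta w \<in> admissible theta_space" if "w \<in> admissible eta_space" for w
    using that by (simp add: eta_space_def theta_space_def theta_of_eta_def smooth_D)
  show "theta_of_eta w \<in> points theta_space" if "w \<in> points eta_space" for w
    using that periodic_u_of_eta[OF that] u_of_v_of_eta[of w]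
    by (simp add: eta_space_def theta_space_def v_of_theta_of_eta) (simp add: theta_of_eta_def smooth_D)
  show "smooth_family T (\<lambda>t. theta_of_eta (W t))" if "open T" "smooth_family T W" for T W
    unfolding theta_of_eta_def by (rule smooth_familyE(5)[OF that(2,1)])
  show "((\<lambda>\<tau>. theta_of_eta (W \<tau>) x) has_vector_derivative
      first_order (\<lambda>x. 1) (\<lambda>x. 0) (dt W t) x) (at t)"
    if "((\<lambda>\<tau>. D (W \<tau>) x) has_vector_derivative D (dt W t) x) (at t)" for W t x
    using that by (simp add: theta_of_eta_def first_order_def)
qed

text \<open>\<rho> is the derivative of log \<eta>, and the variation of log \<eta> in direction
  \<phi> is \<phi>/\<eta>. Placing the coefficient inside the derivative in
  \<open>first_order\<close> keeps such logarithmic substitutions free of a zeroth order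
  term.\<close>

lemma substitution_rho_of_eta:
  "substitution eta_nz_space rho_space rho_of_eta (\<lambda>\<eta>. first_order (\<lambda>x. 1 / \<eta> x) (\<lambda>x. 0))"
proof (rule substitutionI[OF perturbable_eta_nz_space perturbable_rho_space])
  show adm: "rho_of_eta w \<in> admissible rho_space" if "w \<in> admissible eta_nz_space" for w
    using that by (simp add: eta_nz_space_def eta_space_def rho_space_def rho_of_eta_def smooth_intros)
  show "rho_of_eta w \<in> points rho_space" if w: "w \<in> points eta_nz_space" for w
  proof -
    have "w \<in> admissible eta_nz_space" "w \<in> points eta_space" "w \<in> admissible eta_space"
      using w by (auto simp: eta_nz_space_def eta_space_def)
    then show ?thesis
      using adm[of w] periodic_u_of_eta[of w] u_of_v_of_eta[of w] v_of_rho_of_eta[of w]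
      by (simp add: rho_space_def)
  qed
  show "smooth_family T (\<lambda>t. rho_of_eta (W t))"
    if "open T" "smooth_family T W" "\<And>t. t \<in> T \<Longrightarrow> W t \<in> admissible eta_nz_space" for T W
    unfolding rho_of_eta_def using that
    by (intro smooth_family_divide smooth_familyE(5)) (auto simp: eta_nz_space_def)
  show "((\<lambda>\<tau>. rho_of_eta (W \<tau>) x) has_vector_derivative
      first_order (\<lambda>x. 1 / W t x) (\<lambda>x. 0) (dt W t) x) (at t)"
    if "W t \<in> admissible eta_nz_space" "smooth (W t)" "smooth (dt W t)"
      "((\<lambda>\<tau>. W \<tau> x) has_vector_derivative dt W t x) (at t)"
      "((\<lambda>\<tau>. D (W \<tau>) x) has_vector_derivative D (dt W t) x) (at t)" for W t x
  proof -
    have nz: "\<forall>x. W t x \<noteq> 0"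
      using that(1) by (simp add: eta_nz_space_def)
    show ?thesis
      unfolding rho_of_eta_def
      using has_vector_derivative_quotient[OF that(5,4) nz[rule_format]] that(2,3) nz
      by (simp add: first_order_def D_divide algebra_simps)
  qed
qed

lemma substitution_v_of_theta:
  "substitution theta_space v_space v_of_theta (\<lambda>\<theta>. first_order (\<lambda>x. 1 / (2 * \<theta> x)) (\<lambda>x. 0))"
proof (rule substitutionI[OF perturbable_theta_space perturbable_v_space])
  show "v_of_theta w \<in> admissible v_space" if "w \<in> admissible theta_space" for w
    using that by (simp add: theta_space_def v_space_def v_of_theta_def smooth_intros)
  show "v_of_theta w \<in> points v_space" if "w \<in> points theta_space" for w
    using that by (simp add: theta_space_def v_space_def) (simp add: v_of_theta_def smooth_intros)
  show "smooth_family T (\<lambda>t. v_of_theta (W t))"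
    if "open T" "smooth_family T W" "\<And>t. t \<in> T \<Longrightarrow> W t \<in> admissible theta_space" for T W
    unfolding v_of_theta_def using that
    by (intro smooth_family_mult smooth_family_const smooth_family_divide smooth_familyE(5))
      (auto simp: theta_space_def)
  show "((\<lambda>\<tau>. v_of_theta (W \<tau>) x) has_vector_derivative
      first_order (\<lambda>x. 1 / (2 * W t x)) (\<lambda>x. 0) (dt W t) x) (at t)"
    if "W t \<in> admissible theta_space" "smooth (W t)" "smooth (dt W t)"
      "((\<lambda>\<tau>. W \<tau> x) has_vector_derivative dt W t x) (at t)"
      "((\<lambda>\<tau>. D (W \<tau>) x) has_vector_derivative D (dt W t) x) (at t)" for W t x
  proof -
    have nz: "\<forall>x. W t x \<noteq> 0"
      using that(1) by (simp add: theta_space_def)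
    have L: "first_order (\<lambda>x. 1 / (2 * W t x)) (\<lambda>x. 0) (dt W t) x =
        1/2 * ((D (dt W t) x * W t x - D (W t) x * dt W t x) / (W t x)\<^sup>2)"
      using nz that(2,3)
      by (simp add: first_order_def D_rules smooth_intros) (simp add: field_simps power2_eq_square)
    show ?thesis
      unfolding v_of_theta_def L
      by (intro has_vector_derivative_mult_right has_vector_derivative_quotient that nz[rule_format])
  qed
qed

text \<open>Here v is half the logarithmic derivative of \<rho> plus \<rho>/2; the extra summand is
  the zeroth order coefficient 1/2.\<close>

lemma substitution_v_of_rho:
  "substitution rho_space v_space v_of_rho (\<lambda>\<rho>. first_order (\<lambda>x. 1 / (2 * \<rho> x)) (\<lambda>x. 1/2))"
proof (rule substitutionI[OF perturbable_rho_space perturbable_v_space])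
  show "v_of_rho w \<in> admissible v_space" if "w \<in> admissible rho_space" for w
    using that by (simp add: rho_space_def v_space_def v_of_rho_def smooth_intros)
  show "v_of_rho w \<in> points v_space" if "w \<in> points rho_space" for w
    using that by (simp add: rho_space_def v_space_def) (simp add: v_of_rho_def smooth_intros)
  show "smooth_family T (\<lambda>t. v_of_rho (W t))"
    if "open T" "smooth_family T W" "\<And>t. t \<in> T \<Longrightarrow> W t \<in> admissible rho_space" for T W
    unfolding v_of_rho_def using that
    by (intro smooth_family_mult smooth_family_add smooth_family_const smooth_family_divide smooth_familyE(5))
      (auto simp: rho_space_def)
  show "((\<lambda>\<tau>. v_of_rho (W \<tau>) x) has_vector_derivative
      first_order (\<lambda>x. 1 / (2 * W t x)) (\<lambda>x. 1/2) (dt W t) x) (at t)"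
    if "W t \<in> admissible rho_space" "smooth (W t)" "smooth (dt W t)"
      "((\<lambda>\<tau>. W \<tau> x) has_vector_derivative dt W t x) (at t)"
      "((\<lambda>\<tau>. D (W \<tau>) x) has_vector_derivative D (dt W t) x) (at t)" for W t x
  proof -
    have nz: "\<forall>x. W t x \<noteq> 0"
      using that(1) by (simp add: rho_space_def)
    have L: "first_order (\<lambda>x. 1 / (2 * W t x)) (\<lambda>x. 1/2) (dt W t) x =
        1/2 * (dt W t x + (D (dt W t) x * W t x - D (W t) x * dt W t x) / (W t x)\<^sup>2)"
      using nz that(2,3)
      by (simp add: first_order_def D_rules smooth_intros) (simp add: field_simps power2_eq_square)
    show ?thesis
      unfolding v_of_rho_def L
      by (intro has_vector_derivative_mult_right has_vector_derivative_add
          has_vector_derivative_quotient that nz[rule_format])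
  qed
qed

lemma substitution_u_of_v:
  "substitution v_space u_space u_of_v (\<lambda>v. first_order (\<lambda>x. 1) (\<lambda>x. - 2 * v x))"
proof (rule substitutionI[OF perturbable_v_space perturbable_u_space])
  show "u_of_v w \<in> admissible u_space" if "w \<in> admissible v_space" for w
    using that by (simp add: u_space_def v_space_def u_of_v_def smooth_intros)
  show "u_of_v w \<in> points u_space" if "w \<in> points v_space" for w
    using that by (simp add: u_space_def v_space_def) (simp add: u_of_v_def smooth_intros)
  show "smooth_family T (\<lambda>t. u_of_v (W t))" if "open T" "smooth_family T W" for T W
    unfolding u_of_v_def using that
    by (intro smooth_family_diff smooth_family_power smooth_familyE(5))
  show "((\<lambda>\<tau>. u_of_v (W \<tau>) x) has_vector_derivative
      first_order (\<lambda>x. 1) (\<lambda>x. - 2 * W t x) (dt W t) x) (at t)"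
    if "((\<lambda>\<tau>. W \<tau> x) has_vector_derivative dt W t x) (at t)"
      "((\<lambda>\<tau>. D (W \<tau>) x) has_vector_derivative D (dt W t) x) (at t)" for W t x
    unfolding u_of_v_def first_order_def power2_eq_square
    by (rule has_vector_derivative_eq_rhs,
        rule has_vector_derivative_diff[OF that(2) has_vector_derivative_mult[OF that(1) that(1)]]) simp
qed

section \<open>Divergence form of the equations and their transport along the arrows\<close>

lemma theta_rhs_eq:
  assumes "smooth \<theta>" "\<forall>x. \<theta> x \<noteq> 0"
  shows "theta_rhs \<theta> = D (\<lambda>x. 2 * u_of_v (v_of_theta \<theta>) x * \<theta> x)"
proof -
  have "(\<lambda>x. 2 * u_of_v (v_of_theta \<theta>) x * \<theta> x) = (\<lambda>x. D (D \<theta>) x - 3/2 * ((D \<theta> x)\<^sup>2 / \<theta> x))"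
    using assms by (simp add: fun_eq_iff u_of_v_of_theta_eq u_rational_def field_simps power2_eq_square)
  then show ?thesis
    using assms by (simp add: theta_rhs_def funpow_D D_rules smooth_intros fun_eq_iff)
      (simp add: field_simps)
qed

text \<open>Compared with \<theta>, the expression for u has the additional term -\<rho>^2/4, which
  accounts for the cubic term of the flux.\<close>

lemma rho_rhs_eq:
  assumes "smooth \<rho>" "\<forall>x. \<rho> x \<noteq> 0"
  shows "rho_rhs \<rho> = D (\<lambda>x. 2 * u_of_v (v_of_rho \<rho>) x * \<rho> x)"
proof -
  have "(\<lambda>x. 2 * u_of_v (v_of_rho \<rho>) x * \<rho> x) =
      (\<lambda>x. D (D \<rho>) x - 3/2 * ((D \<rho> x)\<^sup>2 / \<rho> x) - 1/2 * \<rho> x ^ 3)"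
    using assms
    by (simp add: fun_eq_iff u_of_v_of_rho_eq u_rational_def field_simps power2_eq_square power3_eq_cube)
  then show ?thesis
    using assms by (simp add: rho_rhs_def funpow_D D_rules smooth_intros fun_eq_iff)
      (simp add: field_simps)
qed

text \<open>With u = v' - v^2 the products v v' cancel in u' + 2uv, leaving v'' - 2v^3.\<close>

lemma v_rhs_eq:
  assumes "smooth v"
  shows "v_rhs v = D (\<lambda>x. D (u_of_v v) x + 2 * u_of_v v x * v x)"
  using assms
  by (simp add: u_of_v_def v_rhs_def funpow_D D_rules smooth_intros fun_eq_iff)
    (simp add: algebra_simps power2_eq_square)

lemma eta_rhs_eq: "eta_rhs \<eta> = (\<lambda>x. 2 * u_of_eta \<eta> x * D \<eta> x)"
  by (simp add: eta_rhs_def u_of_eta_def)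

lemma carries_theta_of_eta: "carries_solutions eta_space eta_rhs theta_space theta_rhs theta_of_eta"
proof (rule carries_solutionsI[OF substitution_theta_of_eta])
  fix \<eta> assume "\<eta> \<in> points eta_space"
  then have "\<eta> \<in> admissible eta_space" and \<eta>: "smooth \<eta>" "\<forall>x. D \<eta> x \<noteq> 0"
    by (auto simp: eta_space_def)
  then have "theta_rhs (theta_of_eta \<eta>) = D (\<lambda>x. 2 * u_of_eta \<eta> x * D \<eta> x)"
    by (subst theta_rhs_eq) (simp_all add: v_of_theta_of_eta u_of_v_of_eta, simp_all add: theta_of_eta_def smooth_D)
  then show "first_order (\<lambda>x. 1) (\<lambda>x. 0) (eta_rhs \<eta>) = theta_rhs (theta_of_eta \<eta>)"
    by (simp add: first_order_def eta_rhs_eq)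
qed

lemma carries_rho_of_eta: "carries_solutions eta_nz_space eta_rhs rho_space rho_rhs rho_of_eta"
proof (rule carries_solutionsI[OF substitution_rho_of_eta])
  fix \<eta> assume "\<eta> \<in> points eta_nz_space"
  then have adm: "\<eta> \<in> admissible eta_space" "\<eta> \<in> admissible eta_nz_space"
    and \<eta>: "smooth \<eta>" "\<forall>x. D \<eta> x \<noteq> 0" "\<forall>x. \<eta> x \<noteq> 0"
    by (auto simp: eta_space_def eta_nz_space_def)
  have "rho_rhs (rho_of_eta \<eta>) = D (\<lambda>x. 2 * u_of_eta \<eta> x * (D \<eta> x / \<eta> x))"
    by (subst rho_rhs_eq)
      (simp_all add: v_of_rho_of_eta[OF adm(2)] u_of_v_of_eta[OF adm(1)],
        use \<eta> in \<open>simp_all add: rho_of_eta_def smooth_intros\<close>)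
  then show "first_order (\<lambda>x. 1 / \<eta> x) (\<lambda>x. 0) (eta_rhs \<eta>) = rho_rhs (rho_of_eta \<eta>)"
    by (simp add: first_order_def eta_rhs_eq)
qed

lemma carries_v_of_theta: "carries_solutions theta_space theta_rhs v_space v_rhs v_of_theta"
proof (rule carries_solutionsI[OF substitution_v_of_theta])
  fix \<theta> assume "\<theta> \<in> points theta_space"
  then have \<theta>: "smooth \<theta>" "\<forall>x. \<theta> x \<noteq> 0"
    by (auto simp: theta_space_def)
  define u where "u = u_of_v (v_of_theta \<theta>)"
  have v: "smooth (v_of_theta \<theta>)" and u: "smooth u"
    using \<theta> by (simp_all add: u_def u_of_v_def v_of_theta_def smooth_intros)
  have "(\<lambda>x. 1 / (2 * \<theta> x) * theta_rhs \<theta> x) = (\<lambda>x. D u x + 2 * u x * v_of_theta \<theta> x)"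
    unfolding theta_rhs_eq[OF \<theta>] u_def[symmetric] using \<theta> u
    by (simp add: D_rules smooth_intros v_of_theta_def fun_eq_iff field_simps)
  then show "first_order (\<lambda>x. 1 / (2 * \<theta> x)) (\<lambda>x. 0) (theta_rhs \<theta>) = v_rhs (v_of_theta \<theta>)"
    by (simp add: first_order_def v_rhs_eq[OF v] u_def[symmetric])
qed

lemma carries_v_of_rho: "carries_solutions rho_space rho_rhs v_space v_rhs v_of_rho"
proof (rule carries_solutionsI[OF substitution_v_of_rho])
  fix \<rho> assume "\<rho> \<in> points rho_space"
  then have \<rho>: "smooth \<rho>" "\<forall>x. \<rho> x \<noteq> 0"
    by (auto simp: rho_space_def)
  define u where "u = u_of_v (v_of_rho \<rho>)"
  have v: "smooth (v_of_rho \<rho>)" and u: "smooth u"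
    using \<rho> by (simp_all add: u_def u_of_v_def v_of_rho_def smooth_intros)
  have 1: "(\<lambda>x. 1 / (2 * \<rho> x) * rho_rhs \<rho> x) = (\<lambda>x. D u x + u x * D \<rho> x / \<rho> x)"
    unfolding rho_rhs_eq[OF \<rho>] u_def[symmetric] using \<rho> u
    by (simp add: D_rules smooth_intros fun_eq_iff field_simps)
  have 2: "(\<lambda>x. D u x + 2 * u x * v_of_rho \<rho> x) = (\<lambda>x. (D u x + u x * D \<rho> x / \<rho> x) + u x * \<rho> x)"
    by (simp add: v_of_rho_def fun_eq_iff algebra_simps)
  \<comment> \<open>The zeroth order part of the linearization is itself a total derivative, that of
    u \<rho>, and this is the piece of the flux u' + 2uv that the first order part lacks.\<close>
  have 3: "1/2 * rho_rhs \<rho> x = D (\<lambda>x. u x * \<rho> x) x" for x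
    unfolding rho_rhs_eq[OF \<rho>] u_def[symmetric] using \<rho> u
    by (simp add: D_rules smooth_intros algebra_simps)
  have "D (\<lambda>x. (D u x + u x * D \<rho> x / \<rho> x) + u x * \<rho> x) =
      (\<lambda>x. D (\<lambda>x. D u x + u x * D \<rho> x / \<rho> x) x + D (\<lambda>x. u x * \<rho> x) x)"
    by (rule D_add) (use \<rho> u in \<open>simp_all add: smooth_intros\<close>)
  then show "first_order (\<lambda>x. 1 / (2 * \<rho> x)) (\<lambda>x. 1/2) (rho_rhs \<rho>) = v_rhs (v_of_rho \<rho>)"
    unfolding first_order_def v_rhs_eq[OF v] u_def[symmetric] 1 2 3 by simp
qed

text \<open>This is the Miura map from the modified to the ordinary KdV equation, verified by
  expanding both sides in v and its derivatives.\<close>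

lemma carries_u_of_v: "carries_solutions v_space v_rhs u_space u_rhs u_of_v"
proof (rule carries_solutionsI[OF substitution_u_of_v])
  fix v assume "v \<in> points v_space"
  then have v: "smooth v"
    by (auto simp: v_space_def)
  then show "first_order (\<lambda>x. 1) (\<lambda>x. - 2 * v x) (v_rhs v) = u_rhs (u_of_v v)"
    by (simp add: first_order_def v_rhs_def u_rhs_def u_of_v_def funpow_D D_rules smooth_intros fun_eq_iff)
      (simp add: algebra_simps power2_eq_square power3_eq_cube)
qed

section \<open>Poisson brackets\<close>

lemma sgn_transform_uminus: "sgn_transform (\<lambda>x. - h x) = (\<lambda>y. - sgn_transform h y)"
  by (simp add: sgn_transform_def fun_eq_iff)

text \<open>Integration by parts against sgn(x - y); the jump at x = y produces the local term -2
  g(y) k(y).\<close>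

lemma sgn_transform_D_mult:
  assumes "test_function a g" "smooth k"
  shows "sgn_transform (\<lambda>x. D g x * k x) = (\<lambda>y. - 2 * g y * k y - sgn_transform (\<lambda>x. g x * D k x) y)"
proof
  fix y
  note g = test_function_imp_smooth[OF assms(1)]
  have "((\<lambda>x. D (\<lambda>x. g x * k x) x * of_real (sgn (x - y)) - g x * D k x * of_real (sgn (x - y)))
      has_integral sgn_transform (D (\<lambda>x. g x * k x)) y - sgn_transform (\<lambda>x. g x * D k x) y) UNIV"
    by (intro has_integral_diff sgn_transform_has_integral[of a] test_function_intros smooth_D assms)
  moreover have "(\<lambda>x. D (\<lambda>x. g x * k x) x * of_real (sgn (x - y)) - g x * D k x * of_real (sgn (x - y)))
      = (\<lambda>x. D g x * k x * of_real (sgn (x - y)))"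
    using assms g by (simp add: D_mult algebra_simps)
  ultimately have "sgn_transform (\<lambda>x. D g x * k x) y =
      sgn_transform (D (\<lambda>x. g x * k x)) y - sgn_transform (\<lambda>x. g x * D k x) y"
    unfolding sgn_transform_def[of "\<lambda>x. D g x * k x"] by (simp add: integral_unique)
  then show "sgn_transform (\<lambda>x. D g x * k x) y = - 2 * g y * k y - sgn_transform (\<lambda>x. g x * D k x) y"
    by (simp add: sgn_transform_D[OF test_function_mult_left[OF assms]])
qed

lemma poisson_theta_space: "poisson theta_space \<theta> f = (\<lambda>y. \<theta> y * sgn_transform (\<lambda>x. f x * \<theta> x) y)"
proof
  fix y
  have "(\<lambda>x. f x * (2 * of_real (sgn (x - y)) * \<theta> x * \<theta> y)) =
      (\<lambda>x. 2 * \<theta> y * (f x * \<theta> x * of_real (sgn (x - y))))"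
    by (simp add: algebra_simps)
  then show "poisson theta_space \<theta> f y = \<theta> y * sgn_transform (\<lambda>x. f x * \<theta> x) y"
    by (simp add: theta_space_def rescale_def theta_bracket_def function_kernel_def sgn_transform_def)
qed

text \<open>Expanding the square separates x from y: what remains are integrals and transforms of f,
  f \<eta> and f \<eta>^2 with coefficients depending on y.\<close>

lemma poisson_eta_space:
  assumes f: "test_function a f" and \<eta>: "smooth \<eta>"
  shows "poisson eta_space \<eta> f = (\<lambda>y. 1/2 *
    (integral UNIV (\<lambda>x. f x * (\<eta> x)\<^sup>2) - (\<eta> y)\<^sup>2 * integral UNIV f
      - sgn_transform (\<lambda>x. f x * (\<eta> x)\<^sup>2) y + 2 * \<eta> y * sgn_transform (\<lambda>x. f x * \<eta> x) y
      - (\<eta> y)\<^sup>2 * sgn_transform f y))"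
proof
  fix y
  have f1: "test_function a (\<lambda>x. f x * \<eta> x)" and f2: "test_function a (\<lambda>x. f x * (\<eta> x)\<^sup>2)"
    by (intro test_function_mult_left f smooth_power \<eta>)+
  note I = test_function_has_integral and S = sgn_transform_has_integral[where y = y]
  note has_integral_diff[OF has_integral_add[OF has_integral_diff[OF has_integral_diff[OF
      I[OF f2] has_integral_mult_right[OF I[OF f], of "(\<eta> y)\<^sup>2"]] S[OF f2]]
      has_integral_mult_right[OF S[OF f1], of "2 * \<eta> y"]]
      has_integral_mult_right[OF S[OF f], of "(\<eta> y)\<^sup>2"]]
  moreover have "(\<lambda>x. f x * (\<eta> x)\<^sup>2 - (\<eta> y)\<^sup>2 * f x - f x * (\<eta> x)\<^sup>2 * of_real (sgn (x - y))
      + 2 * \<eta> y * (f x * \<eta> x * of_real (sgn (x - y))) - (\<eta> y)\<^sup>2 * (f x * of_real (sgn (x - y)))) =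
      (\<lambda>x. f x * ((\<eta> x)\<^sup>2 - (\<eta> y)\<^sup>2 - of_real (sgn (x - y)) * (\<eta> x - \<eta> y)\<^sup>2))"
    by (simp add: fun_eq_iff algebra_simps power2_eq_square)
  ultimately show "poisson eta_space \<eta> f y = 1/2 *
    (integral UNIV (\<lambda>x. f x * (\<eta> x)\<^sup>2) - (\<eta> y)\<^sup>2 * integral UNIV f
      - sgn_transform (\<lambda>x. f x * (\<eta> x)\<^sup>2) y + 2 * \<eta> y * sgn_transform (\<lambda>x. f x * \<eta> x) y
      - (\<eta> y)\<^sup>2 * sgn_transform f y)"
    by (simp add: eta_space_def rescale_def eta_bracket_def function_kernel_def integral_unique)
qed

text \<open>The minus sign from applying \<delta>' to f and the factor -1 in \<open>v_space\<close>
  cancel.\<close>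

lemma poisson_v_space:
  assumes "smooth f"
  shows "poisson v_space v f = (\<lambda>y. 1/2 * D f y)"
  by (simp add: v_space_def rescale_def v_bracket_def delta_kernel_def)

lemma poisson_u_space:
  assumes "smooth f" "smooth u"
  shows "poisson u_space u f = (\<lambda>y. - 1/2 * D (D (D f)) y - 2 * u y * D f y - D u y * f y)"
proof
  fix y
  \<comment> \<open>Here \<open>u y\<close> is a constant: the kernel is differentiated in x alone
    and put on the diagonal afterwards, which gives 2 u f' + u' f.\<close>
  have "D (\<lambda>x. f x * (u x + u y)) = (\<lambda>x. D f x * (u x + u y) + f x * D u x)"
    using assms by (simp add: D_rules smooth_intros)
  then show "poisson u_space u f y = - 1/2 * D (D (D f)) y - 2 * u y * D f y - D u y * f y"
    by (simp add: u_space_def u_bracket_def delta_kernel_def funpow_D algebra_simps)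
qed

lemma smooth_primitive:
  assumes "smooth f"
  obtains F where "smooth F" "D F = f"
proof -
  have "\<exists>F. \<forall>x. - \<infinity> < ereal x \<longrightarrow> ereal x < \<infinity> \<longrightarrow> (F has_vector_derivative f x) (at x)"
    by (rule einterval_antiderivative)
      (use smooth_imp_continuous_on[OF assms, of UNIV] in \<open>auto simp: continuous_on_eq_continuous_at\<close>)
  then obtain F where "\<And>x. (F has_vector_derivative f x) (at x)"
    by auto
  then show thesis
    by (intro that[of F]) (auto intro: smoothI D_eqI assms)
qed

text \<open>Two solutions of E' = \<rho> E without zeros differ by a constant factor, which drops
  out of the quotient. Allowing an arbitrary solution lets \<eta> serve as E when \<rho> =
  \<eta>'/\<eta>, with no choice of a complex logarithm.\<close>

lemma exp_interval_integral:
  assumes \<rho>: "smooth \<rho>" and E: "smooth E" "\<forall>x. E x \<noteq> 0" "\<And>x. D E x = \<rho> x * E x"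
  shows "exp (LBINT s=ereal x..ereal y. \<rho> s) = E y / E x"
proof -
  obtain F where F: "smooth F" "D F = \<rho>"
    using smooth_primitive[OF \<rho>] by blast
  have FD: "(F has_vector_derivative \<rho> x) (at x)" for x
    using smooth_imp_has_D[OF F(1)] F(2) by simp
  have "(LBINT s=ereal x..ereal y. \<rho> s) = F y - F x"
    by (rule interval_integral_FTC_finite)
      (rule smooth_imp_continuous_on[OF \<rho>], rule has_vector_derivative_at_within[OF FD])
  moreover have "exp (F y) / exp (F x) = E y / E x"
  proof -
    have "((\<lambda>x. exp (- F x) * E x) has_vector_derivative 0) (at x within UNIV)" for x
    proof -
      have "((\<lambda>x. exp (- F x) * E x) has_vector_derivative
          exp (- F x) * D E x + (- \<rho> x * exp (- F x)) * E x) (at x)"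
        by (intro has_vector_derivative_mult has_vector_derivative_exp has_vector_derivative_minus
            FD smooth_imp_has_D E(1))
      then show ?thesis
        by (simp add: E(3) algebra_simps)
    qed
    then obtain C where C: "\<And>x. exp (- F x) * E x = C"
      using has_vector_derivative_zero_constant[of UNIV "\<lambda>x. exp (- F x) * E x"] by auto
    have "E z = C * exp (F z)" for z
      using C[of z] by (simp add: exp_minus field_simps)
    then show ?thesis
      using E(2) by (metis mult_divide_mult_cancel_left mult_zero_left)
  qed
  ultimately show ?thesis
    by (simp add: exp_diff)
qed

text \<open>Put r = E(y)/E(x) and let s be the sign. Then twice sinh + s cosh equals r (1 + s) + (s
  - 1)/r, in which x and y separate.\<close>

lemma poisson_rho_space:
  assumes f: "test_function a f" and \<rho>: "smooth \<rho>"
    and E: "smooth E" "\<forall>x. E x \<noteq> 0" "\<And>x. D E x = \<rho> x * E x"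
  shows "poisson rho_space \<rho> f = (\<lambda>y. 1/2 * \<rho> y *
    (E y * (integral UNIV (\<lambda>x. f x * \<rho> x / E x) + sgn_transform (\<lambda>x. f x * \<rho> x / E x) y)
      + (sgn_transform (\<lambda>x. f x * \<rho> x * E x) y - integral UNIV (\<lambda>x. f x * \<rho> x * E x)) / E y))"
proof
  fix y
  have fm: "test_function a (\<lambda>x. f x * \<rho> x * E x)" and fd: "test_function a (\<lambda>x. f x * \<rho> x / E x)"
    by (intro test_function_mult_left test_function_divide f \<rho> E)+
  note I = test_function_has_integral and S = sgn_transform_has_integral[where y = y]
  note * = has_integral_mult_right[OF has_integral_add[OF
      has_integral_mult_right[OF has_integral_add[OF I[OF fd] S[OF fd]], of "E y"]
      has_integral_mult_right[OF has_integral_diff[OF S[OF fm] I[OF fm]], of "1 / E y"]], of "\<rho> y"]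
  have eq: "f x * (2 * \<rho> x * \<rho> y * (sinh (LBINT s=ereal x..ereal y. \<rho> s)
        + of_real (sgn (x - y)) * cosh (LBINT s=ereal x..ereal y. \<rho> s))) =
      \<rho> y * (E y * (f x * \<rho> x / E x + f x * \<rho> x / E x * of_real (sgn (x - y)))
        + 1 / E y * (f x * \<rho> x * E x * of_real (sgn (x - y)) - f x * \<rho> x * E x))" for x
    using E(2)
    by (simp add: sinh_field_def cosh_field_def exp_minus exp_interval_integral[OF \<rho> E] field_simps)
  show "poisson rho_space \<rho> f y = 1/2 * \<rho> y *
    (E y * (integral UNIV (\<lambda>x. f x * \<rho> x / E x) + sgn_transform (\<lambda>x. f x * \<rho> x / E x) y)
      + (sgn_transform (\<lambda>x. f x * \<rho> x * E x) y - integral UNIV (\<lambda>x. f x * \<rho> x * E x)) / E y)"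
    unfolding rho_space_def rescale_def rho_bracket_def function_kernel_def phase_space.simps eq
      integral_unique[OF *]
    by simp
qed

lemma exponential_primitive:
  assumes "smooth \<rho>"
  obtains E where "smooth E" "\<forall>x. E x \<noteq> 0" "\<And>x. D E x = \<rho> x * E x"
proof -
  obtain F where F: "smooth F" "D F = \<rho>"
    using smooth_primitive[OF assms] by blast
  have "((\<lambda>x. exp (F x)) has_vector_derivative \<rho> x * exp (F x)) (at x)" for x
    using has_vector_derivative_exp[OF smooth_imp_has_D[OF F(1)]] F(2) by simp
  then have "D (\<lambda>x. exp (F x)) = (\<lambda>x. \<rho> x * exp (F x))"
    by (rule D_eqI)
  then show thesis
    by (intro that[of "\<lambda>x. exp (F x)"] smooth_exp F) auto
qed

section \<open>Smoothness of bracket fields and the Poisson property of the elementary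
  arrows\<close>

lemma points_smooth:
  shows "w \<in> points eta_space \<Longrightarrow> smooth w" "w \<in> points eta_nz_space \<Longrightarrow> smooth w"
    "w \<in> points theta_space \<Longrightarrow> smooth w" "w \<in> points rho_space \<Longrightarrow> smooth w"
    "w \<in> points v_space \<Longrightarrow> smooth w" "w \<in> points u_space \<Longrightarrow> smooth w"
  by (auto simp: eta_nz_space_def eta_space_def theta_space_def rho_space_def v_space_def u_space_def)

lemma points_nonzero:
  shows "w \<in> points eta_space \<Longrightarrow> \<forall>x. D w x \<noteq> 0" "w \<in> points eta_nz_space \<Longrightarrow> \<forall>x. w x \<noteq> 0"
    "w \<in> points theta_space \<Longrightarrow> \<forall>x. w x \<noteq> 0" "w \<in> points rho_space \<Longrightarrow> \<forall>x. w x \<noteq> 0"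
  by (auto simp: eta_nz_space_def eta_space_def theta_space_def rho_space_def)

lemma poisson_eta_nz_space: "poisson eta_nz_space = poisson eta_space"
  by (simp add: eta_nz_space_def)

lemma smooth_poisson:
  assumes "test_function a f"
  shows "smooth w \<Longrightarrow> smooth (poisson eta_space w f)"
    and "smooth w \<Longrightarrow> smooth (poisson theta_space w f)"
    and "smooth w \<Longrightarrow> smooth (poisson rho_space w f)"
    and "smooth (poisson v_space w f)"
proof -
  note f = assms test_function_imp_smooth[OF assms]
  show "smooth (poisson eta_space w f)" if "smooth w"
    unfolding poisson_eta_space[OF assms that]
    by (intro smooth_intros smooth_sgn_transform[of a] test_function_intros that f)
  show "smooth (poisson theta_space w f)" if "smooth w"
    unfolding poisson_theta_space
    by (intro smooth_intros smooth_sgn_transform[of a] test_function_intros that f)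
  show "smooth (poisson rho_space w f)" if w: "smooth w"
  proof -
    obtain E where E: "smooth E" "\<forall>x. E x \<noteq> 0" "\<And>x. D E x = w x * E x"
      using exponential_primitive[OF w] by blast
    show ?thesis
      unfolding poisson_rho_space[OF assms w E]
      by (intro smooth_intros smooth_sgn_transform[of a] test_function_intros w f E)
  qed
  show "smooth (poisson v_space w f)"
    unfolding poisson_v_space[OF f(2)] by (intro smooth_intros f)
qed

text \<open>The factor multiplying the sign in the kernel vanishes on the diagonal, so
  differentiating the sign leaves no local term; the terms constant in y and the transform of f
  \<eta>^2 disappear as well.\<close>

lemma D_poisson_eta_space:
  assumes f: "test_function a f" and \<eta>: "smooth \<eta>"
  shows "D (poisson eta_space \<eta> f) = (\<lambda>y. D \<eta> y *
    (sgn_transform (\<lambda>x. f x * \<eta> x) y - \<eta> y * sgn_transform f y - \<eta> y * integral UNIV f))"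
proof -
  have f12: "test_function a (\<lambda>x. f x * \<eta> x)" "test_function a (\<lambda>x. f x * (\<eta> x)\<^sup>2)"
    by (intro test_function_mult_left f smooth_power \<eta>)+
  show ?thesis
    unfolding poisson_eta_space[OF f \<eta>]
    using \<eta> smooth_sgn_transform[OF f] smooth_sgn_transform[OF f12(1)] smooth_sgn_transform[OF f12(2)]
    by (simp add: D_rules smooth_intros D_sgn_transform[OF f] D_sgn_transform[OF f12(1)]
        D_sgn_transform[OF f12(2)] fun_eq_iff) (simp add: algebra_simps power2_eq_square)
qed

text \<open>The pulled back derivative is -g', so its plain integral is 0. The local terms 2 g
  \<eta> from the two remaining transforms cancel, which leaves \<eta>' times the transform of g
  \<eta>'.\<close>

lemma poisson_map_theta_of_eta: "poisson_map eta_space theta_space theta_of_eta"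
proof (rule poisson_map_first_orderI[OF substitution_theta_of_eta])
  fix \<eta> a g
  assume "\<eta> \<in> points eta_space" and g: "test_function a g"
  then have \<eta>: "smooth \<eta>" by (simp add: eta_space_def)
  have f: "first_order_adjoint (\<lambda>x. 1) (\<lambda>x. 0) g = (\<lambda>x. - D g x)"
    by (simp add: first_order_adjoint_def)
  have tf: "test_function a (\<lambda>x. - D g x)"
    by (intro test_function_intros g)
  show "first_order (\<lambda>x. 1) (\<lambda>x. 0) (poisson eta_space \<eta> (first_order_adjoint (\<lambda>x. 1) (\<lambda>x. 0) g)) =
      poisson theta_space (theta_of_eta \<eta>) g"
    unfolding f
    by (simp add: first_order_def D_poisson_eta_space[OF tf \<eta>] poisson_theta_space theta_of_eta_def
        sgn_transform_uminus sgn_transform_D_mult[OF g \<eta>] sgn_transform_D[OF g] integral_UNIV_D[OF g])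
qed (use points_smooth points_nonzero smooth_poisson in \<open>auto simp: smooth_intros poisson_eta_nz_space\<close>)

text \<open>With f = -g'/\<eta> the product f \<eta> is a total derivative, and all local terms in
  the bracket field cancel. The surviving combinations \<open>P\<close> and \<open>Q\<close> are, up
  to the sign of \<open>P\<close>, the two nonlocal terms of \<open>poisson_rho_space\<close> for E
  = \<eta>.\<close>

lemma poisson_map_rho_of_eta: "poisson_map eta_nz_space rho_space rho_of_eta"
proof (rule poisson_map_first_orderI[OF substitution_rho_of_eta])
  fix \<eta> a g
  assume "\<eta> \<in> points eta_nz_space" and g: "test_function a g"
  then have \<eta>: "smooth \<eta>" "\<forall>x. \<eta> x \<noteq> 0" by (auto simp: eta_nz_space_def eta_space_def)
  let ?I = "integral UNIV" and ?J = sgn_transform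
  let ?A = "\<lambda>x. g x * D \<eta> x" and ?B = "\<lambda>x. g x * (D \<eta> x / (\<eta> x)\<^sup>2)"
  define f where "f = first_order_adjoint (\<lambda>x. 1 / \<eta> x) (\<lambda>x. 0) g"
  have f_eq: "f = (\<lambda>x. - (D g x * (1 / \<eta> x)))"
    by (simp add: f_def first_order_adjoint_def)
  have f2: "(\<lambda>x. f x * (\<eta> x)\<^sup>2) = (\<lambda>x. - (D g x * \<eta> x))" "(\<lambda>x. f x * \<eta> x) = (\<lambda>x. - D g x)"
    using \<eta>(2) by (simp_all add: f_eq power2_eq_square)
  have inv: "smooth (\<lambda>x. 1 / \<eta> x)" "D (\<lambda>x. 1 / \<eta> x) = (\<lambda>x. - (D \<eta> x / (\<eta> x)\<^sup>2))"
    using \<eta> by (simp_all add: D_rules smooth_intros)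
  have tf: "test_function a f"
    unfolding f_eq by (intro test_function_intros g inv)
  have tA: "test_function a ?A" and tB: "test_function a ?B"
    by (intro test_function_intros g \<eta> smooth_intros; simp add: \<eta>)+
  have A: "?I (\<lambda>x. f x * (\<eta> x)\<^sup>2) = ?I ?A" "?J (\<lambda>x. f x * (\<eta> x)\<^sup>2) = (\<lambda>y. 2 * g y * \<eta> y + ?J ?A y)"
    unfolding f2 by (simp_all add: sgn_transform_uminus sgn_transform_D_mult[OF g \<eta>(1)]
        integral_by_parts[OF g \<eta>(1)] add.commute)
  have B: "?I f = - ?I ?B" "?J f = (\<lambda>y. 2 * g y / \<eta> y - ?J ?B y)"
    unfolding f_eq sgn_transform_uminus sgn_transform_D_mult[OF g inv(1)] inv(2)
    using integral_by_parts[OF g inv(1)] by (simp_all add: sgn_transform_uminus inv(2))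
  have "poisson eta_space \<eta> f = (\<lambda>y. 1/2 * (?I ?A - ?J ?A y + (\<eta> y)\<^sup>2 * (?I ?B + ?J ?B y)))"
    unfolding poisson_eta_space[OF tf \<eta>(1)] A B f2(2)
    using \<eta>(2) by (simp add: sgn_transform_uminus sgn_transform_D[OF g] fun_eq_iff field_simps power2_eq_square)
  moreover define P Q where "P = (\<lambda>y. ?I ?A - ?J ?A y)" and "Q = (\<lambda>y. ?I ?B + ?J ?B y)"
  ultimately have "poisson eta_space \<eta> f = (\<lambda>y. 1/2 * (P y + (\<eta> y)\<^sup>2 * Q y))"
    by (simp only:)
  then have "(\<lambda>x. 1 / \<eta> x * poisson eta_space \<eta> f x) = (\<lambda>y. 1/2 * (P y / \<eta> y + \<eta> y * Q y))"
    using \<eta>(2) by (simp add: fun_eq_iff field_simps power2_eq_square)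
  then have "first_order (\<lambda>x. 1 / \<eta> x) (\<lambda>x. 0) (poisson eta_space \<eta> f) =
      D (\<lambda>y. 1/2 * (P y / \<eta> y + \<eta> y * Q y))"
    by (simp add: first_order_def)
  \<comment> \<open>The derivatives of P and Q contribute 2 g \<eta>'/\<eta> with opposite
    signs.\<close>
  also have "\<dots> = (\<lambda>y. 1/2 * (D \<eta> y * Q y - D \<eta> y / (\<eta> y)\<^sup>2 * P y))"
  proof -
    have "smooth P" "smooth Q"
      unfolding P_def Q_def
      by (intro smooth_add smooth_diff smooth_const smooth_sgn_transform[OF tA] smooth_sgn_transform[OF tB])+
    moreover have "D P = (\<lambda>x. 2 * ?A x)" "D Q = (\<lambda>x. - 2 * ?B x)"
      unfolding P_def Q_def
        D_diff[OF smooth_const smooth_sgn_transform[OF tA]] D_add[OF smooth_const smooth_sgn_transform[OF tB]]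
        D_sgn_transform[OF tA] D_sgn_transform[OF tB] D_const
      by simp_all
    ultimately show ?thesis
      using \<eta> by (simp add: D_rules smooth_intros fun_eq_iff) (simp add: field_simps power2_eq_square)
  qed
  also have "\<dots> = poisson rho_space (rho_of_eta \<eta>) g"
  proof -
    have \<rho>: "smooth (rho_of_eta \<eta>)" "\<And>x. D \<eta> x = rho_of_eta \<eta> x * \<eta> x"
      using \<eta> by (simp_all add: rho_of_eta_def smooth_intros)
    have "(\<lambda>x. g x * rho_of_eta \<eta> x / \<eta> x) = ?B" "(\<lambda>x. g x * rho_of_eta \<eta> x * \<eta> x) = ?A"
      using \<eta>(2) by (simp_all add: rho_of_eta_def fun_eq_iff power2_eq_square)
    then show ?thesis
      unfolding poisson_rho_space[OF g \<rho>(1) \<eta> \<rho>(2)]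
      using \<eta>(2) by (simp add: rho_of_eta_def P_def Q_def fun_eq_iff field_simps power2_eq_square)
  qed
  finally show "first_order (\<lambda>x. 1 / \<eta> x) (\<lambda>x. 0)
      (poisson eta_nz_space \<eta> (first_order_adjoint (\<lambda>x. 1 / \<eta> x) (\<lambda>x. 0) g)) =
      poisson rho_space (rho_of_eta \<eta>) g"
    by (simp add: f_def eta_nz_space_def)
qed (use points_smooth points_nonzero smooth_poisson in \<open>auto simp: smooth_intros poisson_eta_nz_space\<close>)

text \<open>Multiplying the adjoint by \<theta> gives -g'/2, whose sign transform is g. The nonlocal
  bracket collapses to a local one.\<close>

lemma poisson_map_v_of_theta: "poisson_map theta_space v_space v_of_theta"
proof (rule poisson_map_first_orderI[OF substitution_v_of_theta])
  fix \<theta> a g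
  assume "\<theta> \<in> points theta_space" and g: "test_function a g"
  then have \<theta>: "smooth \<theta>" "\<forall>x. \<theta> x \<noteq> 0" by (auto simp: theta_space_def)
  have "(\<lambda>x. first_order_adjoint (\<lambda>x. 1 / (2 * \<theta> x)) (\<lambda>x. 0) g x * \<theta> x) = (\<lambda>x. - (D g x * (1/2)))"
    using \<theta>(2) by (simp add: first_order_adjoint_def)
  then have "(\<lambda>x. 1 / (2 * \<theta> x) * poisson theta_space \<theta> (first_order_adjoint (\<lambda>x. 1 / (2 * \<theta> x)) (\<lambda>x. 0) g) x) = (\<lambda>x. g x * (1/2))"
    unfolding poisson_theta_space using \<theta>(2)
    by (simp only: sgn_transform_uminus sgn_transform_D_mult[OF g smooth_const] D_const)
      (simp add: sgn_transform_def)
  then show "first_order (\<lambda>x. 1 / (2 * \<theta> x)) (\<lambda>x. 0)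
      (poisson theta_space \<theta> (first_order_adjoint (\<lambda>x. 1 / (2 * \<theta> x)) (\<lambda>x. 0) g)) =
      poisson v_space (v_of_theta \<theta>) g"
    using test_function_imp_smooth[OF g]
    by (simp add: first_order_def poisson_v_space D_rules smooth_intros)
qed (use points_smooth points_nonzero smooth_poisson in \<open>auto simp: smooth_intros poisson_eta_nz_space\<close>)

text \<open>One of the two nonlocal terms has a total derivative as integrand and becomes local. The
  other, \<open>K\<close>, persists in the bracket field but cancels between the two parts of the
  linearization.\<close>

lemma poisson_map_v_of_rho: "poisson_map rho_space v_space v_of_rho"
proof (rule poisson_map_first_orderI[OF substitution_v_of_rho])
  fix \<rho> a g
  assume "\<rho> \<in> points rho_space" and g: "test_function a g"
  then have \<rho>: "smooth \<rho>" "\<forall>x. \<rho> x \<noteq> 0" by (auto simp: rho_space_def)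
  obtain E where E: "smooth E" "\<forall>x. E x \<noteq> 0" "\<And>x. D E x = \<rho> x * E x"
    using exponential_primitive[OF \<rho>(1)] by blast
  note sg = test_function_imp_smooth[OF g]
  define f where "f = first_order_adjoint (\<lambda>x. 1 / (2 * \<rho> x)) (\<lambda>x. 1/2) g"
  have tf: "test_function a f"
    unfolding f_def
    by (intro test_function_first_order_adjoint g smooth_const) (use \<rho> in \<open>simp add: smooth_intros\<close>)
  \<comment> \<open>G is the compactly supported primitive of f \<rho>/E, so its derivative has
    integral 0 and sign transform g/E.\<close>
  define G where "G = (\<lambda>x. - 1/2 * (g x / E x))"
  have tG: "test_function a G"
    unfolding G_def by (intro test_function_intros g E smooth_const)
  have DG: "(\<lambda>x. f x * \<rho> x / E x) = D G"
    using \<rho> E sg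
    by (simp add: G_def f_def first_order_adjoint_def D_rules smooth_intros fun_eq_iff field_simps power2_eq_square)
  let ?h = "\<lambda>x. f x * \<rho> x * E x"
  have th: "test_function a ?h"
    by (intro test_function_intros tf \<rho> E)
  have h: "f x * \<rho> x * E x = 1/2 * (g x * \<rho> x - D g x) * E x" for x
    using \<rho> by (simp add: f_def first_order_adjoint_def field_simps)
  define K where "K = (\<lambda>y. sgn_transform ?h y - integral UNIV ?h)"
  have K: "smooth K"
    unfolding K_def by (intro smooth_diff smooth_const smooth_sgn_transform[OF th])
  have "D K = (\<lambda>x. - 2 * ?h x)"
    unfolding K_def D_diff[OF smooth_sgn_transform[OF th] smooth_const] D_sgn_transform[OF th] D_const by simp
  then have DK: "D K = (\<lambda>x. (D g x - g x * \<rho> x) * E x)"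
    unfolding h by (simp add: algebra_simps)
  have P: "poisson rho_space \<rho> f = (\<lambda>y. 1/2 * \<rho> y * (g y + K y / E y))"
    unfolding poisson_rho_space[OF tf \<rho>(1) E] DG sgn_transform_D[OF tG] integral_UNIV_D[OF tG]
    using E(2) by (simp add: K_def G_def)
  have "(\<lambda>x. 1 / (2 * \<rho> x) * poisson rho_space \<rho> f x) = (\<lambda>y. 1/4 * (g y + K y / E y))"
    unfolding P using \<rho>(2) by simp
  moreover have "D (\<lambda>y. 1/4 * (g y + K y / E y)) =
      (\<lambda>y. 1/4 * (2 * D g y - g y * \<rho> y - K y * \<rho> y / E y))"
    using E sg K by (simp add: D_rules smooth_intros DK fun_eq_iff) (simp add: field_simps power2_eq_square)
  ultimately show "first_order (\<lambda>x. 1 / (2 * \<rho> x)) (\<lambda>x. 1/2)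
      (poisson rho_space \<rho> (first_order_adjoint (\<lambda>x. 1 / (2 * \<rho> x)) (\<lambda>x. 1/2) g)) =
      poisson v_space (v_of_rho \<rho>) g"
    unfolding f_def[symmetric] using sg E(2)
    by (simp add: first_order_def poisson_v_space) (simp add: P fun_eq_iff field_simps)
qed (use points_smooth points_nonzero smooth_poisson in \<open>auto simp: smooth_intros poisson_eta_nz_space\<close>)

text \<open>Factorization of the Virasoro operator by the Miura map: the composite of \<partial> -
  2v, \<partial>/2 and -\<partial> - 2v is -\<partial>^3/2 - 2u\<partial> - u'.\<close>

lemma poisson_map_u_of_v: "poisson_map v_space u_space u_of_v"
proof (rule poisson_map_first_orderI[OF substitution_u_of_v])
  fix v a g
  assume "v \<in> points v_space" and g: "test_function a g"
  then have v: "smooth v" by (simp add: v_space_def)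
  note sg = test_function_imp_smooth[OF g]
  have "smooth (first_order_adjoint (\<lambda>x. 1) (\<lambda>x. - 2 * v x) g)" "smooth (u_of_v v)"
    using v sg by (simp_all add: first_order_adjoint_def u_of_v_def smooth_intros)
  then show "first_order (\<lambda>x. 1) (\<lambda>x. - 2 * v x)
      (poisson v_space v (first_order_adjoint (\<lambda>x. 1) (\<lambda>x. - 2 * v x) g)) =
      poisson u_space (u_of_v v) g"
    using v sg
    by (simp add: poisson_v_space poisson_u_space)
      (simp add: first_order_def first_order_adjoint_def u_of_v_def D_rules smooth_intros fun_eq_iff
        field_simps power2_eq_square)
qed (use points_smooth points_nonzero smooth_poisson in \<open>auto simp: smooth_intros poisson_eta_nz_space\<close>)

section \<open>The flows generated by the energy\<close>

text \<open>The family u is compared with a formula g only for small s and inside the period window,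
  since it may be irregular elsewhere.\<close>

lemma energy_derivative:
  fixes g g' :: "real \<Rightarrow> field"
  assumes "\<delta> > 0"
    and deriv: "\<And>s x. \<bar>s\<bar> < \<delta> \<Longrightarrow> x \<in> {a..a + 2 * pi} \<Longrightarrow>
      ((\<lambda>s. g s x) has_vector_derivative g' s x) (at s)"
    and cont: "continuous_on ({-\<delta><..<\<delta>} \<times> {a..a + 2 * pi}) (\<lambda>p. g (fst p) (snd p))"
      "continuous_on ({-\<delta><..<\<delta>} \<times> {a..a + 2 * pi}) (\<lambda>p. g' (fst p) (snd p))"
    and u: "\<And>s x. \<bar>s\<bar> < \<delta> \<Longrightarrow> x \<in> {a..a + 2 * pi} \<Longrightarrow> u s x = g s x"
  shows "((\<lambda>s. energy a (u s)) has_vector_derivative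
    integral {a..a + 2 * pi} (\<lambda>x. 2 * g 0 x * g' 0 x)) (at 0)"
proof -
  let ?U = "{-\<delta><..<\<delta>}" and ?I = "{a..a + 2 * pi}"
  have "((\<lambda>s. integral (cbox a (a + 2 * pi)) (\<lambda>x. (g s x)\<^sup>2)) has_vector_derivative
      integral (cbox a (a + 2 * pi)) (\<lambda>x. 2 * g 0 x * g' 0 x)) (at 0 within ?U)"
  proof (rule leibniz_rule_vector_derivative)
    fix s x assume s: "s \<in> ?U" and x: "x \<in> cbox a (a + 2 * pi)"
    then have d: "((\<lambda>s. g s x) has_vector_derivative g' s x) (at s within ?U)"
      by (intro has_vector_derivative_at_within[OF deriv]) auto
    show "((\<lambda>s. (g s x)\<^sup>2) has_vector_derivative 2 * g s x * g' s x) (at s within ?U)"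
      unfolding power2_eq_square
      by (rule has_vector_derivative_eq_rhs, rule has_vector_derivative_mult[OF d d]) simp
  next
    fix s assume s: "s \<in> ?U"
    have "continuous_on (cbox a (a + 2 * pi)) (\<lambda>x. g (fst (s, x)) (snd (s, x)))"
      by (rule continuous_on_compose2[OF cont(1), of _ "Pair s"])
        (use s in \<open>auto intro: continuous_on_Pair\<close>)
    then show "(\<lambda>x. (g s x)\<^sup>2) integrable_on cbox a (a + 2 * pi)"
      unfolding fst_conv snd_conv by (intro integrable_continuous continuous_on_power)
  next
    show "continuous_on (?U \<times> cbox a (a + 2 * pi)) (\<lambda>(s, x). 2 * g s x * g' s x)"
      unfolding split_beta box_real by (intro continuous_on_mult continuous_on_const cont)
  qed (use assms(1) in auto)
  moreover have "at 0 within ?U = at 0"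
    by (rule at_within_open) (use assms(1) in auto)
  ultimately have "((\<lambda>s. integral ?I (\<lambda>x. (g s x)\<^sup>2)) has_vector_derivative
      integral ?I (\<lambda>x. 2 * g 0 x * g' 0 x)) (at 0)"
    unfolding box_real by (simp only:)
  then show ?thesis
  proof (rule has_vector_derivative_transform_within_open)
    show "open ?U" "0 \<in> ?U"
      using assms(1) by auto
    show "integral ?I (\<lambda>x. (g s x)\<^sup>2) = energy a (u s)" if "s \<in> ?U" for s
      unfolding energy_def using that u by (intro integral_cong) auto
  qed
qed

text \<open>The function h is the first variation of U along the bracket field. Its support in the
  window turns the integral over a period into one over the line, where integration by parts against
  f is available.\<close>

lemma generated_by_energyI:
  assumes M: "perturbable M"
    and *: "\<And>a w f. w \<in> points M \<Longrightarrow> test_function a f \<Longrightarrow>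
      \<exists>h. test_function a h \<and>
        ((\<lambda>s. energy a (U (\<lambda>y. w y + of_real s * poisson M w f y))) has_vector_derivative
          integral {a..a + 2 * pi} (\<lambda>x. 2 * U w x * h x)) (at 0) \<and>
        smooth (U w) \<and>
        integral UNIV (\<lambda>x. h x * (2 * U w x)) = integral UNIV (\<lambda>x. f x * Z w x)"
  shows "generated_by_energy M U Z"
  unfolding generated_by_energy_def
proof (intro allI impI)
  fix a F w assume "w \<in> points M \<and> local_functional_at M a F w"
  then have w: "w \<in> points M" and "local_functional_at M a F w"
    by auto
  then obtain f where f: "has_variational_derivative M a F w f"
    unfolding local_functional_at_def by blast
  have adm: "w \<in> admissible M"
    using M w by (auto simp: perturbable_def)
  note vd = variational_derivative_eq[OF M adm f]
  obtain h where h: "test_function a h"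
    and dE: "((\<lambda>s. energy a (U (\<lambda>y. w y + of_real s * poisson M w f y))) has_vector_derivative
      integral {a..a + 2 * pi} (\<lambda>x. 2 * U w x * h x)) (at 0)"
    and int: "integral UNIV (\<lambda>x. h x * (2 * U w x)) = integral UNIV (\<lambda>x. f x * Z w x)"
    using *[OF w has_variational_derivative_imp_test_function[OF f]] by blast
  obtain c d where "a < c" "d < a + 2 * pi" "\<And>x. x \<notin> {c..d} \<Longrightarrow> h x = 0"
    by (rule test_functionE[OF h]) blast
  then have "integral UNIV (\<lambda>x. h x * (2 * U w x)) = integral {a..a + 2 * pi} (\<lambda>x. h x * (2 * U w x))"
    by (intro integral_UNIV_eq) auto
  also have "\<dots> = integral {a..a + 2 * pi} (\<lambda>x. 2 * U w x * h x)"
    by (simp add: algebra_simps)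
  finally show "((\<lambda>s. energy a (U (\<lambda>y. w y + of_real s * bracket_field M a F w y))) has_vector_derivative
      integral UNIV (\<lambda>x. variational_derivative M a F w x * Z w x)) (at 0)"
    using dE by (simp add: bracket_field_def vd int)
qed

text \<open>The linearization of \<open>u_rational k\<close> at p in direction P, kept in raw
  quotient rule form so that it matches the s-derivative taken under the integral at s = 0.\<close>

definition d_u_rational :: "complex \<Rightarrow> field \<Rightarrow> field \<Rightarrow> field" where
  "d_u_rational k p P = (\<lambda>x. 1/2 * ((D (D P) x * p x - D (D p) x * P x) / (p x)\<^sup>2)
    - 3/4 * (2 * (D p x / p x) * ((D P x * p x - D p x * P x) / (p x)\<^sup>2)) - k * (2 * p x * P x))"

text \<open>
  The perturbed field may vanish outside the window of integration, where \<open>P\<close> need not be bounded,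
  hence \<open>u\<close> is only required to be given by \<open>u_rational\<close> at points where it does not.
\<close>

lemma energy_derivative_u_rational:
  assumes p: "smooth p" "\<forall>x. p x \<noteq> 0" and P: "smooth P"
    and u: "\<And>s x. p x + of_real s * P x \<noteq> 0 \<Longrightarrow>
      u s x = u_rational k (\<lambda>x. p x + of_real s * P x) x"
  shows "((\<lambda>s. energy a (u s)) has_vector_derivative
    integral {a..a + 2 * pi} (\<lambda>x. 2 * u_rational k p x * d_u_rational k p P x)) (at 0)"
proof -
  let ?I = "{a..a + 2 * pi}"
  have "continuous_on ?I (\<lambda>x. P x / p x)"
    by (intro smooth_imp_continuous_on smooth_divide p P)
  then have "bounded ((\<lambda>x. P x / p x) ` ?I)"
    by (intro compact_imp_bounded compact_continuous_image) auto
  then obtain B where B: "B > 0" "\<And>x. x \<in> ?I \<Longrightarrow> norm (P x / p x) \<le> B"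
    by (auto simp: bounded_pos)
  \<comment> \<open>For |s| < 1/B the ratio sP/p has modulus below 1 on the window, so p + sP has no
    zero there.\<close>
  define \<delta> where "\<delta> = 1 / B"
  have nz: "p x + of_real s * P x \<noteq> 0" if "\<bar>s\<bar> < \<delta>" "x \<in> ?I" for s x
  proof
    assume "p x + of_real s * P x = 0"
    then have "of_real s * (P x / p x) = -1"
      using p(2) by (simp add: field_simps eq_neg_iff_add_eq_0 add.commute)
    then have "\<bar>s\<bar> * norm (P x / p x) = 1"
      by (metis norm_minus_cancel norm_mult norm_of_real norm_one)
    moreover have "\<bar>s\<bar> * norm (P x / p x) \<le> \<bar>s\<bar> * B"
      by (intro mult_left_mono B that) simp
    moreover have "\<bar>s\<bar> * B < 1"
      using that(1) B(1) by (simp add: \<delta>_def field_simps)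
    ultimately show False
      by simp
  qed
  define q Q r R where "q = D p" and "Q = D P" and "r = D q" and "R = D Q"
  have sm: "smooth q" "smooth Q" "smooth r" "smooth R"
    using p P by (simp_all add: q_def Q_def r_def R_def smooth_D)
  let ?p = "\<lambda>s x. p x + of_real s * P x" and ?q = "\<lambda>s x. q x + of_real s * Q x"
    and ?r = "\<lambda>s x. r x + of_real s * R x"
  define g where "g = (\<lambda>s x. 1/2 * (?r s x / ?p s x) - 3/4 * (?q s x / ?p s x)\<^sup>2 - k * (?p s x)\<^sup>2)"
  define g' where "g' = (\<lambda>s x. 1/2 * ((R x * ?p s x - ?r s x * P x) / (?p s x)\<^sup>2)
    - 3/4 * (2 * (?q s x / ?p s x) * ((Q x * ?p s x - ?q s x * P x) / (?p s x)\<^sup>2)) - k * (2 * ?p s x * P x))"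
  have lin: "((\<lambda>s. f x + of_real s * F x) has_vector_derivative F x) (at s)" for f F :: field and s x
  proof -
    have "((\<lambda>s. complex_of_real s) has_vector_derivative 1) (at s)"
      using has_vector_derivative_of_real[OF DERIV_ident] by simp
    from has_vector_derivative_add[OF has_vector_derivative_const has_vector_derivative_mult_left[OF this]]
    show ?thesis
      by simp
  qed
  have sq: "((\<lambda>s. (f s)\<^sup>2) has_vector_derivative 2 * f s * f') (at s)"
    if "(f has_vector_derivative f') (at s)" for f :: field and f' s
    unfolding power2_eq_square
    by (rule has_vector_derivative_eq_rhs, rule has_vector_derivative_mult[OF that that]) simp
  have "((\<lambda>s. energy a (u s)) has_vector_derivative
      integral {a..a + 2 * pi} (\<lambda>x. 2 * g 0 x * g' 0 x)) (at 0)"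
  proof (rule energy_derivative)
    show "\<delta> > 0"
      using B(1) by (simp add: \<delta>_def)
    show "((\<lambda>s. g s x) has_vector_derivative g' s x) (at s)" if "\<bar>s\<bar> < \<delta>" "x \<in> ?I" for s x
      unfolding g_def g'_def
      by (intro has_vector_derivative_diff has_vector_derivative_mult_right sq
          has_vector_derivative_quotient lin nz[OF that])
    have c: "continuous_on A (\<lambda>p. f (snd p))" if "smooth f" for f :: field and A :: "(real \<times> real) set"
      by (rule continuous_on_compose2[OF smooth_imp_continuous_on[OF that, of UNIV]])
        (auto intro: continuous_intros)
    have n: "\<forall>z\<in>{-\<delta><..<\<delta>} \<times> ?I. p (snd z) + of_real (fst z) * P (snd z) \<noteq> 0"
      using nz by auto
    then have n2: "\<forall>z\<in>{-\<delta><..<\<delta>} \<times> ?I. (p (snd z) + of_real (fst z) * P (snd z))\<^sup>2 \<noteq> 0"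
      by simp
    show "continuous_on ({-\<delta><..<\<delta>} \<times> ?I) (\<lambda>z. g (fst z) (snd z))"
      "continuous_on ({-\<delta><..<\<delta>} \<times> ?I) (\<lambda>z. g' (fst z) (snd z))"
      unfolding g_def g'_def by (intro continuous_intros c sm p P n n2)+
    show "u s x = g s x" if "\<bar>s\<bar> < \<delta>" "x \<in> ?I" for s x
    proof -
      have D1: "D (?p s) = ?q s" "D (?q s) = ?r s"
        using p P sm by (simp_all add: D_rules smooth_intros q_def Q_def r_def R_def)
      then show ?thesis
        using u[OF nz[OF that]] by (simp add: u_rational_def g_def)
    qed
  qed
  moreover have "g 0 = u_rational k p" "g' 0 = d_u_rational k p P"
    by (simp_all add: g_def g'_def u_rational_def d_u_rational_def q_def Q_def r_def R_def fun_eq_iff)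
  ultimately show ?thesis
    by simp
qed

section \<open>Generation of each of the five flows by the energy\<close>

lemma smooth_u_rational:
  "smooth p \<Longrightarrow> \<forall>x. p x \<noteq> 0 \<Longrightarrow> smooth (u_rational k p)"
  unfolding u_rational_def by (intro smooth_intros) auto

lemma generated_by_energy_eta: "generated_by_energy eta_space u_of_eta eta_rhs"
proof (rule generated_by_energyI[OF perturbable_eta_space])
  fix a \<eta> f assume "\<eta> \<in> points eta_space" and f: "test_function a f"
  then have \<eta>: "smooth \<eta>" "\<forall>x. D \<eta> x \<noteq> 0"
    by (auto simp: points_smooth points_nonzero)
  define X where "X = poisson eta_space \<eta> f"
  have X: "smooth X"
    unfolding X_def by (rule smooth_poisson(1)[OF f \<eta>(1)])
  have DX: "D (\<lambda>y. \<eta> y + of_real s * X y) = (\<lambda>y. D \<eta> y + of_real s * D X y)" for s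
    using \<eta> X by (simp add: D_rules smooth_intros)
  have "((\<lambda>s. energy a (u_of_eta (\<lambda>y. \<eta> y + of_real s * X y))) has_vector_derivative
      integral {a..a + 2 * pi} (\<lambda>x. 2 * u_rational 0 (D \<eta>) x * d_u_rational 0 (D \<eta>) (D X) x)) (at 0)"
    by (rule energy_derivative_u_rational)
      (use \<eta> X in \<open>auto simp: smooth_D u_of_eta_eq DX\<close>)
  moreover have "d_u_rational 0 (D \<eta>) (D X) = (\<lambda>x. f x * D \<eta> x)"
  proof -
    have tf: "test_function a (\<lambda>x. f x * \<eta> x)"
      by (intro test_function_intros f \<eta>)
    \<comment> \<open>Perturbing p by pJ changes u by J''/2 - p'J'/(2p). For p = \<eta>' the chain
      J' = pK, K' = 2f makes the nonlocal K cancel and leaves f p.\<close>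
    define J K where "J = (\<lambda>y. sgn_transform (\<lambda>x. f x * \<eta> x) y - \<eta> y * sgn_transform f y - \<eta> y * integral UNIV f)"
      and "K = (\<lambda>y. - sgn_transform f y - integral UNIV f)"
    have JK: "smooth J" "smooth K" "D J = (\<lambda>y. D \<eta> y * K y)" "D K = (\<lambda>y. 2 * f y)"
      using \<eta> smooth_sgn_transform[OF f] smooth_sgn_transform[OF tf]
      by (simp_all add: J_def K_def D_rules smooth_intros D_sgn_transform[OF f] D_sgn_transform[OF tf])
        (simp_all add: algebra_simps)
    have DX_eq: "D X = (\<lambda>y. D \<eta> y * J y)"
      unfolding X_def D_poisson_eta_space[OF f \<eta>(1)] J_def ..
    show ?thesis
      unfolding DX_eq using \<eta> JK(1,2) test_function_imp_smooth[OF f]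
      by (simp add: d_u_rational_def D_rules smooth_intros JK(3,4) fun_eq_iff)
        (simp add: field_simps power2_eq_square)
  qed
  moreover have "test_function a (\<lambda>x. f x * D \<eta> x)"
    by (intro test_function_intros f smooth_D \<eta>)
  ultimately show "\<exists>h. test_function a h \<and>
      ((\<lambda>s. energy a (u_of_eta (\<lambda>y. \<eta> y + of_real s * poisson eta_space \<eta> f y))) has_vector_derivative
        integral {a..a + 2 * pi} (\<lambda>x. 2 * u_of_eta \<eta> x * h x)) (at 0) \<and>
      smooth (u_of_eta \<eta>) \<and>
      integral UNIV (\<lambda>x. h x * (2 * u_of_eta \<eta> x)) = integral UNIV (\<lambda>x. f x * eta_rhs \<eta> x)"
    using smooth_u_rational[OF smooth_D[OF \<eta>(1)] \<eta>(2)]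
    by (intro exI[of _ "\<lambda>x. f x * D \<eta> x"])
      (simp add: X_def[symmetric] u_of_eta_eq eta_rhs_eq ac_simps)
qed

lemma generated_by_energy_theta: "generated_by_energy theta_space (u_of_v \<circ> v_of_theta) theta_rhs"
proof (rule generated_by_energyI[OF perturbable_theta_space])
  fix a \<theta> f assume "\<theta> \<in> points theta_space" and f: "test_function a f"
  then have \<theta>: "smooth \<theta>" "\<forall>x. \<theta> x \<noteq> 0"
    by (auto simp: points_smooth points_nonzero)
  define X where "X = poisson theta_space \<theta> f"
  have X: "smooth X"
    unfolding X_def by (rule smooth_poisson(2)[OF f \<theta>(1)])
  have u: "(u_of_v \<circ> v_of_theta) \<theta> = u_rational 0 \<theta>"
    using \<theta> by (auto simp: u_of_v_of_theta_eq)
  have dE: "((\<lambda>s. energy a ((u_of_v \<circ> v_of_theta) (\<lambda>y. \<theta> y + of_real s * X y))) has_vector_derivative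
      integral {a..a + 2 * pi} (\<lambda>x. 2 * u_rational 0 \<theta> x * d_u_rational 0 \<theta> X x)) (at 0)"
    by (rule energy_derivative_u_rational)
      (use \<theta> X in \<open>auto simp: u_of_v_of_theta_eq smooth_intros\<close>)
  note sf = test_function_imp_smooth[OF f]
  have dX: "d_u_rational 0 \<theta> X = (\<lambda>x. - (D f x * \<theta> x))"
  proof -
    have tf: "test_function a (\<lambda>x. f x * \<theta> x)"
      by (intro test_function_intros f \<theta>)
    \<comment> \<open>Perturbing \<theta> by \<theta>J changes u by J''/2 - \<theta>'J'/(2\<theta>).
      Only derivatives of J occur, and J' = -2f\<theta> is local.\<close>
    define J where "J = sgn_transform (\<lambda>x. f x * \<theta> x)"
    have J: "smooth J" "D J = (\<lambda>y. - 2 * (f y * \<theta> y))"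
      unfolding J_def by (rule smooth_sgn_transform[OF tf], rule D_sgn_transform[OF tf])
    have X_eq: "X = (\<lambda>y. \<theta> y * J y)"
      unfolding X_def poisson_theta_space J_def ..
    show ?thesis
      unfolding X_eq using \<theta> J(1) sf
      by (simp add: d_u_rational_def D_rules smooth_intros J(2) fun_eq_iff)
        (simp add: field_simps power2_eq_square)
  qed
  note su = smooth_u_rational[OF \<theta>, of 0]
  have "integral UNIV (\<lambda>x. - (D f x * \<theta> x) * (2 * u_rational 0 \<theta> x)) =
      integral UNIV (\<lambda>x. f x * D (\<lambda>x. 2 * u_rational 0 \<theta> x * \<theta> x) x)"
    using integral_by_parts[OF f, of "\<lambda>x. 2 * u_rational 0 \<theta> x * \<theta> x"] \<theta> su
    by (simp add: smooth_intros ac_simps)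
  moreover have "theta_rhs \<theta> = D (\<lambda>x. 2 * u_rational 0 \<theta> x * \<theta> x)"
    using u by (simp add: theta_rhs_eq[OF \<theta>] fun_eq_iff)
  moreover have "test_function a (\<lambda>x. - (D f x * \<theta> x))"
    by (intro test_function_intros f \<theta>)
  ultimately show "\<exists>h. test_function a h \<and>
      ((\<lambda>s. energy a ((u_of_v \<circ> v_of_theta) (\<lambda>y. \<theta> y + of_real s * poisson theta_space \<theta> f y)))
        has_vector_derivative
        integral {a..a + 2 * pi} (\<lambda>x. 2 * (u_of_v \<circ> v_of_theta) \<theta> x * h x)) (at 0) \<and>
      smooth ((u_of_v \<circ> v_of_theta) \<theta>) \<and>
      integral UNIV (\<lambda>x. h x * (2 * (u_of_v \<circ> v_of_theta) \<theta> x)) = integral UNIV (\<lambda>x. f x * theta_rhs \<theta> x)"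
    unfolding u X_def[symmetric] using dE su dX by (intro exI[of _ "\<lambda>x. - (D f x * \<theta> x)"]) simp
qed

lemma generated_by_energy_rho: "generated_by_energy rho_space (u_of_v \<circ> v_of_rho) rho_rhs"
proof (rule generated_by_energyI[OF perturbable_rho_space])
  fix a \<rho> f assume "\<rho> \<in> points rho_space" and f: "test_function a f"
  then have \<rho>: "smooth \<rho>" "\<forall>x. \<rho> x \<noteq> 0"
    by (auto simp: points_smooth points_nonzero)
  define X where "X = poisson rho_space \<rho> f"
  have X: "smooth X"
    unfolding X_def by (rule smooth_poisson(3)[OF f \<rho>(1)])
  have u: "(u_of_v \<circ> v_of_rho) \<rho> = u_rational (1/4) \<rho>"
    using \<rho> by (auto simp: u_of_v_of_rho_eq)
  have dE: "((\<lambda>s. energy a ((u_of_v \<circ> v_of_rho) (\<lambda>y. \<rho> y + of_real s * X y))) has_vector_derivative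
      integral {a..a + 2 * pi} (\<lambda>x. 2 * u_rational (1/4) \<rho> x * d_u_rational (1/4) \<rho> X x)) (at 0)"
    by (rule energy_derivative_u_rational)
      (use \<rho> X in \<open>auto simp: u_of_v_of_rho_eq smooth_intros\<close>)
  note sf = test_function_imp_smooth[OF f]
  have dX: "d_u_rational (1/4) \<rho> X = (\<lambda>x. - (D f x * \<rho> x))"
  proof -
    obtain E where E: "smooth E" "\<forall>x. E x \<noteq> 0" "\<And>x. D E x = \<rho> x * E x"
      using exponential_primitive[OF \<rho>(1)] by blast
    have t: "test_function a (\<lambda>x. f x * \<rho> x / E x)" "test_function a (\<lambda>x. f x * \<rho> x * E x)"
      by (intro test_function_intros f \<rho> E)+
    define J K where "J = (\<lambda>y. integral UNIV (\<lambda>x. f x * \<rho> x / E x) + sgn_transform (\<lambda>x. f x * \<rho> x / E x) y)"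
      and "K = (\<lambda>y. sgn_transform (\<lambda>x. f x * \<rho> x * E x) y - integral UNIV (\<lambda>x. f x * \<rho> x * E x))"
    have JK: "smooth J" "smooth K"
      unfolding J_def K_def
      by (intro smooth_add smooth_diff smooth_const smooth_sgn_transform[OF t(1)] smooth_sgn_transform[OF t(2)])+
    have DJK: "D J = (\<lambda>y. - 2 * (f y * \<rho> y / E y))" "D K = (\<lambda>y. - 2 * (f y * \<rho> y * E y))"
      unfolding J_def K_def
        D_add[OF smooth_const smooth_sgn_transform[OF t(1)]] D_diff[OF smooth_sgn_transform[OF t(2)] smooth_const]
        D_sgn_transform[OF t(1)] D_sgn_transform[OF t(2)] D_const
      by simp_all
    \<comment> \<open>\<open>Y\<close> and \<open>Y'\<close> resemble a pair cosh, sinh: up to the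
      factor \<rho> and a local term in f', differentiation exchanges them. The term -2f in
      \<open>Y'\<close> absorbs the local part of the derivative of \<open>Y\<close>. In the
      variation Y''/2 - \<rho>'Y'/(2\<rho>) - \<rho>^2 Y/2, primes here being derivatives,
      everything nonlocal then cancels.\<close>
    define Y where "Y = (\<lambda>y. 1/2 * (E y * J y + K y / E y))"
    define Y' where "Y' = (\<lambda>y. 1/2 * (E y * J y - K y / E y) - 2 * f y)"
    have sY: "smooth Y" "smooth Y'"
      using E JK sf by (simp_all add: Y_def Y'_def smooth_intros)
    have DY: "D Y = (\<lambda>y. \<rho> y * Y' y)"
      using E JK sf
      by (simp add: Y_def Y'_def D_rules smooth_intros DJK fun_eq_iff)
        (simp add: field_simps power2_eq_square)
    have DY': "D Y' = (\<lambda>y. \<rho> y * Y y - 2 * D f y)"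
      using E JK sf
      by (simp add: Y_def Y'_def D_rules smooth_intros DJK fun_eq_iff)
        (simp add: field_simps power2_eq_square)
    have X_eq: "X = (\<lambda>y. \<rho> y * Y y)"
      unfolding X_def poisson_rho_space[OF f \<rho>(1) E] Y_def J_def K_def by simp
    show ?thesis
      unfolding X_eq using \<rho> sY sf
      by (simp add: d_u_rational_def D_rules smooth_intros DY DY' fun_eq_iff)
        (simp add: field_simps power2_eq_square)
  qed
  note su = smooth_u_rational[OF \<rho>, of "1/4"]
  have "integral UNIV (\<lambda>x. - (D f x * \<rho> x) * (2 * u_rational (1/4) \<rho> x)) =
      integral UNIV (\<lambda>x. f x * D (\<lambda>x. 2 * u_rational (1/4) \<rho> x * \<rho> x) x)"
    using integral_by_parts[OF f, of "\<lambda>x. 2 * u_rational (1/4) \<rho> x * \<rho> x"] \<rho> su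
    by (simp add: smooth_intros ac_simps)
  moreover have "rho_rhs \<rho> = D (\<lambda>x. 2 * u_rational (1/4) \<rho> x * \<rho> x)"
    using u by (simp add: rho_rhs_eq[OF \<rho>] fun_eq_iff)
  moreover have "test_function a (\<lambda>x. - (D f x * \<rho> x))"
    by (intro test_function_intros f \<rho>)
  ultimately show "\<exists>h. test_function a h \<and>
      ((\<lambda>s. energy a ((u_of_v \<circ> v_of_rho) (\<lambda>y. \<rho> y + of_real s * poisson rho_space \<rho> f y)))
        has_vector_derivative
        integral {a..a + 2 * pi} (\<lambda>x. 2 * (u_of_v \<circ> v_of_rho) \<rho> x * h x)) (at 0) \<and>
      smooth ((u_of_v \<circ> v_of_rho) \<rho>) \<and>
      integral UNIV (\<lambda>x. h x * (2 * (u_of_v \<circ> v_of_rho) \<rho> x)) = integral UNIV (\<lambda>x. f x * rho_rhs \<rho> x)"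
    unfolding u X_def[symmetric] using dE su dX by (intro exI[of _ "\<lambda>x. - (D f x * \<rho> x)"]) simp
qed

text \<open>For v and u the bracket field is local and the perturbed u is a polynomial in s of
  degree at most 2, so only its linear coefficient matters at s = 0.\<close>

lemma energy_derivative_polynomial:
  assumes "smooth p" "smooth q" "smooth r"
    and "\<And>s x. u s x = p x + of_real s * q x - (of_real s)\<^sup>2 * r x"
  shows "((\<lambda>s. energy a (u s)) has_vector_derivative
    integral {a..a + 2 * pi} (\<lambda>x. 2 * p x * q x)) (at 0)"
proof -
  have c: "continuous_on A (\<lambda>p. f (snd p))" if "smooth f" for f :: field and A :: "(real \<times> real) set"
    by (rule continuous_on_compose2[OF smooth_imp_continuous_on[OF that, of UNIV]])
      (auto intro: continuous_intros)
  have id: "((\<lambda>s. complex_of_real s) has_vector_derivative 1) (at s)" for s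
    using has_vector_derivative_of_real[OF DERIV_ident] by simp
  have "((\<lambda>s. energy a (u s)) has_vector_derivative integral {a..a + 2 * pi}
      (\<lambda>x. 2 * (p x + of_real 0 * q x - (of_real 0 * of_real 0) * r x) * (q x - 2 * of_real 0 * r x))) (at 0)"
  proof (rule energy_derivative[where \<delta> = 1])
    show "((\<lambda>s. p x + of_real s * q x - (of_real s * of_real s) * r x) has_vector_derivative
        q x - 2 * of_real s * r x) (at s)" for s x
    proof -
      have "((\<lambda>s. p x + of_real s * q x - (of_real s * of_real s) * r x) has_vector_derivative
          0 + 1 * q x - (of_real s * 1 + 1 * of_real s) * r x) (at s)"
        by (intro has_vector_derivative_diff has_vector_derivative_add has_vector_derivative_const
            has_vector_derivative_mult_left has_vector_derivative_mult id)
      then show ?thesis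
        by (rule has_vector_derivative_eq_rhs) simp
    qed
  qed (use assms in \<open>auto simp: power2_eq_square intro!: continuous_intros c\<close>)
  then show ?thesis
    by simp
qed

lemma generated_by_energy_v: "generated_by_energy v_space u_of_v v_rhs"
proof (rule generated_by_energyI[OF perturbable_v_space])
  fix a v f assume "v \<in> points v_space" and f: "test_function a f"
  then have v: "smooth v"
    by (simp add: points_smooth)
  note sf = test_function_imp_smooth[OF f]
  define u where "u = u_of_v v"
  have u: "smooth u"
    using v by (simp add: u_def u_of_v_def smooth_intros)
  let ?X = "\<lambda>y. 1/2 * D f y" and ?h = "\<lambda>x. 1/2 * D (D f) x - D f x * v x"
  have th: "test_function a ?h"
    by (intro test_function_intros f v smooth_const)
  have dE: "((\<lambda>s. energy a (u_of_v (\<lambda>y. v y + of_real s * ?X y))) has_vector_derivative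
      integral {a..a + 2 * pi} (\<lambda>x. 2 * u x * ?h x)) (at 0)"
  \<comment> \<open>The quadratic coefficient comes from -v^2 and is minus the square of the bracket
    field.\<close>
  proof (rule energy_derivative_polynomial[where r = "\<lambda>x. (?X x)\<^sup>2"])
    show "u_of_v (\<lambda>y. v y + of_real s * ?X y) x = u x + of_real s * ?h x - (of_real s)\<^sup>2 * (?X x)\<^sup>2" for s x
      using v sf by (simp add: u_def u_of_v_def D_rules smooth_intros) (simp add: field_simps power2_eq_square)
  qed (use u v sf in \<open>simp_all add: smooth_intros\<close>)
  have "integral UNIV (\<lambda>x. ?h x * (2 * u x)) = integral UNIV (\<lambda>x. D (D f) x * u x - D f x * (2 * u x * v x))"
    by (simp add: algebra_simps)
  also have "\<dots> = integral UNIV (\<lambda>x. D (D f) x * u x) - integral UNIV (\<lambda>x. D f x * (2 * u x * v x))"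
    by (intro integral_unique has_integral_diff test_function_has_integral[of a] test_function_mult_left
        test_function_D f smooth_mult smooth_const u v)
  also have "\<dots> = - (integral UNIV (\<lambda>x. D f x * D u x) + integral UNIV (\<lambda>x. D f x * (2 * u x * v x)))"
    by (simp add: integral_by_parts[OF test_function_D[OF f] u])
  also have "integral UNIV (\<lambda>x. D f x * D u x) + integral UNIV (\<lambda>x. D f x * (2 * u x * v x)) =
      integral UNIV (\<lambda>x. D f x * D u x + D f x * (2 * u x * v x))"
    by (rule integral_unique[symmetric], rule has_integral_add; rule test_function_has_integral[of a];
        intro test_function_mult_left test_function_D f smooth_mult smooth_const u v smooth_D)
  also have "\<dots> = integral UNIV (\<lambda>x. D f x * (D u x + 2 * u x * v x))"
    by (simp add: algebra_simps)
  also have "\<dots> = - integral UNIV (\<lambda>x. f x * v_rhs v x)"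
    unfolding v_rhs_eq[OF v] u_def[symmetric]
    by (rule integral_by_parts[OF f]) (intro smooth_intros u v)
  finally have int: "integral UNIV (\<lambda>x. ?h x * (2 * u x)) = integral UNIV (\<lambda>x. f x * v_rhs v x)"
    by simp
  show "\<exists>h. test_function a h \<and>
      ((\<lambda>s. energy a (u_of_v (\<lambda>y. v y + of_real s * poisson v_space v f y))) has_vector_derivative
        integral {a..a + 2 * pi} (\<lambda>x. 2 * u_of_v v x * h x)) (at 0) \<and>
      smooth (u_of_v v) \<and>
      integral UNIV (\<lambda>x. h x * (2 * u_of_v v x)) = integral UNIV (\<lambda>x. f x * v_rhs v x)"
    unfolding poisson_v_space[OF sf] u_def[symmetric] by (intro exI[of _ ?h] conjI th dE u int)
qed

lemma generated_by_energy_u: "generated_by_energy u_space (\<lambda>u. u) u_rhs"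
proof (rule generated_by_energyI[OF perturbable_u_space])
  fix a u f assume "u \<in> points u_space" and f: "test_function a f"
  then have u: "smooth u"
    by (simp add: points_smooth)
  note sf = test_function_imp_smooth[OF f]
  let ?h = "\<lambda>x. - 1/2 * D (D (D f)) x - 2 * u x * D f x - D u x * f x"
  have th: "test_function a ?h"
    by (intro test_function_intros smooth_mult smooth_const smooth_D f u)
  have dE: "((\<lambda>s. energy a (\<lambda>y. u y + of_real s * ?h y)) has_vector_derivative
      integral {a..a + 2 * pi} (\<lambda>x. 2 * u x * ?h x)) (at 0)"
    by (rule energy_derivative_polynomial[where r = "\<lambda>x. 0"])
      (use u sf in \<open>simp_all add: smooth_intros\<close>)
  note t = test_function_has_integral[of a]
  have 1: "integral UNIV (\<lambda>x. D (D (D f)) x * u x) = - integral UNIV (\<lambda>x. f x * D (D (D u)) x)"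
    using u by (simp add: integral_by_parts[OF test_function_D[OF test_function_D[OF f]]]
        integral_by_parts[OF test_function_D[OF f]] integral_by_parts[OF f] smooth_D)
  \<comment> \<open>This yields 8 u u'; together with -2 u u' from the undifferentiated term it
    makes the 6 u u' of the KdV equation.\<close>
  have 2: "integral UNIV (\<lambda>x. D f x * (4 * (u x)\<^sup>2)) = - integral UNIV (\<lambda>x. f x * (8 * u x * D u x))"
  proof -
    have "D (\<lambda>x. 4 * (u x)\<^sup>2) = (\<lambda>x. 8 * u x * D u x)"
      using u by (simp add: D_rules smooth_intros mult.assoc)
    then show ?thesis
      using integral_by_parts[OF f, of "\<lambda>x. 4 * (u x)\<^sup>2"] u by (simp add: smooth_intros)
  qed
  have "integral UNIV (\<lambda>x. ?h x * (2 * u x)) =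
      integral UNIV (\<lambda>x. - (D (D (D f)) x * u x) - D f x * (4 * (u x)\<^sup>2) - f x * (2 * u x * D u x))"
    by (simp add: algebra_simps power2_eq_square)
  also have "\<dots> = - integral UNIV (\<lambda>x. D (D (D f)) x * u x) - integral UNIV (\<lambda>x. D f x * (4 * (u x)\<^sup>2))
      - integral UNIV (\<lambda>x. f x * (2 * u x * D u x))"
    by (intro integral_unique has_integral_diff has_integral_neg t test_function_mult_left
        test_function_D f smooth_mult smooth_const smooth_power smooth_D u)
  also have "\<dots> = integral UNIV (\<lambda>x. f x * D (D (D u)) x) + integral UNIV (\<lambda>x. f x * (8 * u x * D u x))
      - integral UNIV (\<lambda>x. f x * (2 * u x * D u x))"
    unfolding 1 2 by simp
  also have "\<dots> = integral UNIV (\<lambda>x. f x * D (D (D u)) x + f x * (8 * u x * D u x) - f x * (2 * u x * D u x))"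
    by (rule integral_unique[symmetric])
      (intro has_integral_diff has_integral_add t test_function_mult_left
        f smooth_mult smooth_const smooth_D u)
  also have "\<dots> = integral UNIV (\<lambda>x. f x * u_rhs u x)"
    by (simp add: u_rhs_def funpow_D algebra_simps)
  finally have int: "integral UNIV (\<lambda>x. ?h x * (2 * u x)) = integral UNIV (\<lambda>x. f x * u_rhs u x)" .
  show "\<exists>h. test_function a h \<and>
      ((\<lambda>s. energy a (\<lambda>y. u y + of_real s * poisson u_space u f y)) has_vector_derivative
        integral {a..a + 2 * pi} (\<lambda>x. 2 * u x * h x)) (at 0) \<and>
      smooth u \<and> integral UNIV (\<lambda>x. h x * (2 * u x)) = integral UNIV (\<lambda>x. f x * u_rhs u x)"
    unfolding poisson_u_space[OF sf u] by (intro exI[of _ ?h] conjI th dE u int)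
qed

text \<open>The factorization through \<theta> is the one available on all of
  \<open>eta_space\<close>; the one through \<rho> is restricted to curves without zeros.\<close>

lemma v_of_eta_comp: "v_of_eta = (\<lambda>\<eta>. v_of_theta (theta_of_eta \<eta>))"
  by (simp add: v_of_theta_of_eta)

lemma points_eta_space: "\<eta> \<in> points eta_space \<Longrightarrow> \<eta> \<in> admissible eta_space"
  by (simp add: eta_space_def)

theorem proposition2p16:
  shows
    "(poisson_map eta_nz_space rho_space rho_of_eta \<and>
     poisson_map eta_space theta_space theta_of_eta \<and>
     poisson_map eta_space v_space v_of_eta \<and>
     poisson_map eta_space u_space u_of_eta \<and>
     poisson_map rho_space v_space v_of_rho \<and>
     poisson_map theta_space v_space v_of_theta \<and>
     poisson_map v_space u_space u_of_v) \<and>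
     (\<forall>\<eta> \<in> admissible eta_nz_space. v_of_rho (rho_of_eta \<eta>) = v_of_eta \<eta>) \<and>
     (\<forall>\<eta> \<in> admissible eta_space. v_of_theta (theta_of_eta \<eta>) = v_of_eta \<eta>) \<and>
     (\<forall>\<eta> \<in> admissible eta_space. u_of_v (v_of_eta \<eta>) = u_of_eta \<eta>) \<and>
     (generated_by_energy eta_space u_of_eta eta_rhs \<and>
     generated_by_energy rho_space (u_of_v \<circ> v_of_rho) rho_rhs \<and>
     generated_by_energy theta_space (u_of_v \<circ> v_of_theta) theta_rhs \<and>
     generated_by_energy v_space u_of_v v_rhs \<and>
     generated_by_energy u_space (\<lambda>u. u) u_rhs) \<and>
     (carries_solutions eta_nz_space eta_rhs rho_space rho_rhs rho_of_eta \<and>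
     carries_solutions eta_space eta_rhs theta_space theta_rhs theta_of_eta \<and>
     carries_solutions eta_space eta_rhs v_space v_rhs v_of_eta \<and>
     carries_solutions eta_space eta_rhs u_space u_rhs u_of_eta \<and>
     carries_solutions rho_space rho_rhs v_space v_rhs v_of_rho \<and>
     carries_solutions theta_space theta_rhs v_space v_rhs v_of_theta \<and>
     carries_solutions v_space v_rhs u_space u_rhs u_of_v)"
proof -
  have pv: "poisson_map eta_space v_space v_of_eta"
    unfolding v_of_eta_comp by (rule poisson_map_comp[OF poisson_map_theta_of_eta poisson_map_v_of_theta])
  have pu: "poisson_map eta_space u_space u_of_eta"
    by (rule poisson_map_cong[OF poisson_map_comp[OF pv poisson_map_u_of_v] perturbable_eta_space])
      (simp add: u_of_v_of_eta)
  have cv: "carries_solutions eta_space eta_rhs v_space v_rhs v_of_eta"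
    unfolding v_of_eta_comp by (rule carries_solutions_comp[OF carries_theta_of_eta carries_v_of_theta])
  have cu: "carries_solutions eta_space eta_rhs u_space u_rhs u_of_eta"
    by (rule carries_solutions_cong[OF carries_solutions_comp[OF cv carries_u_of_v]])
      (simp add: u_of_v_of_eta points_eta_space)
  show ?thesis
    by (intro conjI ballI pv pu cv cu poisson_map_rho_of_eta poisson_map_theta_of_eta
        poisson_map_v_of_rho poisson_map_v_of_theta poisson_map_u_of_v
        v_of_rho_of_eta v_of_theta_of_eta u_of_v_of_eta
        generated_by_energy_eta generated_by_energy_rho generated_by_energy_theta
        generated_by_energy_v generated_by_energy_u
        carries_rho_of_eta carries_theta_of_eta carries_v_of_rho carries_v_of_theta carries_u_of_v)
qed

end
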